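(* The following non-containments hold in $\mathbb P^{34}$: (1) $\mathcal F_{[441b]}\not\subset\overline{\mathcal F_{[550]}}$; (2) $\mathcal F_{[550]}\not\subset\overline{\mathcal F_{[441a]}}$; (3) $\mathcal F_{[331]}\not\subset\overline{\mathcal F_{[420]}}$; (4) $\mathcal F_{[210]}\not\subset\overline{\mathcal F_{[300a]}}$; (5) $\mathcal F_{[331]}\not\subset\overline{\mathcal F_{[320]}}$.
   Context: Let $S=\mathbb C[x_0,\dots,x_3]$ act on $R=\mathbb C[y_0,\dots,y_3]$ by differentiation. For $F\in R_4$, $F^\perp=\{G\in S\mid G(F)=0\}$, $A_F=S/F^\perp$; $F$ is nondegenerate if $F^\perp$ contains no linear form. $\mathcal F_{[b_{12}b_{23}b_{34}]}\subset\mathbb P(R_4)=\mathbb P^{34}$ is the set of classes of nondegenerate $F$ with $\dim_{\mathbb C}\operatorname{Tor}_i^S(A_F,\mathbb C)_{i+1}=b_{i,i+1}$ for $i=1,2,3$. Let $Q_F$ be the ideal generated by the quadrics in $F^\perp$. $\mathcal F_{[300a]}$ is the set of $F\in\mathcal F_{[300]}$ with $Q_F$ a complete intersection of three quadrics and such that the minimal length of a zero-dimensional scheme $\Gamma\subset\mathbb P(R_1)$ with $I_\Gamma\subset F^\perp$ is $8$. For $F\in\mathcal F_{[441]}$ the ideal $Q_F$ has a unique (up to scalar) linear second syzygy in $\operatorname{Tor}_3^S(S/Q_F,\mathbb C)_4$; its rank is the number of linearly independent linear first syzygies it involves. $\mathcal F_{[441a]}$ (resp. $\mathcal F_{[441b]}$)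 is the set of $F\in\mathcal F_{[441]}$ for which this rank is $3$ (resp. $4$). Closures are Zariski closures in $\mathbb P^{34}$. *)

theory Defs
  imports Complex_Main "HOL-Library.Poly_Mapping" "HOL-Library.Function_Algebras"
    "HOL-Library.Numeral_Type"
begin

text \<open>
  Polynomials are finitely supported functions from exponents to coefficients. Both
  \<open>S = \<complex>[x\<^sub>0,\<dots>,x\<^sub>3]\<close> and \<open>R = \<complex>[y\<^sub>0,\<dots>,y\<^sub>3]\<close> are the type \<open>4 mpoly\<close>: the index type
  \<open>4\<close> has exactly the elements \<open>0, 1, 2, 3\<close>, linearly ordered in this way.
\<close>

type_synonym 'v mpoly = "('v \<Rightarrow>\<^sub>0 nat) \<Rightarrow>\<^sub>0 complex"

definition X :: "'v \<Rightarrow> 'v mpoly"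
  where "X i = Poly_Mapping.single (Poly_Mapping.single i 1) 1"

definition scal :: "complex \<Rightarrow> 'v mpoly \<Rightarrow> 'v mpoly"
  where "scal c p = Poly_Mapping.map ((*) c) p"

definition mdeg :: "('v \<Rightarrow>\<^sub>0 nat) \<Rightarrow> nat"
  where "mdeg m = (\<Sum>v\<in>Poly_Mapping.keys m. Poly_Mapping.lookup m v)"

text \<open>The graded piece of degree \<open>d\<close>; it contains \<open>0\<close>.\<close>

definition forms :: "nat \<Rightarrow> 'v mpoly set"
  where "forms d = {p. \<forall>m\<in>Poly_Mapping.keys p. mdeg m = d}"

definition eval_poly :: "'v mpoly \<Rightarrow> ('v \<Rightarrow> complex) \<Rightarrow> complex"
  where "eval_poly p a = (\<Sum>m\<in>Poly_Mapping.keys p. Poly_Mapping.lookup p m * (\<Prod>v\<in>Poly_Mapping.keys m. a v ^ Poly_Mapping.lookup m v))"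

lemma scal_conv_mult: "scal c p = Poly_Mapping.single 0 c * p"
  by (simp add: scal_def mult_map_scale_conv_mult)

interpretation mpoly: vector_space "scal :: complex \<Rightarrow> 'v mpoly \<Rightarrow> 'v mpoly"
  by unfold_locales
    (simp_all add: scal_conv_mult algebra_simps single_add mult_single flip: mult.assoc)

text \<open>Ideals of \<open>S\<close> are the \<open>S\<close>-submodules of \<open>S\<close>; the span of a set is the ideal it generates.\<close>

lemma module_mult: "module ((*) :: 4 mpoly \<Rightarrow> 4 mpoly \<Rightarrow> 4 mpoly)"
  by unfold_locales (simp_all add: algebra_simps)

abbreviation ideal_span :: "4 mpoly set \<Rightarrow> 4 mpoly set"
  where "ideal_span \<equiv> module.span (*)"


subsection \<open>Apolarity\<close>

definition pdiff :: "'v \<Rightarrow> 'v mpoly \<Rightarrow> 'v mpoly"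
  where "pdiff i F = (\<Sum>b\<in>Poly_Mapping.keys F.
    Poly_Mapping.single (b - Poly_Mapping.single i 1) (of_nat (Poly_Mapping.lookup b i) * Poly_Mapping.lookup F b))"

definition diff_action :: "4 mpoly \<Rightarrow> 4 mpoly \<Rightarrow> 4 mpoly"
  where "diff_action G F = (\<Sum>a\<in>Poly_Mapping.keys G. scal (Poly_Mapping.lookup G a)
    ((pdiff 0 ^^ Poly_Mapping.lookup a 0) ((pdiff 1 ^^ Poly_Mapping.lookup a 1) ((pdiff 2 ^^ Poly_Mapping.lookup a 2)
      ((pdiff 3 ^^ Poly_Mapping.lookup a 3) F)))))"

definition apolar :: "4 mpoly \<Rightarrow> 4 mpoly set"
  where "apolar F = {G. diff_action G F = 0}"

definition nondegenerate :: "4 mpoly \<Rightarrow> bool"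
  where "nondegenerate F \<longleftrightarrow> apolar F \<inter> forms 1 = {0}"

definition quadric_ideal :: "4 mpoly \<Rightarrow> 4 mpoly set"
  where "quadric_ideal F = ideal_span (apolar F \<inter> forms 2)"


subsection \<open>Tor\<close>

text \<open>
  \<open>Tor\<^sub>i(S/I, \<complex>)\<close> is the homology of \<open>K \<otimes> S/I\<close>, where \<open>K\<close> is the Koszul resolution of
  \<open>\<complex> = S/(x\<^sub>0,\<dots>,x\<^sub>3)\<close>. An element \<open>\<Sum>\<^sub>T z\<^sub>T e\<^sub>T\<close> of \<open>\<Lambda>\<^sup>p\<complex>\<^sup>4 \<otimes> S\<close> is given by its
  coefficients \<open>z\<^sub>T\<close>, where \<open>T\<close> runs through the \<open>p\<close>-element sets of indices and \<open>e\<^sub>T\<close>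
  is the wedge product of the \<open>e\<^sub>i\<close>, \<open>i \<in> T\<close>, in increasing order.
\<close>

type_synonym chain = "4 set \<Rightarrow> 4 mpoly"

definition chain_scal :: "complex \<Rightarrow> chain \<Rightarrow> chain"
  where "chain_scal c z = (\<lambda>T. scal c (z T))"

interpretation chain: vector_space chain_scal
  by unfold_locales
    (simp_all add: chain_scal_def fun_eq_iff mpoly.scale_right_distrib mpoly.scale_left_distrib)

text \<open>Chains of homological degree \<open>p\<close> and internal degree \<open>j\<close>; each \<open>e\<^sub>i\<close> has degree 1.\<close>

definition kchains :: "nat \<Rightarrow> nat \<Rightarrow> chain set"
  where "kchains p j = {z. \<forall>T. z T \<in> forms (j - p) \<and> (card T \<noteq> p \<or> j < p \<longrightarrow> z T = 0)}"

definition sgn_at :: "4 \<Rightarrow> 4 set \<Rightarrow> 4 mpoly"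
  where "sgn_at k T = (-1) ^ card {i\<in>T. i < k}"

text \<open>Contraction with the \<open>k\<close>-th dual basis vector, and the Koszul differential.\<close>

definition contract :: "4 \<Rightarrow> chain \<Rightarrow> chain"
  where "contract k z = (\<lambda>T. if k \<in> T then 0 else sgn_at k T * z (insert k T))"

definition koszul :: "chain \<Rightarrow> chain"
  where "koszul z = (\<lambda>T. \<Sum>k\<in>UNIV. X k * contract k z T)"

text \<open>
  The following facts show that the chains with the Koszul differential form a graded free
  resolution of \<open>\<complex>\<close>: it is a complex, and it is exact in every positive internal degree
  (in internal degree 0 it is just \<open>S\<^sub>0 = \<complex>\<close>). Exactness comes from the homotopy
  \<open>dk\<close> below, the exterior derivative.
\<close>

lemma lookup_X_mult:
  "Poly_Mapping.lookup (X k * f) m =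
    (if Poly_Mapping.lookup m k = 0 then 0 else Poly_Mapping.lookup f (m - Poly_Mapping.single k 1))"
proof -
  have eq: "m = Poly_Mapping.single k 1 + q \<longleftrightarrow>
      Poly_Mapping.lookup m k \<noteq> 0 \<and> q = m - Poly_Mapping.single k 1" for q
    by (auto simp: poly_mapping_eq_iff fun_eq_iff lookup_add lookup_minus lookup_single when_def)
  have "Poly_Mapping.lookup (X k * f) m =
      Sum_any (\<lambda>q. Poly_Mapping.lookup f q when m = Poly_Mapping.single k 1 + q)"
    by (simp add: X_def lookup_mult lookup_single when_mult)
  also have "\<dots> = (if Poly_Mapping.lookup m k = 0 then 0
      else Poly_Mapping.lookup f (m - Poly_Mapping.single k 1))"
    by (simp only: eq) (auto simp: when_def)
  finally show ?thesis .
qed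

lemma lookup_pdiff:
  "Poly_Mapping.lookup (pdiff i F) m =
    of_nat (Suc (Poly_Mapping.lookup m i)) * Poly_Mapping.lookup F (m + Poly_Mapping.single i 1)"
proof -
  let ?t = "\<lambda>b. of_nat (Poly_Mapping.lookup b i) * Poly_Mapping.lookup F b"
  let ?m = "m + Poly_Mapping.single i 1"
  have eq: "b - Poly_Mapping.single i 1 = m \<longleftrightarrow> b = ?m" if "Poly_Mapping.lookup b i \<noteq> 0" for b
    using that
    by (auto simp: poly_mapping_eq_iff fun_eq_iff lookup_add lookup_minus lookup_single when_def)
  have "Poly_Mapping.lookup (pdiff i F) m =
      (\<Sum>b\<in>Poly_Mapping.keys F. if b = ?m then ?t b else 0)"
    unfolding pdiff_def lookup_sum lookup_single
    by (intro sum.cong refl) (use eq in \<open>auto simp: when_def\<close>)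
  also have "\<dots> = ?t ?m"
    by (auto simp: in_keys_iff)
  finally show ?thesis
    by (simp add: lookup_add)
qed

lemma pdiff_X_mult:
  "pdiff i (X k * f) = X k * pdiff i f + (if i = k then f else 0)"
proof (rule poly_mapping_eqI)
  fix m :: "'a \<Rightarrow>\<^sub>0 nat"
  let ?e = "\<lambda>i::'a. Poly_Mapping.single i (1::nat)"
  have 1: "m + ?e i - ?e i = m" by simp
  have 2: "Poly_Mapping.lookup m k \<noteq> 0 \<Longrightarrow> m - ?e k + ?e k = m"
    by (auto simp: poly_mapping_eq_iff fun_eq_iff lookup_add lookup_minus lookup_single when_def)
  have 3: "i \<noteq> k \<Longrightarrow> Poly_Mapping.lookup m k \<noteq> 0 \<Longrightarrow> m + ?e i - ?e k = m - ?e k + ?e i"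
    by (auto simp: poly_mapping_eq_iff fun_eq_iff lookup_add lookup_minus lookup_single when_def)
  show "Poly_Mapping.lookup (pdiff i (X k * f)) m =
      Poly_Mapping.lookup (X k * pdiff i f + (if i = k then f else 0)) m"
    using 1 2 3
    by (auto simp: lookup_pdiff lookup_X_mult lookup_add lookup_minus lookup_single distrib_right left_diff_distrib)
qed

lemma pdiff_add: "pdiff i (f + g) = pdiff i f + pdiff i g"
  by (rule poly_mapping_eqI) (simp add: lookup_pdiff lookup_add algebra_simps)

lemma pdiff_0 [simp]: "pdiff i 0 = 0"
  by (simp add: pdiff_def)

lemma pdiff_uminus: "pdiff i (- f) = - pdiff i f"
  by (rule poly_mapping_eqI) (simp add: lookup_pdiff)

lemma pdiff_sum: "pdiff i (sum f A) = (\<Sum>a\<in>A. pdiff i (f a))"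
  by (induction A rule: infinite_finite_induct) (simp_all add: pdiff_add)

lemma pdiff_sign: "pdiff i (sgn_at k T * f) = sgn_at k T * pdiff i f"
proof -
  have "pdiff i ((-1) ^ n * f) = (-1) ^ n * pdiff i f" for n
    by (induction n) (simp_all add: pdiff_uminus)
  then show ?thesis by (simp add: sgn_at_def)
qed

lemma mdeg_conv_sum: "mdeg (m :: 4 \<Rightarrow>\<^sub>0 nat) = (\<Sum>v\<in>UNIV. Poly_Mapping.lookup m v)"
  unfolding mdeg_def by (rule sum.mono_neutral_left) (auto simp: in_keys_iff)

lemma mdeg_add_single: "mdeg (m + Poly_Mapping.single (i::4) 1) = Suc (mdeg m)"
  by (simp add: mdeg_conv_sum lookup_add sum.distrib lookup_single when_def)

lemma euler:
  assumes "f \<in> forms d"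
  shows "(\<Sum>i\<in>UNIV. X i * pdiff i f) = of_nat d * (f :: 4 mpoly)"
proof (rule poly_mapping_eqI)
  fix m :: "4 \<Rightarrow>\<^sub>0 nat"
  have *: "Poly_Mapping.lookup (X i * pdiff i f) m =
      of_nat (Poly_Mapping.lookup m i) * Poly_Mapping.lookup f m" for i
  proof (cases "Poly_Mapping.lookup m i = 0")
    case False
    then have "m - Poly_Mapping.single i 1 + Poly_Mapping.single i 1 = m"
      by (auto simp: poly_mapping_eq_iff fun_eq_iff lookup_add lookup_minus lookup_single when_def)
    with False show ?thesis
      by (simp add: lookup_X_mult lookup_pdiff lookup_minus)
  qed (simp add: lookup_X_mult)
  have "Poly_Mapping.lookup (\<Sum>i\<in>UNIV. X i * pdiff i f) m =
      of_nat (mdeg m) * Poly_Mapping.lookup f m"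
    by (simp add: lookup_sum * mdeg_conv_sum sum_distrib_right)
  also have "\<dots> = of_nat d * Poly_Mapping.lookup f m"
    using assms by (cases "m \<in> Poly_Mapping.keys f") (auto simp: forms_def in_keys_iff)
  also have "\<dots> = Poly_Mapping.lookup (scal (of_nat d) f) m"
    by (simp add: scal_def Poly_Mapping.map.rep_eq when_def)
  finally show "Poly_Mapping.lookup (\<Sum>i\<in>UNIV. X i * pdiff i f) m =
      Poly_Mapping.lookup (of_nat d * f) m"
    by (simp add: scal_conv_mult)
qed

lemma subspace_forms: "mpoly.subspace (forms d)"
  by (rule mpoly.subspaceI)
    (auto simp: forms_def scal_def Poly_Mapping.map.rep_eq in_keys_iff when_def lookup_add
      dest!: subsetD[OF Poly_Mapping.keys_add])

lemma X_mult_forms: "f \<in> forms d \<Longrightarrow> X (k::4) * f \<in> forms (Suc d)"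
proof -
  assume f: "f \<in> forms d"
  have "mdeg m = Suc d" if "m \<in> Poly_Mapping.keys (X k * f)" for m
  proof -
    from that have *: "Poly_Mapping.lookup m k \<noteq> 0"
        "m - Poly_Mapping.single k 1 \<in> Poly_Mapping.keys f"
      by (auto simp: in_keys_iff lookup_X_mult split: if_splits)
    then have "m - Poly_Mapping.single k 1 + Poly_Mapping.single k 1 = m"
      by (auto simp: poly_mapping_eq_iff fun_eq_iff lookup_add lookup_minus lookup_single when_def)
    with * f show ?thesis
      using mdeg_add_single[of "m - Poly_Mapping.single k 1" k] by (simp add: forms_def)
  qed
  then show ?thesis by (simp add: forms_def)
qed

lemma pdiff_forms:
  assumes "f \<in> forms d"
  shows "pdiff (i::4) f \<in> forms (d - 1)" and "d = 0 \<Longrightarrow> pdiff i f = 0"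
proof -
  have *: "Suc (mdeg m) = d" if "m \<in> Poly_Mapping.keys (pdiff i f)" for m
    using that assms mdeg_add_single[of m i]
    by (auto simp: in_keys_iff lookup_pdiff forms_def)
  then show "pdiff i f \<in> forms (d - 1)" by (fastforce simp: forms_def)
  show "pdiff i f = 0" if "d = 0"
    using * that by (metis keys_eq_empty equals0I nat.distinct(2))
qed

lemma sign_forms: "f \<in> forms d \<Longrightarrow> sgn_at k T * f \<in> forms d"
proof -
  assume "f \<in> forms d"
  then have "(-1) ^ n * f \<in> forms d" for n
    by (induction n) (simp_all add: mpoly.subspace_neg[OF subspace_forms])
  then show ?thesis by (simp add: sgn_at_def)
qed

lemma koszul_kchains:
  assumes "z \<in> kchains (Suc p) j"
  shows "koszul z \<in> kchains p j"
proof -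
  have z: "z T \<in> forms (j - Suc p)" "card T \<noteq> Suc p \<or> j < Suc p \<Longrightarrow> z T = 0" for T
    using assms by (auto simp: kchains_def)
  have 0: "contract k z T = 0" if "card T \<noteq> p \<or> j < Suc p" for k T
    using z(2)[of "insert k T"] that by (auto simp: contract_def card_insert_if)
  have "X k * contract k z T \<in> forms (j - p)" for k T
  proof (cases "j < Suc p")
    case False
    then have "j - p = Suc (j - Suc p)" by simp
    then show ?thesis
      using X_mult_forms[OF sign_forms[OF z(1)[of "insert k T"], of k T], of k]
      by (simp add: contract_def mpoly.subspace_0[OF subspace_forms])
  qed (use 0 mpoly.subspace_0[OF subspace_forms] in auto)
  with 0 show ?thesis
    by (auto simp: kchains_def koszul_def intro!: mpoly.subspace_sum[OF subspace_forms])
qed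

lemma sgn_at_insert:
  assumes "i \<notin> T"
  shows "sgn_at k (insert i T) = (if i < k then - sgn_at k T else sgn_at k T)"
proof -
  have "{l \<in> insert i T. l < k} = (if i < k then insert i {l\<in>T. l < k} else {l\<in>T. l < k})"
    by auto
  with assms show ?thesis by (simp add: sgn_at_def)
qed

lemma contract_contract:
  "contract i (contract k z) T = - contract k (contract i z) T"
proof (cases "i \<in> T \<or> k \<in> T \<or> i = k")
  case False
  then have "i < k \<or> k < i" by auto
  with False show ?thesis
    by (auto simp: contract_def sgn_at_insert insert_commute mult.left_commute)
qed (auto simp: contract_def)

lemma koszul_koszul: "koszul (koszul z) = 0"
proof
  fix T
  let ?S = "\<Sum>i\<in>UNIV. \<Sum>k\<in>UNIV. X i * (X k * contract i (contract k z) T)"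
  have "contract i (koszul z) T = (\<Sum>k\<in>UNIV. X k * contract i (contract k z) T)" for i
    by (simp add: contract_def koszul_def sum_distrib_left mult.left_commute)
  then have eq: "koszul (koszul z) T = ?S"
    by (simp only: koszul_def[of "koszul z"] sum_distrib_left)
  have "?S = (\<Sum>k\<in>UNIV. \<Sum>i\<in>UNIV. X i * (X k * contract i (contract k z) T))"
    by (rule sum.swap)
  also have "\<dots> = (\<Sum>k\<in>UNIV. \<Sum>i\<in>UNIV. - (X k * (X i * contract k (contract i z) T)))"
  proof (intro sum.cong refl)
    fix k i
    show "X i * (X k * contract i (contract k z) T) = - (X k * (X i * contract k (contract i z) T))"
      by (simp add: contract_contract[of i k] mult.left_commute)
  qed
  also have "\<dots> = - ?S" by (simp only: sum_negf)
  finally have "?S + ?S = 0" by (simp only: eq_neg_iff_add_eq_0)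
  then have "2 * ?S = 0" by (simp only: mult_2)
  moreover have "(2 :: 4 mpoly) = Poly_Mapping.single 0 2" by simp
  ultimately have "scal 2 ?S = 0" by (simp only: scal_conv_mult)
  then have "?S = 0" by simp
  then show "koszul (koszul z) T = 0 T" by (simp add: eq)
qed

definition dk :: "chain \<Rightarrow> chain"
  where "dk z = (\<lambda>T. \<Sum>i\<in>T. sgn_at i T * pdiff i (z (T - {i})))"

lemma koszul_dk:
  assumes "z \<in> kchains p j"
  shows "koszul (dk z) T + dk (koszul z) T = of_nat j * z T"
proof (cases "card T \<noteq> p \<or> j < p")
  case False
  then have p: "card T = p" "p \<le> j" by auto
  have zT: "z T \<in> forms (j - p)" using assms by (auto simp: kchains_def)
  have koszul: "koszul y U = (\<Sum>k\<in>-U. X k * (sgn_at k U * y (insert k U)))" for y U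
    unfolding koszul_def contract_def
    by (rule sum.mono_neutral_cong_right) auto
  have sgn_self: "sgn_at k (insert k T) = sgn_at k T" "sgn_at k (T - {k}) = sgn_at k T" for k
    unfolding sgn_at_def by (rule arg_cong[where f = "\<lambda>A. (-1) ^ card A"]; auto)+
  have sq: "sgn_at k T * (sgn_at k T * y) = y" for k y
    by (simp add: sgn_at_def flip: mult.assoc power_add)
  let ?A = "\<lambda>k i. X k * (sgn_at k T * (sgn_at i (insert k T) * pdiff i (z (insert k T - {i}))))"
  let ?B = "\<lambda>k i. sgn_at i T * (sgn_at k (T - {i}) * (X k * pdiff i (z (insert k (T - {i})))))"
  have 1: "koszul (dk z) T = (\<Sum>k\<in>-T. X k * pdiff k (z T)) + (\<Sum>k\<in>-T. \<Sum>i\<in>T. ?A k i)"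
  proof -
    have "X k * (sgn_at k T * dk z (insert k T)) =
        X k * pdiff k (z T) + (\<Sum>i\<in>T. ?A k i)" if "k \<in> -T" for k
    proof -
      have "insert k T - {k} = T" using that by auto
      then have "dk z (insert k T) = sgn_at k T * pdiff k (z T) +
          (\<Sum>i\<in>T. sgn_at i (insert k T) * pdiff i (z (insert k T - {i})))"
        using that by (simp add: dk_def sgn_self)
      then show ?thesis
        by (simp only: distrib_left sum_distrib_left sq)
    qed
    then show ?thesis
      by (simp add: koszul sum.distrib)
  qed
  have 2: "dk (koszul z) T =
      (\<Sum>i\<in>T. X i * pdiff i (z T) + z T) + (\<Sum>i\<in>T. \<Sum>k\<in>-T. ?B k i)"
  proof -
    have "sgn_at i T * pdiff i (koszul z (T - {i})) =
        (X i * pdiff i (z T) + z T) + (\<Sum>k\<in>-T. ?B k i)" if i: "i \<in> T" for i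
    proof -
      have C: "- (T - {i}) = insert i (-T)" using i by auto
      have I: "insert i (T - {i}) = T" using i by auto
      have D: "pdiff i (X k * (sgn_at k U * y)) =
          sgn_at k U * (X k * pdiff i y + (if i = k then y else 0))" for k U y
        by (subst mult.left_commute) (simp only: pdiff_sign pdiff_X_mult)
      have "sgn_at i T * pdiff i (koszul z (T - {i})) =
          sgn_at i T * (sgn_at i T * (X i * pdiff i (z T) + z T)) +
          sgn_at i T * (\<Sum>k\<in>-T. sgn_at k (T - {i}) * (X k * pdiff i (z (insert k (T - {i})))))"
      proof -
        have "pdiff i (koszul z (T - {i})) =
            (\<Sum>k\<in>insert i (-T). pdiff i (X k * (sgn_at k (T - {i}) * z (insert k (T - {i})))))"
          by (simp only: koszul C pdiff_sum)
        also have "\<dots> = sgn_at i T * (X i * pdiff i (z T) + z T) +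
            (\<Sum>k\<in>-T. pdiff i (X k * (sgn_at k (T - {i}) * z (insert k (T - {i})))))"
          using i by (simp add: D sgn_self I insert_absorb)
        also have "(\<Sum>k\<in>-T. pdiff i (X k * (sgn_at k (T - {i}) * z (insert k (T - {i}))))) =
            (\<Sum>k\<in>-T. sgn_at k (T - {i}) * (X k * pdiff i (z (insert k (T - {i})))))"
          by (intro sum.cong refl) (use i in \<open>auto simp: D\<close>)
        finally show ?thesis by (simp only: distrib_left)
      qed
      then show ?thesis by (simp add: sq sum_distrib_left)
    qed
    then show ?thesis by (simp add: dk_def sum.distrib)
  qed
  have 3: "?A k i = - ?B k i" if "k \<in> -T" "i \<in> T" for k i
  proof -
    define V where "V = T - {i}"
    have T: "T = insert i V" and V: "i \<notin> V" "k \<notin> V" "i \<noteq> k"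
      using that by (auto simp: V_def)
    have self: "sgn_at i (insert i U) = sgn_at i U" for U
      unfolding sgn_at_def by (rule arg_cong[where f = "\<lambda>A. (-1) ^ card A"]) auto
    have U: "insert k T - {i} = insert k V" "T - {i} = V" "insert k T = insert i (insert k V)"
      using V by (auto simp: T)
    have "i < k \<or> k < i" using V by auto
    then show ?thesis
      unfolding U unfolding T self using V
      by (auto simp: sgn_at_insert ac_simps)
  qed
  have "(\<Sum>k\<in>-T. \<Sum>i\<in>T. ?A k i) = (\<Sum>k\<in>-T. \<Sum>i\<in>T. - ?B k i)"
    by (intro sum.cong refl 3)
  also have "\<dots> = - (\<Sum>i\<in>T. \<Sum>k\<in>-T. ?B k i)"
    by (subst sum.swap) (simp add: sum_negf)
  finally have 4: "(\<Sum>k\<in>-T. \<Sum>i\<in>T. ?A k i) = - (\<Sum>i\<in>T. \<Sum>k\<in>-T. ?B k i)" .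
  have "koszul (dk z) T + dk (koszul z) T =
      (\<Sum>i\<in>-T. X i * pdiff i (z T)) + (\<Sum>i\<in>T. X i * pdiff i (z T)) + of_nat (card T) * z T"
    unfolding 1 2 4 by (simp add: sum.distrib)
  also have "(\<Sum>i\<in>-T. X i * pdiff i (z T)) + (\<Sum>i\<in>T. X i * pdiff i (z T)) =
      (\<Sum>i\<in>UNIV. X i * pdiff i (z T))"
    by (subst sum.union_disjoint[symmetric]) (auto intro!: sum.cong)
  also have "\<dots> = of_nat (j - p) * z T" by (rule euler[OF zT])
  finally show ?thesis
    using p by (simp add: algebra_simps)
next
  case True
  then have z: "z T = 0" using assms by (auto simp: kchains_def)
  have "koszul (dk z) T = 0"
  proof -
    have "dk z (insert k T) = 0" if "k \<notin> T" for k
      unfolding dk_def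
    proof (rule sum.neutral, rule ballI)
      fix i assume "i \<in> insert k T"
      with that have "card (insert k T - {i}) = card T" by simp
      then have "z (insert k T - {i}) = 0" using True assms by (auto simp: kchains_def)
      then show "sgn_at i (insert k T) * pdiff i (z (insert k T - {i})) = 0" by simp
    qed
    then show ?thesis by (auto simp: koszul_def contract_def intro!: sum.neutral)
  qed
  moreover have "dk (koszul z) T = 0"
    unfolding dk_def
  proof (rule sum.neutral, rule ballI)
    fix i assume i: "i \<in> T"
    have "contract k z (T - {i}) = 0" for k
    proof (cases "k \<in> T - {i}")
      case False
      then have "card (insert k (T - {i})) = card T" 
        using i False by (simp add: card_Suc_Diff1 del: card_Diff_insert)
      then have "z (insert k (T - {i})) = 0" using True assms by (auto simp: kchains_def)
      then show ?thesis by (simp add: contract_def)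
    qed (simp add: contract_def)
    then show "sgn_at i T * pdiff i (koszul z (T - {i})) = 0" by (simp add: koszul_def)
  qed
  ultimately show ?thesis by (simp add: z)
qed

lemma koszul_chain_scal: "koszul (chain_scal c z) = chain_scal c (koszul z)"
  by (rule ext) (auto simp: koszul_def contract_def chain_scal_def scal_conv_mult sum_distrib_left ac_simps
      intro!: sum.cong)

lemma koszul_exact:
  assumes z: "z \<in> kchains p j" and "0 < j" and 0: "koszul z = 0"
  shows "z \<in> koszul ` kchains (Suc p) j"
proof -
  have sub: "mpoly.subspace (forms d)" for d by (rule subspace_forms)
  have zT: "z T \<in> forms (j - p)" "card T \<noteq> p \<or> j < p \<Longrightarrow> z T = 0" for T
    using z by (auto simp: kchains_def)
  let ?w = "chain_scal (1 / of_nat j) (dk z)"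
  have "dk z T \<in> forms (j - Suc p)" for T
    unfolding dk_def using pdiff_forms(1)[OF zT(1)]
    by (auto intro!: mpoly.subspace_sum[OF sub] sign_forms)
  moreover have "dk z T = 0" if "card T \<noteq> Suc p \<or> j < Suc p" for T
    unfolding dk_def
  proof (rule sum.neutral, rule ballI)
    fix i assume i: "i \<in> T"
    have "pdiff i (z (T - {i})) = 0"
    proof (cases "card T = Suc p")
      case True
      with that have "j - p = 0" by simp
      then show ?thesis using pdiff_forms(2)[OF zT(1)] by blast
    next
      case False
      then have "card (T - {i}) \<noteq> p \<or> j < p" using that i card_Suc_Diff1[of T i] by auto
      then show ?thesis using zT(2) by simp
    qed
    then show "sgn_at i T * pdiff i (z (T - {i})) = 0" by simp
  qed
  ultimately have w: "?w \<in> kchains (Suc p) j"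
    by (auto simp: kchains_def chain_scal_def intro: mpoly.subspace_scale[OF sub])
  have "koszul ?w = z"
  proof
    fix T
    have "koszul (dk z) T = of_nat j * z T"
      using koszul_dk[OF z, of T] by (simp add: 0 dk_def)
    also have "\<dots> = scal (of_nat j) (z T)" by (simp add: scal_conv_mult)
    finally have "koszul (dk z) T = scal (of_nat j) (z T)" .
    moreover have "koszul ?w T = scal (1 / of_nat j) (koszul (dk z) T)"
      unfolding koszul_chain_scal by (simp add: chain_scal_def)
    ultimately show "koszul ?w T = z T" using \<open>0 < j\<close> by simp
  qed
  then show ?thesis using w by (rule image_eqI[OF sym])
qed

text \<open>
  For a homogeneous ideal \<open>I\<close>: the chains representing cycles, respectively boundaries, of
  \<open>K\<^sub>p \<otimes> S/I\<close> in degree \<open>j\<close>.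
\<close>

definition cycles :: "nat \<Rightarrow> nat \<Rightarrow> 4 mpoly set \<Rightarrow> chain set"
  where "cycles p j I = {z \<in> kchains p j. \<forall>T. koszul z T \<in> I}"

definition boundaries :: "nat \<Rightarrow> nat \<Rightarrow> 4 mpoly set \<Rightarrow> chain set"
  where "boundaries p j I = {koszul w + v |w v. w \<in> kchains (Suc p) j \<and> v \<in> kchains p j \<and> (\<forall>T. v T \<in> I)}"

lemma boundaries_subset_cycles:
  assumes "module.subspace (*) I"
  shows "boundaries p j I \<subseteq> cycles p j I"
proof
  interpret S: module "(*) :: 4 mpoly \<Rightarrow> 4 mpoly \<Rightarrow> 4 mpoly" by (rule module_mult)
  fix z assume "z \<in> boundaries p j I"
  then obtain w v where z: "z = koszul w + v" and w: "w \<in> kchains (Suc p) j"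
    and v: "v \<in> kchains p j" "\<And>T. v T \<in> I"
    by (auto simp: boundaries_def)
  have "z \<in> kchains p j"
    using koszul_kchains[OF w] v(1)
    by (auto simp: z kchains_def intro: mpoly.subspace_add[OF subspace_forms])
  moreover have "koszul z T = koszul v T" for T
  proof -
    have "koszul (koszul w + v) T = koszul (koszul w) T + koszul v T"
      unfolding koszul_def sum.distrib[symmetric] contract_def
      by (intro sum.cong refl) (auto simp: distrib_left)
    then show ?thesis by (simp add: z koszul_koszul)
  qed
  moreover have "koszul v T \<in> I" for T
    unfolding koszul_def contract_def
    by (intro S.subspace_sum[OF assms] S.subspace_scale[OF assms])
      (simp add: S.subspace_scale[OF assms v(2)] S.subspace_0[OF assms])
  ultimately have "z \<in> kchains p j" "\<And>T. koszul z T \<in> I" by simp_all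
  then show "z \<in> cycles p j I" unfolding cycles_def by blast
qed

text \<open>The dimension of \<open>Tor\<^sub>p(S/I, \<complex>)\<^sub>j\<close>.\<close>

definition tor_dim :: "nat \<Rightarrow> nat \<Rightarrow> 4 mpoly set \<Rightarrow> nat"
  where "tor_dim p j I = chain.dim (cycles p j I) - chain.dim (boundaries p j I)"

text \<open>
  A linear first syzygy among the quadrics of \<open>I\<close> is an element \<open>\<Sum>\<^sub>m x\<^sub>m \<otimes> q\<^sub>m\<close> of \<open>S\<^sub>1 \<otimes> I\<^sub>2\<close>
  with \<open>\<Sum>\<^sub>m x\<^sub>m q\<^sub>m = 0\<close>; it is given by the chain \<open>{m} \<mapsto> q\<^sub>m\<close>. The connecting isomorphism
  \<open>Tor\<^sub>3(S/I, \<complex>)\<^sub>4 \<cong> Tor\<^sub>2(I, \<complex>)\<^sub>4\<close> maps the class of a cycle \<open>z\<close> to \<open>koszul z\<close>, which for an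
  ideal \<open>I\<close> without linear forms is an antisymmetric family of quadrics \<open>q\<^sub>k\<^sub>m \<in> I\<close> with
  \<open>\<Sum>\<^sub>m x\<^sub>m q\<^sub>k\<^sub>m = 0\<close> for each \<open>k\<close>. This is the second syzygy \<open>\<Sum>\<^sub>k x\<^sub>k \<sigma>\<^sub>k = 0\<close> among the linear
  first syzygies \<open>\<sigma>\<^sub>k = \<Sum>\<^sub>m x\<^sub>m \<otimes> q\<^sub>k\<^sub>m\<close>, given by \<open>contract k (koszul z)\<close>. Their span is the smallest
  space of linear first syzygies over which it can be written with linear coefficients.
\<close>

definition syzygy_rank :: "chain \<Rightarrow> nat"
  where "syzygy_rank z = chain.dim (chain.span (range (\<lambda>k. contract k (koszul z))))"

definition linear_second_syzygies :: "4 mpoly set \<Rightarrow> chain set"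
  where "linear_second_syzygies I = cycles 3 4 I - boundaries 3 4 I"


subsection \<open>Complete intersections and zero-dimensional schemes\<close>

definition regular_sequence :: "4 mpoly list \<Rightarrow> bool"
  where "regular_sequence qs \<longleftrightarrow> 1 \<notin> ideal_span (set qs) \<and>
    (\<forall>k<length qs. \<forall>G. qs ! k * G \<in> ideal_span (set (take k qs)) \<longrightarrow> G \<in> ideal_span (set (take k qs)))"

definition complete_intersection_of_quadrics :: "nat \<Rightarrow> 4 mpoly set \<Rightarrow> bool"
  where "complete_intersection_of_quadrics r I \<longleftrightarrow>
    (\<exists>qs. length qs = r \<and> set qs \<subseteq> forms 2 \<and> regular_sequence qs \<and> I = ideal_span (set qs))"

text \<open>
  Closed subschemes of \<open>\<P>(R\<^sub>1) = Proj S\<close> correspond to saturated homogeneous ideals of \<open>S\<close>;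
  the scheme is zero-dimensional of length \<open>n\<close> iff its Hilbert polynomial is the constant \<open>n > 0\<close>.
\<close>

definition homogeneous_ideal :: "4 mpoly set \<Rightarrow> bool"
  where "homogeneous_ideal I \<longleftrightarrow> I = ideal_span (I \<inter> (\<Union>d. forms d))"

definition saturated :: "4 mpoly set \<Rightarrow> bool"
  where "saturated I \<longleftrightarrow> (\<forall>G. (\<forall>i. X i * G \<in> I) \<longrightarrow> G \<in> I)"

definition hilbert_function :: "4 mpoly set \<Rightarrow> nat \<Rightarrow> nat"
  where "hilbert_function I d = mpoly.dim (forms d :: 4 mpoly set) - mpoly.dim (I \<inter> forms d)"

definition zero_dim_scheme :: "4 mpoly set \<Rightarrow> nat \<Rightarrow> bool"
  where "zero_dim_scheme I n \<longleftrightarrow> homogeneous_ideal I \<and> saturated I \<and> n > 0 \<and>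
    (\<forall>\<^sub>F d in sequentially. hilbert_function I d = n)"

definition min_apolar_length :: "4 mpoly \<Rightarrow> nat \<Rightarrow> bool"
  where "min_apolar_length F n \<longleftrightarrow>
    (\<exists>I. zero_dim_scheme I n \<and> I \<subseteq> apolar F) \<and>
    (\<forall>I m. zero_dim_scheme I m \<and> I \<subseteq> apolar F \<longrightarrow> n \<le> m)"


subsection \<open>The projective space of quartics\<close>

text \<open>The point \<open>[F]\<close> of \<open>\<P>(R\<^sub>4)\<close> is the set of non-zero multiples of \<open>F\<close>.\<close>

definition point :: "4 mpoly \<Rightarrow> 4 mpoly set"
  where "point F = {scal c F |c. c \<noteq> 0}"

definition PR4 :: "4 mpoly set set"
  where "PR4 = point ` (forms 4 - {0})"

text \<open>
  The homogeneous coordinates on \<open>\<P>(R\<^sub>4)\<close> are the 35 coefficients of a quartic, so polynomials in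
  these coordinates have variables indexed by the exponents of degree 4.
\<close>

definition PR4_forms :: "(4 \<Rightarrow>\<^sub>0 nat) mpoly set"
  where "PR4_forms = {H. (\<exists>e. H \<in> forms e) \<and>
    (\<forall>m\<in>Poly_Mapping.keys H. \<forall>a\<in>Poly_Mapping.keys m. mdeg a = 4)}"

definition zariski_closed :: "4 mpoly set set \<Rightarrow> bool"
  where "zariski_closed Z \<longleftrightarrow> (\<exists>E\<subseteq>PR4_forms.
    Z = {P \<in> PR4. \<forall>F\<in>P. \<forall>H\<in>E. eval_poly H (Poly_Mapping.lookup F) = 0})"

definition zariski_closure :: "4 mpoly set set \<Rightarrow> 4 mpoly set set"
  where "zariski_closure W = zariski_closed hull W"


subsection \<open>The strata\<close>

definition betti_forms :: "nat \<Rightarrow> nat \<Rightarrow> nat \<Rightarrow> 4 mpoly set"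
  where "betti_forms b12 b23 b34 = {F \<in> forms 4. nondegenerate F \<and>
    tor_dim 1 2 (apolar F) = b12 \<and> tor_dim 2 3 (apolar F) = b23 \<and> tor_dim 3 4 (apolar F) = b34}"

definition \<F> :: "nat \<Rightarrow> nat \<Rightarrow> nat \<Rightarrow> 4 mpoly set set"
  where "\<F> b12 b23 b34 = point ` betti_forms b12 b23 b34"

definition \<F>_300a :: "4 mpoly set set"
  where "\<F>_300a = point ` {F \<in> betti_forms 3 0 0.
    complete_intersection_of_quadrics 3 (quadric_ideal F) \<and> min_apolar_length F 8}"

text \<open>
  For \<open>F \<in> betti_forms 4 4 1\<close> the linear second syzygy of \<open>quadric_ideal F\<close> is unique up to a
  non-zero scalar, which does not change the rank.
\<close>

definition \<F>_441_rank :: "nat \<Rightarrow> 4 mpoly set set"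
  where "\<F>_441_rank r = point ` {F \<in> betti_forms 4 4 1.
    \<exists>z \<in> linear_second_syzygies (quadric_ideal F). syzygy_rank z = r}"

abbreviation \<F>_441a :: "4 mpoly set set"
  where "\<F>_441a \<equiv> \<F>_441_rank 3"

abbreviation \<F>_441b :: "4 mpoly set set"
  where "\<F>_441b \<equiv> \<F>_441_rank 4"

end

theory Submission
  imports Defs "Jordan_Normal_Form.Determinant"
begin

text \<open>
  All five statements are instances of one principle. Let \<open>L F\<close> be a linear map on a
  finite-dimensional space \<open>U\<close> that depends linearly on the quartic \<open>F\<close>. If \<open>L F\<^sub>0\<close> is injective
  while \<open>L F\<close> has a kernel for every \<open>F\<close> in a set \<open>W\<close>, then a maximal minor of \<open>L\<close> is a form in the
  coefficients of \<open>F\<close> that vanishes on \<open>W\<close> but not at \<open>F\<^sub>0\<close>, so \<open>F\<^sub>0\<close> is not in the closure of \<open>W\<close>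
  (\<open>not_in_zariski_closure\<close>). Hence each non-containment needs one test quartic \<open>F\<^sub>0\<close> in the left
  stratum and one family \<open>L\<close>.

  Without linear forms in \<open>F\<^sup>\<bottom>\<close>, the three Betti numbers count the quadrics in \<open>F\<^sup>\<bottom>\<close>, the linear
  relations among them and the linear relations among these (\<open>tor_dim_linear_strand\<close>). In (1), (3)
  and (4) the quartics of the left stratum have fewer apolar quadrics than those of the right one:
  \<open>4 < 5\<close>, \<open>3 < 4\<close>, \<open>2 < 3\<close>. Here \<open>L F\<close> is the catalecticant map \<open>q \<mapsto> q(F)\<close> on a complement of the
  quadrics apolar to \<open>F\<^sub>0\<close> (\<open>quadrics_separate\<close>). In (2) a quartic on the right has a linear second
  syzygy and one on the left has none; here \<open>L F\<close> applies \<open>F\<close> to the values of the antisymmetric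
  families of quadrics \<open>q\<^sub>k\<^sub>m\<close> with \<open>\<Sum>\<^sub>m x\<^sub>m q\<^sub>k\<^sub>m = 0\<close> (\<open>second_syzygies_separate\<close>).

  In (5) both strata have three apolar quadrics, and the left one has more syzygies, so semicontinuity
  of Betti numbers gives nothing. If \<open>F\<close> has Betti numbers \<open>3, 2, 0\<close>, then its net of apolar quadrics
  has a basis \<open>n = k \<times> b\<close> that is the cross product of two vectors of linear forms, by a
  Hilbert--Burch argument (\<open>hilbert_burch\<close>): the net consists of the minors of a
  \<open>3 \<times> 2\<close> matrix. Then \<open>k\<close> and \<open>b\<close> are two syzygies of \<open>n\<close>, and the tensor \<open>k \<and> b\<close> together with
  the proportionality of its minors to \<open>n\<close> can be expressed by linear equations on a tensor \<open>w\<close> with six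
  indices, in which \<open>F\<close> enters only through the condition that the first two indices are contracted
  to zero by \<open>F\<close>. These equations define \<open>U\<close> and \<open>L\<close>. For the test quartic the net is
  \<open>x\<^sub>0 (x\<^sub>1, x\<^sub>2, x\<^sub>3)\<close>, whose syzygies are the Koszul relations of \<open>x\<^sub>1, x\<^sub>2, x\<^sub>3\<close>; the minors of two of
  them do not involve \<open>x\<^sub>0\<close>, so they cannot be proportional to the net, and \<open>w = 0\<close>
  (\<open>pairing_plane_point\<close>). This reflects that a plane with a point outside it is not a
  limit of twisted cubics.

  The test quartics are sums of monomials \<open>y\<^sub>a\<^sup>2 y\<^sub>b\<^sup>2\<close>, given by the edges of a graph. For these the
  apolar quadrics can be read off from the graph, and quadrics and their syzygies are handled as
  tensors of second derivatives, which turns all Betti numbers into finite systems of linear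
  equations.
\<close>

section \<open>Linear algebra with dual families of functionals\<close>

context vector_space
begin

text \<open>
  Induction on the set of functionals: each one cuts the dimension by at most one, and the vectors
  on which all of them vanish are zero.
\<close>

lemma span_of_separating_functionals:
  assumes "subspace S" "finite J"
    and "\<forall>j\<in>J. Vector_Spaces.linear scale (*) (f j)"
    and "\<forall>x\<in>S. (\<forall>j\<in>J. f j x = 0) \<longrightarrow> x = 0"
  obtains B where "finite B" "card B \<le> card J" "B \<subseteq> S" "span B = S"
proof -
  have "\<exists>B. finite B \<and> card B \<le> card J \<and> B \<subseteq> S \<and> S \<subseteq> span B"
    using assms(2,1,3,4)
  proof (induction J arbitrary: S rule: finite_induct)
    case empty
    then have "S \<subseteq> {0}" by auto
    then show ?case by (intro exI[of _ "{}"]) (auto simp: span_empty)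
  next
    case (insert j J)
    interpret fj: Vector_Spaces.linear scale "(*)" "f j" using insert.prems(2) by simp
    define S' where "S' = {x \<in> S. f j x = 0}"
    have S': "subspace S'"
      using insert.prems(1) unfolding S'_def
      by (auto simp: subspace_def fj.add fj.scale fj.zero)
    obtain B where B: "finite B" "card B \<le> card J" "B \<subseteq> S'" "S' \<subseteq> span B"
      using insert.IH[OF S'] insert.prems(2,3) by (fastforce simp: S'_def)
    show ?case
    proof (cases "S = S'")
      case True
      with B insert.hyps show ?thesis by (intro exI[of _ B]) auto
    next
      case False
      then obtain v where v: "v \<in> S" "f j v \<noteq> 0" by (auto simp: S'_def)
      have "S \<subseteq> span (Set.insert v B)"
      proof
        fix x assume x: "x \<in> S"
        let ?c = "f j x / f j v"
        have "x - scale ?c v \<in> S'"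
          using x v insert.prems(1) by (auto simp: S'_def fj.diff fj.scale subspace_diff subspace_scale)
        then have "x - scale ?c v \<in> span (Set.insert v B)"
          using B(4) span_mono[of B "Set.insert v B"] by auto
        then have "x - scale ?c v + scale ?c v \<in> span (Set.insert v B)"
          by (intro span_add span_scale) (auto intro: span_base)
        then show "x \<in> span (Set.insert v B)" by simp
      qed
      moreover have "card (Set.insert v B) \<le> card (Set.insert j J)"
        using B insert.hyps by (auto simp: card_insert_if)
      ultimately show ?thesis using B v by (intro exI[of _ "Set.insert v B"]) (auto simp: S'_def)
    qed
  qed
  then show ?thesis using that assms(1) span_minimal by blast
qed

lemma dim_le_card_functionals:
  assumes "subspace S" "finite J"
    and "\<forall>j\<in>J. Vector_Spaces.linear scale (*) (f j)"
    and "\<forall>x\<in>S. (\<forall>j\<in>J. f j x = 0) \<longrightarrow> x = 0"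
  shows "dim S \<le> card J"
proof -
  obtain B where "finite B" "card B \<le> card J" "span B = S"
    using span_of_separating_functionals[OF assms] by blast
  then show ?thesis using dim_le_card[of S B] by simp
qed

lemma independent_of_dual_functionals:
  assumes fin: "finite J" and lin: "\<forall>j\<in>J. Vector_Spaces.linear scale (*) (f j)"
    and dual: "\<forall>i\<in>J. \<forall>j\<in>J. f j (b i) = (if i = j then 1 else 0)"
  shows "inj_on b J" "independent (b ` J)"
proof -
  show inj: "inj_on b J" using dual by (metis inj_onI zero_neq_one)
  show "independent (b ` J)"
  proof (rule independent_if_scalars_zero)
    fix g x assume 0: "(\<Sum>x\<in>b ` J. scale (g x) x) = 0" and "x \<in> b ` J"
    then obtain j where j: "j \<in> J" "x = b j" by auto
    interpret fj: Vector_Spaces.linear scale "(*)" "f j" using lin j(1) by blast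
    have "0 = f j (\<Sum>i\<in>J. scale (g (b i)) (b i))" using 0 by (simp add: sum.reindex[OF inj] fj.zero)
    also have "\<dots> = (\<Sum>i\<in>J. g (b i) * f j (b i))" by (simp add: fj.sum fj.scale)
    also have "\<dots> = (\<Sum>i\<in>J. if i = j then g (b i) else 0)"
      by (intro sum.cong refl) (use dual j in auto)
    also have "\<dots> = g x" using j fin by simp
    finally show "g x = 0" by simp
  qed (use fin in simp)
qed

text \<open>
  This is how all dimensions below are computed: the functionals bound the dimension from above
  because they separate points, and from below because each can be switched on alone.
\<close>

lemma dim_eq_card_dual_functionals:
  assumes S: "subspace S" and fin: "finite J"
    and lin: "\<forall>j\<in>J. Vector_Spaces.linear scale (*) (f j)"
    and sep: "\<forall>x\<in>S. (\<forall>j\<in>J. f j x = 0) \<longrightarrow> x = 0"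
    and b: "\<forall>j\<in>J. b j \<in> S"
    and dual: "\<forall>i\<in>J. \<forall>j\<in>J. f j (b i) = (if i = j then 1 else 0)"
  shows "dim S = card J"
proof -
  obtain B where B: "finite B" "card B \<le> card J" "span B = S"
    using span_of_separating_functionals[OF S fin lin sep] by blast
  note ind = independent_of_dual_functionals[OF fin lin dual]
  have 1: "b ` J \<subseteq> span B" using b B by auto
  have 2: "card (b ` J) = card J" by (rule card_image[OF ind(1)])
  obtain C where C: "C \<subseteq> S" "independent C" "S \<subseteq> span C" "card C = dim S"
    using basis_exists by blast
  have "finite C" using independent_span_bound[OF B(1) C(2)] C(1) B(3) by auto
  then have "card (b ` J) \<le> card C"
    using independent_span_bound[of C "b ` J"] ind(2) b C(3) by (meson image_subset_iff subset_iff)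
  with dim_le_card_functionals[OF S fin lin sep] 2 C(4) show ?thesis by simp
qed

lemma basis_of_dim_2:
  assumes "subspace S" "dim S = 2"
  obtains y z where "y \<in> S" "z \<in> S" "\<And>a b. scale a y + scale b z = 0 \<Longrightarrow> a = 0 \<and> b = 0"
    "\<And>x. x \<in> S \<Longrightarrow> \<exists>a b. x = scale a y + scale b z"
proof -
  obtain B where B: "B \<subseteq> S" "independent B" "S \<subseteq> span B" "card B = dim S"
    by (meson basis_exists)
  then obtain y z where yz: "B = {y, z}" "y \<noteq> z" using assms(2) by (auto simp: card_2_iff)
  have "a = 0 \<and> b = 0" if 0: "scale a y + scale b z = 0" for a b
  proof -
    let ?u = "\<lambda>v. if v = y then a else b"
    have s: "(\<Sum>v\<in>{y, z}. scale (?u v) v) = 0" using 0 yz(2) by auto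
    have "?u y = 0" "?u z = 0"
      by (rule independentD[OF B(2) _ _ s]; simp add: yz(1))+
    then show ?thesis using yz(2) by auto
  qed
  moreover have "\<exists>a b. x = scale a y + scale b z" if "x \<in> S" for x
  proof -
    have "x \<in> span {y, z}" using that B(3) yz by auto
    then obtain u where "x = (\<Sum>v\<in>{y, z}. scale (u v) v)" using span_finite[of "{y, z}"] by auto
    then show ?thesis using yz(2) by auto
  qed
  ultimately show ?thesis using that[of y z] B(1) yz(1) by auto
qed

lemma basis_of_dim_3:
  assumes "subspace S" "dim S = 3"
  obtains y1 y2 y3 where "y1 \<in> S" "y2 \<in> S" "y3 \<in> S"
    "\<And>a b c. scale a y1 + scale b y2 + scale c y3 = 0 \<Longrightarrow> a = 0 \<and> b = 0 \<and> c = 0"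
    "\<And>x. x \<in> S \<Longrightarrow> \<exists>a b c. x = scale a y1 + scale b y2 + scale c y3"
proof -
  obtain B where B: "B \<subseteq> S" "independent B" "S \<subseteq> span B" "card B = dim S"
    by (meson basis_exists)
  then obtain x y z where yz: "B = {x, y, z}" "x \<noteq> y" "x \<noteq> z" "y \<noteq> z"
    using assms(2) by (auto simp: card_3_iff)
  have "a = 0 \<and> b = 0 \<and> c = 0" if 0: "scale a x + scale b y + scale c z = 0" for a b c
  proof -
    let ?u = "\<lambda>v. if v = x then a else if v = y then b else c"
    have s: "(\<Sum>v\<in>{x, y, z}. scale (?u v) v) = 0" using 0 yz(2-) by (auto simp: add.assoc)
    have "?u x = 0" "?u y = 0" "?u z = 0"
      by (rule independentD[OF B(2) _ _ s]; simp add: yz(1))+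
    then show ?thesis using yz(2-) by (auto split: if_splits)
  qed
  moreover have "\<exists>a b c. v = scale a x + scale b y + scale c z" if "v \<in> S" for v
  proof -
    have "v \<in> span {x, y, z}" using that B(3) yz by auto
    then obtain u where "v = (\<Sum>v\<in>{x, y, z}. scale (u v) v)" using span_finite[of "{x, y, z}"] by auto
    then have "v = scale (u x) x + scale (u y) y + scale (u z) z" using yz(2-) by (simp add: add.assoc)
    then show ?thesis by blast
  qed
  ultimately show ?thesis using that[of x y z] B(1) yz(1) by auto
qed

lemma three_vectors_in_plane:
  assumes "v1 \<in> span {y, z}" "v2 \<in> span {y, z}" "v3 \<in> span {y, z}"
  obtains a b c where "scale a v1 + scale b v2 + scale c v3 = 0" "a \<noteq> 0 \<or> b \<noteq> 0 \<or> c \<noteq> 0"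
proof (cases "v1 = v2 \<or> v1 = v3 \<or> v2 = v3")
  case True
  then show ?thesis
    using that[of 1 "- 1" 0] that[of 1 0 "- 1"] that[of 0 1 "- 1"] by auto
next
  case False
  have "dependent {v1, v2, v3}"
  proof (rule ccontr)
    assume "\<not> dependent {v1, v2, v3}"
    then have "card {v1, v2, v3} \<le> card {y, z}"
      using independent_span_bound[of "{y, z}" "{v1, v2, v3}"] assms by auto
    moreover have "card {y, z} \<le> 2" by (simp add: card_insert_if)
    ultimately show False using False by simp
  qed
  then obtain u where u: "\<exists>v\<in>{v1, v2, v3}. u v \<noteq> 0" "(\<Sum>v\<in>{v1, v2, v3}. scale (u v) v) = 0"
    using dependent_finite[of "{v1, v2, v3}"] by auto
  then show ?thesis using that[of "u v1" "u v2" "u v3"] False by (auto simp: add.assoc)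
qed

text \<open>
  The ambient space need not be finite-dimensional, as it consists of chains of polynomials.
  A basis of the kernel is extended to one of the subspace; the images of the added vectors form a
  basis of the image.
\<close>

lemma rank_nullity:
  assumes V: "vector_space scale2" and g: "Vector_Spaces.linear scale scale2 g"
    and C: "finite B" "span B = C"
  shows "dim C = dim {x \<in> C. g x = 0} + vector_space.dim scale2 (g ` C)"
proof -
  interpret V2: vector_space scale2 by (rule V)
  interpret g: Vector_Spaces.linear scale scale2 g by (rule g)
  interpret P: vector_space_pair scale scale2 ..
  let ?K = "{x \<in> C. g x = 0}"
  have CS: "subspace C" using C by auto
  obtain K where K: "K \<subseteq> ?K" "independent K" "?K \<subseteq> span K" "card K = dim ?K"
    using basis_exists by blast
  obtain D where D: "K \<subseteq> D" "D \<subseteq> C" "independent D" "C \<subseteq> span D"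
    using maximal_independent_subset_extend[of K C] K(1,2) by auto
  have finD: "finite D" using independent_span_bound[OF C(1) D(3)] D(2) C(2) by auto
  let ?E = "D - K"
  have inj: "x = 0" if x: "x \<in> span ?E" "g x = 0" for x
  proof -
    have "span ?E \<subseteq> C" using D(2) CS by (intro span_minimal) auto
    then have xK: "x \<in> span K" using x K(3) by auto
    have "representation D x = representation K x" "representation D x = representation ?E x"
      using D(1,3) xK x(1) by (auto intro!: representation_extend)
    then have "representation D x b = 0" for b
      using representation_ne_zero[of K x b] representation_ne_zero[of ?E x b] by fastforce
    moreover have "x \<in> span D" using xK span_mono[OF D(1)] by auto
    ultimately show "x = 0"
      using sum_nonzero_representation_eq[OF D(3), of x] by simp
  qed
  have injE: "inj_on g (span ?E)"
    by (rule inj_onI) (metis g.diff inj right_minus_eq span_diff)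
  have "independent ?E" using D(3) independent_mono by blast
  then have indE: "V2.independent (g ` ?E)"
    using g.independent_injective_image injE by blast
  have "g ` C = V2.span (g ` ?E)"
  proof -
    have "g ` C = V2.span (g ` D)" using D CS g.span_image[of D] by (metis span_minimal subset_antisym)
    also have "g ` D = g ` ?E \<union> g ` K" using D(1) by auto
    also have "V2.span (g ` ?E \<union> g ` K) = V2.span (g ` ?E)"
    proof (rule V2.span_eq[THEN iffD2], intro conjI)
      show "g ` ?E \<union> g ` K \<subseteq> V2.span (g ` ?E)"
        using K(1) V2.span_superset[of "g ` ?E"] V2.span_zero[of "g ` ?E"] by force
      show "g ` ?E \<subseteq> V2.span (g ` ?E \<union> g ` K)" by (auto intro: V2.span_base)
    qed
    finally show ?thesis .
  qed
  then have "V2.dim (g ` C) = card (g ` ?E)"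
    using indE by (simp add: V2.dim_eq_card_independent)
  also have "\<dots> = card ?E" by (intro card_image inj_on_subset[OF injE] span_superset)
  also have "\<dots> = card D - card K" using D(1) finD by (simp add: card_Diff_subset finite_subset)
  finally have "V2.dim (g ` C) = card D - card K" .
  moreover have "card D = dim C" using D by (intro basis_card_eq_dim) auto
  moreover have "card K \<le> card D" using D(1) finD by (intro card_mono)
  ultimately show ?thesis using K(4) by simp
qed

end
section \<open>Determinants in the coordinates of the space of quartics\<close>

abbreviation lookup where "lookup \<equiv> Poly_Mapping.lookup"
abbreviation keys where "keys \<equiv> Poly_Mapping.keys"

lemma sum_singles: "(\<Sum>m\<in>keys p. Poly_Mapping.single m (lookup p m)) = p"
  by (rule poly_mapping_eqI)
    (auto simp: lookup_sum lookup_single when_def in_keys_iff if_distrib cong: if_cong)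

definition eval_monom :: "('v \<Rightarrow>\<^sub>0 nat) \<Rightarrow> ('v \<Rightarrow> complex) \<Rightarrow> complex"
  where "eval_monom m a = (\<Prod>v\<in>keys m. a v ^ lookup m v)"

lemma eval_monom_superset:
  "finite A \<Longrightarrow> keys m \<subseteq> A \<Longrightarrow> eval_monom m a = (\<Prod>v\<in>A. a v ^ lookup m v)"
  unfolding eval_monom_def by (rule prod.mono_neutral_left) (auto simp: in_keys_iff)

lemma eval_monom_add: "eval_monom (m + n) a = eval_monom m a * eval_monom n a"
proof -
  have "keys (m + n) \<subseteq> keys m \<union> keys n" by (rule Poly_Mapping.keys_add)
  then show ?thesis
    using eval_monom_superset[of "keys m \<union> keys n" "m + n" a]
      eval_monom_superset[of "keys m \<union> keys n" m a] eval_monom_superset[of "keys m \<union> keys n" n a]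
    by (simp add: lookup_add power_add prod.distrib)
qed

lemma eval_poly_superset:
  "finite A \<Longrightarrow> keys p \<subseteq> A \<Longrightarrow> eval_poly p a = (\<Sum>m\<in>A. lookup p m * eval_monom m a)"
  unfolding eval_poly_def eval_monom_def[symmetric]
  by (rule sum.mono_neutral_left) (auto simp: in_keys_iff)

lemma eval_poly_single: "eval_poly (Poly_Mapping.single m c) a = c * eval_monom m a"
  by (subst eval_poly_superset[of "{m}"]) auto

lemma eval_poly_add: "eval_poly (p + q) a = eval_poly p a + eval_poly q a"
proof -
  have "keys (p + q) \<subseteq> keys p \<union> keys q" by (rule Poly_Mapping.keys_add)
  then show ?thesis
    using eval_poly_superset[of "keys p \<union> keys q" "p + q" a]
      eval_poly_superset[of "keys p \<union> keys q" p a] eval_poly_superset[of "keys p \<union> keys q" q a]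
    by (simp add: lookup_add distrib_right sum.distrib)
qed

lemma eval_poly_0: "eval_poly 0 a = 0"
  by (simp add: eval_poly_def)

lemma eval_poly_sum: "eval_poly (sum f A) a = (\<Sum>x\<in>A. eval_poly (f x) a)"
  by (induction A rule: infinite_finite_induct) (simp_all add: eval_poly_add eval_poly_0)

lemma eval_poly_mult: "eval_poly (p * q) a = eval_poly p a * eval_poly q a"
proof -
  have "p * q = (\<Sum>m\<in>keys p. \<Sum>n\<in>keys q. Poly_Mapping.single (m + n) (lookup p m * lookup q n))"
    by (subst sum_singles[of p, symmetric], subst sum_singles[of q, symmetric])
      (simp add: sum_product mult_single del: sum_singles)
  also have "eval_poly \<dots> a = (\<Sum>m\<in>keys p. \<Sum>n\<in>keys q. (lookup p m * eval_monom m a) * (lookup q n * eval_monom n a))"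
    by (simp add: eval_poly_sum eval_poly_single eval_monom_add mult_ac)
  also have "\<dots> = eval_poly p a * eval_poly q a"
    by (simp add: eval_poly_def eval_monom_def sum_product)
  finally show ?thesis .
qed

lemma eval_poly_ring_hom: "comm_ring_hom (\<lambda>p. eval_poly p a)"
proof
  show "eval_poly 1 a = 1"
    using eval_poly_single[of 0 1 a] by (simp add: eval_monom_def)
qed (simp_all add: eval_poly_0 eval_poly_add eval_poly_mult)

lemma mdeg_add: "mdeg (m + n) = mdeg m + mdeg n"
proof -
  have *: "mdeg l = (\<Sum>v\<in>keys m \<union> keys n. lookup l v)" if "keys l \<subseteq> keys m \<union> keys n" for l
    unfolding mdeg_def using that by (intro sum.mono_neutral_left) (auto simp: in_keys_iff)
  show ?thesis
    using Poly_Mapping.keys_add[of m n]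
    by (simp add: *[of "m + n"] *[of m] *[of n] lookup_add sum.distrib)
qed

lemma forms_mult: "f \<in> forms d \<Longrightarrow> g \<in> forms e \<Longrightarrow> f * g \<in> forms (d + e)"
proof -
  assume fg: "f \<in> forms d" "g \<in> forms e"
  have "mdeg m = d + e" if m: "m \<in> keys (f * g)" for m
  proof -
    obtain m1 m2 where "m = m1 + m2" "m1 \<in> keys f" "m2 \<in> keys g"
      using keys_mult[of f g] m by auto
    with fg show ?thesis by (simp add: forms_def mdeg_add)
  qed
  then show ?thesis by (simp add: forms_def)
qed

definition coordinate_forms :: "nat \<Rightarrow> (4 \<Rightarrow>\<^sub>0 nat) mpoly set"
  where "coordinate_forms e = {H \<in> forms e. \<forall>m\<in>keys H. \<forall>a\<in>keys m. mdeg a = 4}"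

lemma coordinate_forms_mult:
  assumes "f \<in> coordinate_forms d" "g \<in> coordinate_forms e"
  shows "f * g \<in> coordinate_forms (d + e)"
proof -
  have "mdeg a = 4" if m: "m \<in> keys (f * g)" and a: "a \<in> keys m" for m a
  proof -
    obtain m1 m2 where "m = m1 + m2" "m1 \<in> keys f" "m2 \<in> keys g"
      using keys_mult[of f g] m by auto
    moreover from this a have "a \<in> keys m1 \<union> keys m2" using Poly_Mapping.keys_add[of m1 m2] by auto
    ultimately show ?thesis using assms by (auto simp: coordinate_forms_def)
  qed
  then show ?thesis using assms forms_mult by (auto simp: coordinate_forms_def)
qed

lemma coordinate_forms_add:
  assumes "f \<in> coordinate_forms d" "g \<in> coordinate_forms d"
  shows "f + g \<in> coordinate_forms d"
proof -
  have "m \<in> keys f \<or> m \<in> keys g" if "m \<in> keys (f + g)" for m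
    using that Poly_Mapping.keys_add[of f g] by blast
  then show ?thesis using assms by (simp add: coordinate_forms_def forms_def) blast
qed

lemma coordinate_forms_uminus: "f \<in> coordinate_forms d \<Longrightarrow> - f \<in> coordinate_forms d"
  by (simp add: coordinate_forms_def forms_def)

lemma coordinate_forms_0: "0 \<in> coordinate_forms d"
  by (simp add: coordinate_forms_def forms_def)

lemma coordinate_forms_sum:
  "(\<And>x. x \<in> A \<Longrightarrow> f x \<in> coordinate_forms d) \<Longrightarrow> sum f A \<in> coordinate_forms d"
  by (induction A rule: infinite_finite_induct) (auto intro: coordinate_forms_0 coordinate_forms_add)

lemma coordinate_forms_1: "1 \<in> coordinate_forms 0"
  by (simp add: coordinate_forms_def forms_def mdeg_def)

lemma coordinate_forms_prod:
  "finite A \<Longrightarrow> (\<And>x. x \<in> A \<Longrightarrow> f x \<in> coordinate_forms 1) \<Longrightarrow> prod f A \<in> coordinate_forms (card A)"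
proof (induction A rule: finite_induct)
  case (insert x A)
  then show ?case using coordinate_forms_mult[of "f x" 1 "prod f A" "card A"] by simp
qed (simp add: coordinate_forms_1)

lemma det_coordinate_forms:
  fixes P :: "nat \<Rightarrow> nat \<Rightarrow> (4 \<Rightarrow>\<^sub>0 nat) mpoly"
  assumes "\<And>i j. i < n \<Longrightarrow> j < n \<Longrightarrow> P i j \<in> coordinate_forms 1"
  shows "det (mat n n (\<lambda>(i, j). P i j)) \<in> coordinate_forms n"
proof -
  have "signof p * (\<Prod>i = 0..<n. P i (p i)) \<in> coordinate_forms n" if "p permutes {0..<n}" for p
  proof -
    have "p i < n" if "i < n" for i using permutes_in_image[OF \<open>p permutes {0..<n}\<close>, of i] that by simp
    then have "(\<Prod>i = 0..<n. P i (p i)) \<in> coordinate_forms n"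
      using coordinate_forms_prod[of "{0..<n}" "\<lambda>i. P i (p i)"] assms by simp
    then show ?thesis by (simp add: sign_def coordinate_forms_uminus)
  qed
  moreover have "det (mat n n (\<lambda>(i, j). P i j)) =
      (\<Sum>p\<in>{p. p permutes {0..<n}}. signof p * (\<Prod>i = 0..<n. P i (p i)))"
    by (subst det_def'[of _ n]) (auto intro!: sum.cong prod.cong simp: permutes_in_image[of _ "{0..<n}", simplified])
  ultimately show ?thesis by (auto intro: coordinate_forms_sum)
qed

lemma finite_quartic_exponents: "finite {m :: 4 \<Rightarrow>\<^sub>0 nat. mdeg m = d}"
proof -
  have "lookup m i \<le> d" if "mdeg m = d" for m :: "4 \<Rightarrow>\<^sub>0 nat" and i
    using that member_le_sum[of i UNIV "lookup m"] by (simp add: mdeg_conv_sum)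
  then have "lookup ` {m :: 4 \<Rightarrow>\<^sub>0 nat. mdeg m = d} \<subseteq> PiE UNIV (\<lambda>_. {..d})" by auto
  moreover have "finite (PiE UNIV (\<lambda>_. {..d}) :: (4 \<Rightarrow> nat) set)"
    by (rule finite_PiE) auto
  ultimately have "finite (lookup ` {m :: 4 \<Rightarrow>\<^sub>0 nat. mdeg m = d})" by (rule finite_subset)
  then show ?thesis by (rule finite_imageD) (rule inj_onI, rule poly_mapping_eqI, simp)
qed

definition fun_scal :: "complex \<Rightarrow> ('k \<Rightarrow> complex) \<Rightarrow> 'k \<Rightarrow> complex"
  where "fun_scal c f = (\<lambda>k. c * f k)"

lemma fun_scal_vector_space: "vector_space fun_scal"
  by unfold_locales (auto simp: fun_scal_def fun_eq_iff algebra_simps)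

lemma complex_vector_space: "vector_space ((*) :: complex \<Rightarrow> complex \<Rightarrow> complex)"
  by unfold_locales (simp_all add: algebra_simps)

text \<open>
  Functionals of \<open>F\<close> are linear forms in its coefficients, so by the Leibniz formula the determinant
  is a form of degree \<open>n\<close> in them.
\<close>

lemma zariski_closed_determinant:
  fixes M :: "4 mpoly \<Rightarrow> nat \<Rightarrow> nat \<Rightarrow> complex"
  assumes lin: "\<And>i j. Vector_Spaces.linear scal (*) (\<lambda>F. M F i j)"
  shows "zariski_closed {P \<in> PR4. \<forall>F\<in>P. det (mat n n (\<lambda>(i, j). M F i j)) = 0}"
proof -
  let ?D = "{m :: 4 \<Rightarrow>\<^sub>0 nat. mdeg m = 4}"
  define P where "P i j = (\<Sum>m\<in>?D. Poly_Mapping.single (Poly_Mapping.single m (1::nat))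
    (M (Poly_Mapping.single m 1) i j))" for i j
  define H where "H = det (mat n n (\<lambda>(i, j). P i j))"
  have "P i j \<in> coordinate_forms 1" for i j
    unfolding P_def by (rule coordinate_forms_sum) (auto simp: coordinate_forms_def forms_def mdeg_def)
  then have H: "H \<in> PR4_forms"
    using det_coordinate_forms[of n P] by (auto simp: H_def coordinate_forms_def PR4_forms_def)
  have evP: "eval_poly (P i j) (lookup F) = M F i j" if F: "F \<in> forms 4" for F i j
  proof -
    interpret M: Vector_Spaces.linear scal "(*)" "\<lambda>F. M F i j" by (rule lin)
    have "F = (\<Sum>m\<in>?D. scal (lookup F m) (Poly_Mapping.single m 1))"
    proof (rule poly_mapping_eqI)
      fix m
      have "lookup F m = 0" if "mdeg m \<noteq> 4" using F that by (auto simp: forms_def in_keys_iff)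
      then show "lookup F m = lookup (\<Sum>m\<in>?D. scal (lookup F m) (Poly_Mapping.single m 1)) m"
        by (simp add: lookup_sum scal_def Poly_Mapping.map.rep_eq lookup_single when_def
            finite_quartic_exponents if_distrib cong: if_cong)
    qed
    then have "M F i j = M (\<Sum>m\<in>?D. scal (lookup F m) (Poly_Mapping.single m 1)) i j" by simp
    also have "\<dots> = (\<Sum>m\<in>?D. M (Poly_Mapping.single m 1) i j * lookup F m)"
      by (simp add: M.sum M.scale mult.commute)
    also have "\<dots> = eval_poly (P i j) (lookup F)"
      by (simp add: P_def eval_poly_sum eval_poly_single eval_monom_def)
    finally show ?thesis by simp
  qed
  have evH: "eval_poly H (lookup F) = det (mat n n (\<lambda>(i, j). M F i j))" if F: "F \<in> forms 4" for F
  proof -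
    interpret ev: comm_ring_hom "\<lambda>p. eval_poly p (lookup F)" by (rule eval_poly_ring_hom)
    have "eval_poly H (lookup F) = det (map_mat (\<lambda>p. eval_poly p (lookup F)) (mat n n (\<lambda>(i, j). P i j)))"
      by (simp add: H_def)
    also have "map_mat (\<lambda>p. eval_poly p (lookup F)) (mat n n (\<lambda>(i, j). P i j)) = mat n n (\<lambda>(i, j). M F i j)"
      by (rule eq_matI) (auto simp: evP F)
    finally show ?thesis .
  qed
  have "F \<in> forms 4" if "Q \<in> PR4" "F \<in> Q" for Q F
    using that by (auto simp: PR4_def point_def mpoly.subspace_scale[OF subspace_forms])
  then have "{P \<in> PR4. \<forall>F\<in>P. det (mat n n (\<lambda>(i, j). M F i j)) = 0} =
      {P \<in> PR4. \<forall>F\<in>P. \<forall>H\<in>{H}. eval_poly H (lookup F) = 0}"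
    using evH by auto
  with H show ?thesis unfolding zariski_closed_def by (intro exI[of _ "{H}"]) auto
qed

text \<open>
  The images under \<open>L F0\<close> of a basis of \<open>U\<close> are independent, so they have dual functionals. These
  select a square submatrix of \<open>L F\<close> that is the identity for \<open>F0\<close> and singular for each \<open>F\<close> in \<open>W\<close>.
  The same holds for the multiples of \<open>F\<close>, as \<open>L\<close> is homogeneous in \<open>F\<close>.
\<close>

lemma not_in_zariski_closure:
  fixes s :: "complex \<Rightarrow> 'u::ab_group_add \<Rightarrow> 'u" and L :: "4 mpoly \<Rightarrow> 'u \<Rightarrow> 'k \<Rightarrow> complex"
  assumes vs: "vector_space s" and B: "finite B" and U: "module.span s B = U"
    and linF: "\<And>u k. Vector_Spaces.linear scal (*) (\<lambda>F. L F u k)"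
    and linU: "\<And>F k. Vector_Spaces.linear s (*) (\<lambda>u. L F u k)"
    and inj: "\<And>u. u \<in> U \<Longrightarrow> (\<And>k. L F0 u k = 0) \<Longrightarrow> u = 0"
    and W: "W \<subseteq> forms 4 - {0}"
    and ker: "\<And>F. F \<in> W \<Longrightarrow> \<exists>u\<in>U. u \<noteq> 0 \<and> (\<forall>k. L F u k = 0)"
  shows "point F0 \<notin> zariski_closure (point ` W)"
proof -
  interpret V: vector_space s by (rule vs)
  let ?fs = "fun_scal :: complex \<Rightarrow> ('k \<Rightarrow> complex) \<Rightarrow> 'k \<Rightarrow> complex"
  interpret Fn: vector_space ?fs by (rule fun_scal_vector_space)
  interpret cc: vector_space "(*) :: complex \<Rightarrow> complex \<Rightarrow> complex"
    by (rule complex_vector_space)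
  interpret P: vector_space_pair ?fs "(*) :: complex \<Rightarrow> complex \<Rightarrow> complex" ..
  obtain C where C: "C \<subseteq> U" "V.independent C" "U \<subseteq> V.span C" by (meson V.basis_exists)
  have Usub: "V.subspace U" using U by auto
  have finC: "finite C" using V.independent_span_bound[OF B C(2)] C(1) U by auto
  define n where "n = card C"
  obtain b where b: "bij_betw b {0..<n} C" using ex_bij_betw_nat_finite[OF finC] n_def by auto
  have bC: "b j \<in> C" if "j < n" for j using b that by (auto simp: bij_betw_def)
  have linL: "Vector_Spaces.linear s fun_scal (L F)" for F
  proof -
    show ?thesis
      unfolding Vector_Spaces.linear_iff
    proof (intro conjI allI V.vector_space_axioms Fn.vector_space_axioms)
      fix u v show "L F (u + v) = L F u + L F v"
        by (rule ext) (use linU[unfolded Vector_Spaces.linear_iff] in auto)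
    next
      fix c u show "L F (s c u) = fun_scal c (L F u)"
        unfolding fun_scal_def by (rule ext) (use linU[unfolded Vector_Spaces.linear_iff] in auto)
    qed
  qed
  interpret L0: Vector_Spaces.linear s fun_scal "L F0" by (rule linL)
  have injU: "inj_on (L F0) U"
  proof (rule inj_onI)
    fix u v assume uv: "u \<in> U" "v \<in> U" "L F0 u = L F0 v"
    then have "u - v \<in> U" by (simp add: V.subspace_diff[OF Usub])
    then have "u - v = 0" using inj[of "u - v"] uv L0.diff[of u v] by auto
    then show "u = v" by simp
  qed
  have spC: "V.span C = U" using C Usub by (metis V.span_minimal subset_antisym)
  have ind: "Fn.independent (L F0 ` C)"
    using L0.independent_injective_image[OF C(2)] injU spC by simp
  have inj0: "inj_on (\<lambda>j. L F0 (b j)) {0..<n}"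
    using comp_inj_on[of b "{0..<n}" "L F0"] b injU C(1)
    by (auto simp: bij_betw_def comp_def intro: inj_on_subset)
  have "\<exists>g. Vector_Spaces.linear fun_scal (*) g \<and> (\<forall>x\<in>L F0 ` C. g x = (if x = L F0 (b i) then 1 else 0))" for i
    by (rule P.linear_independent_extend[OF ind])
  then obtain \<phi> where \<phi>: "\<And>i. Vector_Spaces.linear fun_scal (*) (\<phi> i)"
    and dual: "\<And>i x. x \<in> L F0 ` C \<Longrightarrow> \<phi> i x = (if x = L F0 (b i) then 1 else 0)"
    by metis
  define M where "M F i j = \<phi> i (L F (b j))" for F i j
  have linM: "Vector_Spaces.linear scal (*) (\<lambda>F. M F i j)" for i j
  proof -
    interpret \<phi>: Vector_Spaces.linear fun_scal "(*)" "\<phi> i" by (rule \<phi>)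
    show ?thesis
      unfolding Vector_Spaces.linear_iff
    proof (intro conjI allI mpoly.vector_space_axioms complex_vector_space)
      fix F G
      have "L (F + G) (b j) = L F (b j) + L G (b j)"
        by (rule ext) (use linF[unfolded Vector_Spaces.linear_iff] in auto)
      then show "M (F + G) i j = M F i j + M G i j" by (simp add: M_def \<phi>.add)
    next
      fix c F
      have "L (scal c F) (b j) = fun_scal c (L F (b j))"
        unfolding fun_scal_def by (rule ext) (use linF[unfolded Vector_Spaces.linear_iff] in auto)
      then show "M (scal c F) i j = c * M F i j" using \<phi>.scale[of c "L F (b j)"] by (simp add: M_def)
    qed
  qed
  let ?M = "\<lambda>F. mat n n (\<lambda>(i, j). M F i j)"
  let ?Z = "{P \<in> PR4. \<forall>F\<in>P. det (?M F) = 0}"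
  have "point F \<in> ?Z" if "F \<in> W" for F
  proof -
    obtain u where u: "u \<in> U" "u \<noteq> 0" "\<And>k. L F u k = 0" using ker[OF \<open>F \<in> W\<close>] by blast
    obtain g where g: "u = (\<Sum>v\<in>C. s (g v) v)"
      using u(1) spC V.span_finite[OF finC] by auto
    have g': "u = (\<Sum>j\<in>{0..<n}. s (g (b j)) (b j))"
      unfolding g by (rule sum.reindex_bij_betw[OF b, symmetric])
    define v where "v = vec n (\<lambda>j. g (b j))"
    have "v \<noteq> 0\<^sub>v n"
    proof
      assume "v = 0\<^sub>v n"
      then have "g (b j) = 0" if "j < n" for j
        using that by (metis index_vec index_zero_vec(1) v_def)
      then have "u = 0" using g' by simp
      with u show False by simp
    qed
    have "det (?M (scal c F)) = 0" for c
    proof -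
      have lcF: "L (scal c F) x = (\<lambda>k. c * L F x k)" for x
        by (rule ext) (use linF[unfolded Vector_Spaces.linear_iff] in auto)
      have "?M (scal c F) *\<^sub>v v = 0\<^sub>v n"
      proof (rule eq_vecI)
        fix i assume "i < dim_vec (0\<^sub>v n)"
        then have i: "i < n" by simp
        interpret \<phi>: Vector_Spaces.linear fun_scal "(*)" "\<phi> i" by (rule \<phi>)
        interpret LF: Vector_Spaces.linear s fun_scal "L (scal c F)" by (rule linL)
        have "(?M (scal c F) *\<^sub>v v) $ i = (\<Sum>j\<in>{0..<n}. g (b j) * \<phi> i (L (scal c F) (b j)))"
          using i by (simp add: scalar_prod_def v_def M_def mult.commute)
        also have "\<dots> = \<phi> i (L (scal c F) u)"
          unfolding g' LF.sum \<phi>.sum by (intro sum.cong refl) (simp add: LF.scale \<phi>.scale)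
        also have "L (scal c F) u = 0" using u(3) by (simp add: lcF fun_eq_iff)
        finally show "(?M (scal c F) *\<^sub>v v) $ i = 0\<^sub>v n $ i" using i \<phi>.zero by (simp add: zero_fun_def)
      qed simp
      then show ?thesis
        using \<open>v \<noteq> 0\<^sub>v n\<close> det_0_iff_vec_prod_zero_field[of "?M (scal c F)" n]
        by (auto simp: v_def intro!: exI[of _ v])
    qed
    moreover have "point F \<in> PR4" using W that by (auto simp: PR4_def)
    ultimately show ?thesis by (auto simp: point_def)
  qed
  then have "zariski_closure (point ` W) \<subseteq> ?Z"
    unfolding zariski_closure_def
    by (intro hull_minimal zariski_closed_determinant linM) auto
  moreover have "point F0 \<notin> ?Z"
  proof -
    have "?M F0 = 1\<^sub>m n"
    proof (rule eq_matI)
      fix i j assume "i < dim_row (1\<^sub>m n)" "j < dim_col (1\<^sub>m n)"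
      then show "?M F0 $$ (i, j) = 1\<^sub>m n $$ (i, j)"
        using dual[of "L F0 (b j)" i] bC inj_onD[OF inj0, of j i] by (auto simp: M_def)
    qed auto
    then have "det (?M F0) = 1" by simp
    moreover have "F0 \<in> point F0" by (auto simp: point_def intro!: exI[of _ 1])
    ultimately show ?thesis by fastforce
  qed
  ultimately show ?thesis by blast
qed

section \<open>Forms and their derivatives\<close>

(* The degree of a linear form is to stay 1 and not become Suc 0, so that facts about forms 1 apply. *)
declare One_nat_def [simp del]

lemma UNIV_4: "(UNIV :: 4 set) = {0, 1, 2, 3}"
proof -
  have "i \<in> {0, 1, 2, 3}" for i :: 4
  proof (cases i)
    case (of_int z)
    then have "z \<in> {0, 1, 2, 3}" by auto
    with of_int show ?thesis by auto
  qed
  then show ?thesis by blast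
qed

lemma exhaust_4: "(i :: 4) = 0 \<or> i = 1 \<or> i = 2 \<or> i = 3"
  using UNIV_4 by auto

lemma forall_4: "(\<forall>i::4. P i) \<longleftrightarrow> P 0 \<and> P 1 \<and> P 2 \<and> P 3"
  by (metis (full_types) UNIV_4 UNIV_I empty_iff insert_iff)

lemma sum_4: "sum f (UNIV :: 4 set) = f 0 + f 1 + f 2 + f 3"
  unfolding UNIV_4 by (simp add: add.assoc)

lemma pdiff_commute: "pdiff i (pdiff j f) = pdiff j (pdiff i f)"
  by (rule poly_mapping_eqI) (auto simp: lookup_pdiff lookup_add lookup_single when_def add_ac)

lemma lookup_scal [simp]: "lookup (scal c p) m = c * lookup p m"
  by (simp add: scal_def Poly_Mapping.map.rep_eq when_def)

lemma pdiff_scal: "pdiff i (scal c f) = scal c (pdiff i f)"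
  by (rule poly_mapping_eqI) (simp add: lookup_pdiff)

lemma pdiff_minus: "pdiff i (f - g) = pdiff i f - pdiff i g"
  by (rule poly_mapping_eqI) (simp add: lookup_pdiff lookup_minus algebra_simps)

lemma scal_mult_left: "scal c f * g = scal c (f * g)"
  by (simp add: scal_conv_mult mult.assoc)

lemma scal_mult_right: "f * scal c g = scal c (f * g)"
  by (simp add: scal_conv_mult mult_ac)

lemma forms_add: "f \<in> forms d \<Longrightarrow> g \<in> forms d \<Longrightarrow> f + g \<in> forms d"
  by (rule mpoly.subspace_add[OF subspace_forms])

lemma forms_diff: "f \<in> forms d \<Longrightarrow> g \<in> forms d \<Longrightarrow> f - g \<in> forms d"
  by (rule mpoly.subspace_diff[OF subspace_forms])

lemma forms_uminus: "f \<in> forms d \<Longrightarrow> - f \<in> forms d"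
  by (rule mpoly.subspace_neg[OF subspace_forms])

lemma forms_scal: "f \<in> forms d \<Longrightarrow> scal c f \<in> forms d"
  by (rule mpoly.subspace_scale[OF subspace_forms])

lemma forms_sum: "(\<And>x. x \<in> A \<Longrightarrow> f x \<in> forms d) \<Longrightarrow> sum f A \<in> forms d"
  by (rule mpoly.subspace_sum[OF subspace_forms])

lemma forms_0: "0 \<in> forms d"
  by (rule mpoly.subspace_0[OF subspace_forms])

lemma one_forms: "1 \<in> forms 0"
  by (simp add: forms_def mdeg_def)

lemma X_forms: "X (i::4) \<in> forms 1"
  using X_mult_forms[OF one_forms, of i] by (simp add: One_nat_def)

lemmas forms_intros = forms_add forms_diff forms_uminus forms_scal forms_sum forms_0 X_forms

lemma form_0_const: "p \<in> forms 0 \<Longrightarrow> p = scal (lookup p 0) (1 :: 4 mpoly)"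
proof (rule poly_mapping_eqI)
  fix m :: "4 \<Rightarrow>\<^sub>0 nat"
  assume p: "p \<in> forms 0"
  have "m = 0" if "mdeg m = 0" using that by (simp add: mdeg_conv_sum) (metis poly_mapping_eqI lookup_zero)
  then have "m \<notin> keys p" if "m \<noteq> 0" using p that by (auto simp: forms_def)
  then have "lookup p m = 0" if "m \<noteq> 0" using that by (simp add: in_keys_iff)
  then show "lookup p m = lookup (scal (lookup p 0) 1) m" by (simp add: lookup_one when_def)
qed

text \<open>
  Euler's formula recovers a form of positive degree from its derivatives.
\<close>

lemma form_eq_0_of_pdiff:
  assumes p: "p \<in> forms d" "0 < d" and 0: "\<And>i. pdiff (i::4) p = 0"
  shows "p = 0"
proof -
  have "scal (of_nat d) p = of_nat d * p" by (simp add: scal_conv_mult)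
  also have "\<dots> = (\<Sum>i\<in>UNIV. X i * pdiff i p)" by (rule euler[OF p(1), symmetric])
  also have "\<dots> = 0" by (simp add: 0)
  finally show ?thesis using p(2) by simp
qed

text \<open>
  Derivatives at the origin. On forms of degree one, two and three these are the coefficients up to
  factorials; unlike the coefficients they are symmetric tensors, which treats squares and products of
  distinct variables alike.
\<close>

definition grad :: "4 mpoly \<Rightarrow> 4 \<Rightarrow> complex"
  where "grad p i = lookup (pdiff i p) 0"

definition hess :: "4 mpoly \<Rightarrow> 4 \<Rightarrow> 4 \<Rightarrow> complex"
  where "hess p i j = lookup (pdiff i (pdiff j p)) 0"

definition third :: "4 mpoly \<Rightarrow> 4 \<Rightarrow> 4 \<Rightarrow> 4 \<Rightarrow> complex"
  where "third p i j k = lookup (pdiff i (pdiff j (pdiff k p))) 0"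

lemma hess_sym: "hess p i j = hess p j i"
  by (simp add: hess_def pdiff_commute[of i])

lemma grad_simps:
  "grad (p + q) i = grad p i + grad q i" "grad (p - q) i = grad p i - grad q i"
  "grad (- p) i = - grad p i" "grad (scal c p) i = c * grad p i" "grad 0 i = 0"
  "grad (sum f A) i = (\<Sum>x\<in>A. grad (f x) i)"
  by (simp_all add: grad_def pdiff_add pdiff_minus pdiff_uminus pdiff_scal pdiff_sum lookup_add lookup_minus lookup_sum)

lemma hess_simps:
  "hess (p + q) i j = hess p i j + hess q i j" "hess (p - q) i j = hess p i j - hess q i j"
  "hess (- p) i j = - hess p i j" "hess (scal c p) i j = c * hess p i j" "hess 0 i j = 0"
  "hess (sum f A) i j = (\<Sum>x\<in>A. hess (f x) i j)"
  by (simp_all add: hess_def pdiff_add pdiff_minus pdiff_uminus pdiff_scal pdiff_sum lookup_add lookup_minus lookup_sum)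

lemma third_simps:
  "third (p + q) i j k = third p i j k + third q i j k"
  "third (scal c p) i j k = c * third p i j k" "third 0 i j k = 0"
  "third (sum f A) i j k = (\<Sum>x\<in>A. third (f x) i j k)"
  by (simp_all add: third_def pdiff_add pdiff_minus pdiff_uminus pdiff_scal pdiff_sum lookup_add lookup_minus lookup_sum)

lemma pdiff_form_1: "p \<in> forms 1 \<Longrightarrow> pdiff (i::4) p \<in> forms 0"
  using pdiff_forms(1)[of p 1 i] by simp

lemma pdiff_form_2: "p \<in> forms 2 \<Longrightarrow> pdiff (i::4) p \<in> forms 1"
  using pdiff_forms(1)[of p 2 i] by (simp add: One_nat_def)

lemma pdiff_form_3: "p \<in> forms 3 \<Longrightarrow> pdiff (i::4) p \<in> forms 2"
  using pdiff_forms(1)[of p 3 i] by simp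

lemma pdiff_form_4: "p \<in> forms 4 \<Longrightarrow> pdiff (i::4) p \<in> forms 3"
  using pdiff_forms(1)[of p 4 i] by simp

lemma form_1_eq_0:
  assumes p: "p \<in> forms 1" and 0: "\<And>i. grad p i = 0"
  shows "p = 0"
proof (rule form_eq_0_of_pdiff[OF p])
  show "pdiff i p = 0" for i
    using form_0_const[OF pdiff_form_1[OF p, of i]] 0[of i] by (simp add: grad_def)
qed simp

lemma form_2_eq_0:
  assumes p: "p \<in> forms 2" and 0: "\<And>i j. hess p i j = 0"
  shows "p = 0"
proof (rule form_eq_0_of_pdiff[OF p])
  show "pdiff j p = 0" for j
    using form_1_eq_0[OF pdiff_form_2[OF p, of j]] 0[of _ j] by (simp add: grad_def hess_def)
qed simp

lemma form_3_eq_0: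
  assumes p: "p \<in> forms 3" and 0: "\<And>i j k. third p i j k = 0"
  shows "p = 0"
proof (rule form_eq_0_of_pdiff[OF p])
  show "pdiff k p = 0" for k
    using form_2_eq_0[OF pdiff_form_3[OF p, of k]] 0[of _ _ k] by (simp add: hess_def third_def)
qed simp

lemma form_1_eqI: "p \<in> forms 1 \<Longrightarrow> q \<in> forms 1 \<Longrightarrow> (\<And>i. grad p i = grad q i) \<Longrightarrow> p = q"
  using form_1_eq_0[of "p - q"] by (simp add: grad_simps forms_diff)

lemma form_2_eqI: "p \<in> forms 2 \<Longrightarrow> q \<in> forms 2 \<Longrightarrow> (\<And>i j. hess p i j = hess q i j) \<Longrightarrow> p = q"
  using form_2_eq_0[of "p - q"] by (simp add: hess_simps forms_diff)

lemma pdiff_one: "pdiff i 1 = (0 :: 4 mpoly)"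
  by (rule pdiff_forms(2)[OF one_forms]) simp

lemma pdiff_X: "pdiff i (X j :: 4 mpoly) = (if i = j then 1 else 0)"
  using pdiff_X_mult[of i j 1] by (simp add: pdiff_one)

lemma grad_X: "grad (X j) i = (if i = j then 1 else 0)"
  by (simp add: grad_def pdiff_X lookup_one)

lemma linear_form_expand: "p \<in> forms 1 \<Longrightarrow> p = (\<Sum>i\<in>UNIV. scal (grad p i) (X i))"
  by (rule form_1_eqI) (auto intro!: forms_intros simp: grad_simps grad_X if_distrib cong: if_cong)

lemma pdiff_linear_mult:
  assumes "k \<in> forms 1"
  shows "pdiff i (k * f) = k * pdiff i f + scal (grad k i) f"
proof -
  have *: "scal c (pdiff i (X a * f)) = scal c (X a) * pdiff i f + (if a = i then scal c f else 0)" for a c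
    by (auto simp: pdiff_X_mult mpoly.scale_right_distrib scal_mult_left)
  have "pdiff i (k * f) = (\<Sum>a\<in>UNIV. scal (grad k a) (pdiff i (X a * f)))"
    by (subst linear_form_expand[OF assms])
      (simp add: sum_distrib_right pdiff_sum scal_mult_left pdiff_scal)
  also have "\<dots> = (\<Sum>a\<in>UNIV. scal (grad k a) (X a)) * pdiff i f + scal (grad k i) f"
    by (simp add: * sum.distrib sum_distrib_right)
  finally show ?thesis using linear_form_expand[OF assms] by simp
qed

lemma lookup_linear_mult_0: "(k :: 4 mpoly) \<in> forms 1 \<Longrightarrow> lookup (k * f) 0 = 0"
  by (subst linear_form_expand[of k])
    (auto simp: sum_distrib_right scal_mult_left lookup_sum lookup_X_mult)

lemma hess_linear_mult:
  assumes "k \<in> forms 1" "b \<in> forms 1"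
  shows "hess (k * b) i j = grad k i * grad b j + grad k j * grad b i"
  by (simp add: hess_def pdiff_linear_mult assms pdiff_add pdiff_scal lookup_add grad_def
      lookup_linear_mult_0)

lemma hess_XX: "hess (X a * X b) i j = (if i = a \<and> j = b then 1 else 0) + (if i = b \<and> j = a then 1 else 0)"
  unfolding hess_linear_mult[OF X_forms X_forms] grad_X
  by (cases "i = a"; cases "j = b"; cases "i = b"; cases "j = a"; simp only: if_True if_False; simp)

lemma third_linear_mult:
  assumes "k \<in> forms 1"
  shows "third (k * q) i j l = grad k i * hess q j l + grad k j * hess q i l + grad k l * hess q i j"
  by (simp add: third_def pdiff_linear_mult assms pdiff_add pdiff_scal lookup_add hess_def
      lookup_linear_mult_0 pdiff_commute)

lemma third_X_mult:
  "third (X a * q) i j l = (if i = a then hess q j l else 0) + (if j = a then hess q i l else 0)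
    + (if l = a then hess q i j else 0)"
  by (simp add: third_linear_mult X_forms grad_X)

text \<open>
  On symmetric matrices this is the inverse of \<open>hess\<close>.
\<close>

definition quad :: "(4 \<Rightarrow> 4 \<Rightarrow> complex) \<Rightarrow> 4 mpoly"
  where "quad g = (\<Sum>i\<in>UNIV. \<Sum>j\<in>UNIV. scal (g i j / 2) (X i * X j))"

lemma XX_forms: "X (i::4) * X j \<in> forms 2"
  using forms_mult[OF X_forms X_forms] by (simp add: numeral_2_eq_2)

lemma quad_forms: "quad g \<in> forms 2"
  unfolding quad_def by (intro forms_sum forms_scal XX_forms)

lemma hess_quad: "hess (quad g) i j = (g i j + g j i) / 2"
proof -
  have "hess (quad g) i j = (\<Sum>a\<in>UNIV. \<Sum>b\<in>UNIV. if j = b then (if i = a then g a b / 2 else 0) else 0)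
     + (\<Sum>a\<in>UNIV. \<Sum>b\<in>UNIV. if i = b then (if j = a then g a b / 2 else 0) else 0)"
    unfolding quad_def hess_simps sum.distrib[symmetric] hess_XX
    by (intro sum.cong refl) auto
  also have "\<dots> = (g i j + g j i) / 2"
    by (simp add: add_divide_distrib)
  finally show ?thesis .
qed

lemma quad_hess: "q \<in> forms 2 \<Longrightarrow> quad (hess q) = q"
  by (rule form_2_eqI) (auto simp: quad_forms hess_quad hess_sym)

text \<open>
  Linear relations \<open>\<Sum>\<^sub>m x\<^sub>m q\<^sub>m = 0\<close> between quadrics become equations between the entries of their
  Hessians; this is where the syzygy computations become linear algebra over \<open>\<complex>\<close>.
\<close>

lemma linear_relation_iff_hess:
  assumes q: "\<And>m. q m \<in> forms 2"
  shows "(\<Sum>m\<in>UNIV. X m * q m) = 0 \<longleftrightarrow>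
    (\<forall>i j k. hess (q i) j k + hess (q j) i k + hess (q k) i j = 0)"
proof -
  have f: "(\<Sum>m\<in>UNIV. X m * q m) \<in> forms 3"
    using X_mult_forms[OF q] by (intro forms_sum) (simp add: numeral_3_eq_3 numeral_2_eq_2)
  have *: "third (\<Sum>m\<in>UNIV. X m * q m) i j k = hess (q i) j k + hess (q j) i k + hess (q k) i j" for i j k
    by (simp add: third_simps third_X_mult sum.distrib)
  show ?thesis
  proof
    assume "(\<Sum>m\<in>UNIV. X m * q m) = 0"
    then show "\<forall>i j k. hess (q i) j k + hess (q j) i k + hess (q k) i j = 0"
      using * by (simp add: third_simps)
  next
    assume "\<forall>i j k. hess (q i) j k + hess (q j) i k + hess (q k) i j = 0"
    then show "(\<Sum>m\<in>UNIV. X m * q m) = 0" using form_3_eq_0[OF f] by (simp add: *)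
  qed
qed

section \<open>Apolarity in terms of Hessians\<close>

definition diff_monom :: "(4 \<Rightarrow>\<^sub>0 nat) \<Rightarrow> 4 mpoly \<Rightarrow> 4 mpoly"
  where "diff_monom a F = (pdiff 0 ^^ lookup a 0) ((pdiff 1 ^^ lookup a 1) ((pdiff 2 ^^ lookup a 2) ((pdiff 3 ^^ lookup a 3) F)))"

lemma diff_action_superset:
  "finite A \<Longrightarrow> keys G \<subseteq> A \<Longrightarrow> diff_action G F = (\<Sum>a\<in>A. scal (lookup G a) (diff_monom a F))"
  unfolding diff_action_def diff_monom_def
  by (rule sum.mono_neutral_left) (auto simp: in_keys_iff)

lemma diff_action_add: "diff_action (G + H) F = diff_action G F + diff_action H F"
proof -
  have "keys (G + H) \<subseteq> keys G \<union> keys H" by (rule Poly_Mapping.keys_add)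
  then show ?thesis
    using diff_action_superset[of "keys G \<union> keys H" "G + H" F]
      diff_action_superset[of "keys G \<union> keys H" G F] diff_action_superset[of "keys G \<union> keys H" H F]
    by (simp add: lookup_add mpoly.scale_left_distrib sum.distrib)
qed

lemma diff_action_scal: "diff_action (scal c G) F = scal c (diff_action G F)"
proof -
  have "keys (scal c G) \<subseteq> keys G" by (auto simp: in_keys_iff)
  then show ?thesis
    using diff_action_superset[of "keys G" "scal c G" F] diff_action_superset[of "keys G" G F]
    by (simp add: mpoly.scale_sum_right)
qed

lemma diff_action_0: "diff_action 0 F = 0"
  by (simp add: diff_action_def)

lemma diff_action_sum: "diff_action (sum f A) F = (\<Sum>x\<in>A. diff_action (f x) F)"
  by (induction A rule: infinite_finite_induct) (simp_all add: diff_action_add diff_action_0)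

lemma funpow_pdiff_linear:
  "(pdiff i ^^ n) (F + G) = (pdiff i ^^ n) F + (pdiff i ^^ n) G"
  "(pdiff i ^^ n) (scal c F) = scal c ((pdiff i ^^ n) F)"
  by (induction n) (simp_all add: pdiff_add pdiff_scal)

lemma diff_action_add_right: "diff_action G (F + F') = diff_action G F + diff_action G F'"
  by (simp add: diff_action_def funpow_pdiff_linear mpoly.scale_right_distrib sum.distrib)

lemma diff_action_scal_right: "diff_action G (scal c F) = scal c (diff_action G F)"
  by (simp add: diff_action_def funpow_pdiff_linear mpoly.scale_sum_right mult.commute)

lemma diff_action_X: "diff_action (X i) F = pdiff i F"
proof -
  show ?thesis
    using exhaust_4[of i] by (elim disjE) (simp_all add: diff_action_def X_def lookup_single One_nat_def)
qed

lemma diff_action_XX: "diff_action (X i * X j) F = pdiff i (pdiff j F)"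
proof -
  have "diff_action (X i * X j) F = diff_monom (Poly_Mapping.single i 1 + Poly_Mapping.single j 1) F"
    by (simp add: diff_action_def diff_monom_def X_def mult_single)
  then show ?thesis
    using exhaust_4[of i] exhaust_4[of j]
    by (elim disjE)
      (simp_all add: diff_monom_def lookup_add lookup_single One_nat_def numeral_2_eq_2 pdiff_commute)
qed

lemma diff_action_quadric:
  assumes "q \<in> forms 2"
  shows "diff_action q F = (\<Sum>i\<in>UNIV. \<Sum>j\<in>UNIV. scal (hess q i j / 2) (pdiff i (pdiff j F)))"
  by (subst quad_hess[OF assms, symmetric])
    (simp add: quad_def diff_action_sum diff_action_scal diff_action_XX)

lemma diff_action_linear_form:
  assumes "p \<in> forms 1"
  shows "diff_action p F = (\<Sum>i\<in>UNIV. scal (grad p i) (pdiff i F))"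
  by (subst linear_form_expand[OF assms]) (simp add: diff_action_sum diff_action_scal diff_action_X)

lemma apolar_subspace: "mpoly.subspace (apolar F)"
  by (rule mpoly.subspaceI) (auto simp: apolar_def diff_action_add diff_action_scal diff_action_0)

text \<open>
  The derivative \<open>q(F)\<close> is a quadric, so it is zero as soon as its Hessian is.
\<close>

lemma apolar_quadric_iff:
  assumes q: "q \<in> forms 2" and F: "F \<in> forms 4"
  shows "q \<in> apolar F \<longleftrightarrow>
    (\<forall>k l. (\<Sum>i\<in>UNIV. \<Sum>j\<in>UNIV. hess q i j * hess (pdiff i (pdiff j F)) k l) = 0)"
proof -
  have 2: "pdiff i (pdiff j F) \<in> forms 2" for i j
    by (intro pdiff_form_3 pdiff_form_4 F)
  have f: "diff_action q F \<in> forms 2"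
    unfolding diff_action_quadric[OF q] by (intro forms_sum forms_scal 2)
  have *: "hess (diff_action q F) k l = (\<Sum>i\<in>UNIV. \<Sum>j\<in>UNIV. hess q i j * hess (pdiff i (pdiff j F)) k l) / 2" for k l
    unfolding diff_action_quadric[OF q] hess_simps by (simp add: sum_divide_distrib)
  show ?thesis
  proof
    assume "q \<in> apolar F"
    then have "diff_action q F = 0" by (simp add: apolar_def)
    then show "\<forall>k l. (\<Sum>i\<in>UNIV. \<Sum>j\<in>UNIV. hess q i j * hess (pdiff i (pdiff j F)) k l) = 0"
      using * by (simp add: hess_simps)
  next
    assume "\<forall>k l. (\<Sum>i\<in>UNIV. \<Sum>j\<in>UNIV. hess q i j * hess (pdiff i (pdiff j F)) k l) = 0"
    then show "q \<in> apolar F" using form_2_eq_0[OF f] by (simp add: * apolar_def)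
  qed
qed

lemma nondegenerateI:
  assumes F: "F \<in> forms 4"
    and c: "\<And>c. (\<And>j k l. (\<Sum>i\<in>UNIV. c i * hess (pdiff l (pdiff i F)) j k) = 0) \<Longrightarrow> \<forall>i. c i = 0"
  shows "nondegenerate F"
proof -
  have "p = 0" if p: "p \<in> apolar F" "p \<in> forms 1" for p
  proof (rule form_1_eq_0[OF p(2)])
    have 0: "(\<Sum>i\<in>UNIV. scal (grad p i) (pdiff i F)) = 0"
      using p by (simp add: apolar_def diff_action_linear_form)
    have "(\<Sum>i\<in>UNIV. grad p i * hess (pdiff l (pdiff i F)) j k) = hess (pdiff l (\<Sum>i\<in>UNIV. scal (grad p i) (pdiff i F))) j k" for j k l
      by (simp add: pdiff_sum pdiff_scal hess_simps)
    then show "grad p i = 0" for i using c[of "grad p"] by (simp add: 0 hess_simps)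
  qed
  moreover have "0 \<in> apolar F \<inter> forms 1" by (simp add: apolar_def diff_action_0 forms_0)
  ultimately show ?thesis unfolding nondegenerate_def by blast
qed

lemma nondegenerate_nonzero: "nondegenerate F \<Longrightarrow> F \<noteq> 0"
proof
  assume F: "nondegenerate F" "F = 0"
  have "X 0 \<in> apolar F \<inter> forms 1" using F(2) X_forms[of 0] by (simp add: apolar_def diff_action_X)
  then have "X 0 \<in> {0 :: 4 mpoly}" using F(1) unfolding nondegenerate_def by blast
  then have "X (0::4) = 0" by blast
  then show False using grad_X[of 0 0] by (simp add: grad_simps)
qed

section \<open>Linear strands\<close>

text \<open>
  The cycles of degree \<open>p + 2\<close> in \<open>K\<^sub>p \<otimes> I\<close>: the quadrics of \<open>I\<close> for \<open>p = 0\<close>, the linear relations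
  among them for \<open>p = 1\<close> and the linear second syzygies for \<open>p = 2\<close>.
\<close>

definition linear_strand :: "nat \<Rightarrow> 4 mpoly set \<Rightarrow> chain set"
  where "linear_strand p I = {y \<in> kchains p (p + 2). (\<forall>T. y T \<in> I) \<and> koszul y = 0}"

lemma kchains_linear_iff: "z \<in> kchains p (Suc p) \<longleftrightarrow> (\<forall>T. z T \<in> forms 1 \<and> (card T \<noteq> p \<longrightarrow> z T = 0))"
  by (simp add: kchains_def One_nat_def)

lemma kchains_quadratic_iff: "z \<in> kchains p (p + 2) \<longleftrightarrow> (\<forall>T. z T \<in> forms 2 \<and> (card T \<noteq> p \<longrightarrow> z T = 0))"
  by (simp add: kchains_def)

lemma chain_scal_apply: "chain_scal c z T = scal c (z T)"
  by (simp add: chain_scal_def)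

lemma koszul_add: "koszul (y + z) = koszul y + koszul z"
  by (rule ext) (simp add: koszul_def contract_def distrib_left sum.distrib[symmetric] if_distrib cong: if_cong)

lemma koszul_linear: "Vector_Spaces.linear chain_scal chain_scal koszul"
  by (simp add: Vector_Spaces.linear_iff chain.vector_space_axioms koszul_add koszul_chain_scal)

lemma grad_functional: "Vector_Spaces.linear chain_scal (*) (\<lambda>y. grad (y T) i)"
  by (simp add: Vector_Spaces.linear_iff chain.vector_space_axioms complex_vector_space grad_simps chain_scal_def)

lemma hess_functional: "Vector_Spaces.linear chain_scal (*) (\<lambda>y. hess (y T) i j)"
  by (simp add: Vector_Spaces.linear_iff chain.vector_space_axioms complex_vector_space hess_simps chain_scal_def)

lemma kchains_subspace: "chain.subspace (kchains p j)"
  by (rule chain.subspaceI)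
    (auto simp: kchains_def chain_scal_def forms_0 forms_add forms_scal)

lemma linear_strand_subspace:
  assumes I: "mpoly.subspace I"
  shows "chain.subspace (linear_strand p I)"
proof -
  interpret K: Vector_Spaces.linear chain_scal chain_scal koszul by (rule koszul_linear)
  show ?thesis
    by (rule chain.subspaceI)
      (auto simp: linear_strand_def K.add K.scale K.zero chain.subspace_0[OF kchains_subspace]
        chain.subspace_add[OF kchains_subspace] chain.subspace_scale[OF kchains_subspace]
        mpoly.subspace_0[OF I] mpoly.subspace_add[OF I] mpoly.subspace_scale[OF I] chain_scal_apply)
qed

text \<open>
  The Koszul differential induces the connecting map \<open>Tor\<^sub>p\<^sub>+\<^sub>1(S/I, \<complex>) \<rightarrow> Tor\<^sub>p(I, \<complex>)\<close>. It is onto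
  because the Koszul complex is exact. Its kernel consists of the boundaries: a cycle with linear
  coefficients in \<open>I\<close> is zero, so the boundaries are exactly the image of \<open>K\<^sub>p\<^sub>+\<^sub>2\<close>, which is the kernel by
  exactness.
\<close>

lemma tor_dim_linear_strand:
  assumes I: "mpoly.subspace I" and I1: "I \<inter> forms 1 = {0}"
  shows "tor_dim (Suc p) (p + 2) I = chain.dim (linear_strand p I)"
proof -
  interpret K: Vector_Spaces.linear chain_scal chain_scal koszul by (rule koszul_linear)
  let ?C = "cycles (Suc p) (p + 2) I"
  have C: "chain.subspace ?C"
    by (rule chain.subspaceI)
      (auto simp: cycles_def K.add K.scale K.zero chain.subspace_0[OF kchains_subspace]
        chain.subspace_add[OF kchains_subspace] chain.subspace_scale[OF kchains_subspace]
        mpoly.subspace_0[OF I] mpoly.subspace_add[OF I] mpoly.subspace_scale[OF I] chain_scal_apply)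
  have lin: "z T \<in> forms 1" if "z \<in> kchains (Suc p) (p + 2)" for z T
    using that kchains_linear_iff[of z "Suc p"] by simp
  obtain B where B: "finite B" "chain.span B = ?C"
  proof (rule chain.span_of_separating_functionals[OF C finite_class.finite_UNIV, of "\<lambda>x y. grad (y (fst x)) (snd x)"])
    show "\<forall>x\<in>UNIV. Vector_Spaces.linear chain_scal (*) (\<lambda>y. grad (y (fst x)) (snd x))"
      using grad_functional by blast
    show "\<forall>z\<in>?C. (\<forall>x\<in>UNIV. grad (z (fst x)) (snd x) = 0) \<longrightarrow> z = 0"
    proof (intro ballI impI ext)
      fix z :: chain and T assume z: "z \<in> ?C" "\<forall>x\<in>UNIV. grad (z (fst x)) (snd x) = 0"
      show "z T = 0 T"
        using form_1_eq_0[OF lin[of z T]] z by (simp add: cycles_def)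
    qed
  qed
  have ker: "{z \<in> ?C. koszul z = 0} = boundaries (Suc p) (p + 2) I"
  proof (intro subset_antisym subsetI)
    fix z assume z: "z \<in> {z \<in> ?C. koszul z = 0}"
    then obtain w where "w \<in> kchains (Suc (Suc p)) (p + 2)" "z = koszul w"
      using koszul_exact[of z "Suc p" "p + 2"] by (auto simp: cycles_def)
    then show "z \<in> boundaries (Suc p) (p + 2) I"
      unfolding boundaries_def mem_Collect_eq
      by (intro exI[of _ w] exI[of _ 0]) (simp add: chain.subspace_0[OF kchains_subspace] mpoly.subspace_0[OF I])
  next
    fix z assume "z \<in> boundaries (Suc p) (p + 2) I"
    then obtain w v where z: "z = koszul w + v" "w \<in> kchains (Suc (Suc p)) (p + 2)"
      "v \<in> kchains (Suc p) (p + 2)" "\<And>T. v T \<in> I"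
      by (auto simp: boundaries_def)
    have "v T = 0" for T using I1 lin[OF z(3), of T] z(4)[of T] by blast
    then have "z = koszul w" using z(1) by (auto simp: fun_eq_iff)
    then show "z \<in> {z \<in> ?C. koszul z = 0}"
      using koszul_kchains[OF z(2)] by (simp add: cycles_def koszul_koszul mpoly.subspace_0[OF I])
  qed
  have im: "koszul ` ?C = linear_strand p I"
  proof (intro subset_antisym subsetI)
    fix y assume "y \<in> koszul ` ?C"
    then show "y \<in> linear_strand p I"
      using koszul_kchains[of _ p "p + 2"] by (auto simp: cycles_def linear_strand_def koszul_koszul)
  next
    fix y assume y: "y \<in> linear_strand p I"
    then obtain z where "z \<in> kchains (Suc p) (p + 2)" "y = koszul z"
      using koszul_exact[of y p "p + 2"] by (auto simp: linear_strand_def)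
    with y show "y \<in> koszul ` ?C" by (auto simp: cycles_def linear_strand_def)
  qed
  show ?thesis
    using chain.rank_nullity[OF chain.vector_space_axioms koszul_linear B]
    unfolding tor_dim_def ker im by simp
qed

lemma linear_strand_span:
  assumes I: "mpoly.subspace I"
  obtains B where "finite B" "chain.span B = linear_strand p I"
proof (rule chain.span_of_separating_functionals[OF linear_strand_subspace[OF I, of p] finite_class.finite_UNIV,
      of "\<lambda>x y. hess (y (fst x)) (fst (snd x)) (snd (snd x))"])
  show "\<forall>x\<in>UNIV. Vector_Spaces.linear chain_scal (*) (\<lambda>y. hess (y (fst x)) (fst (snd x)) (snd (snd x)))"
    using hess_functional by blast
  show "\<forall>y\<in>linear_strand p I. (\<forall>x\<in>UNIV. hess (y (fst x)) (fst (snd x)) (snd (snd x)) = 0) \<longrightarrow> y = 0"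
  proof (intro ballI impI ext)
    fix y :: chain and T
    assume y: "y \<in> linear_strand p I" "\<forall>x\<in>UNIV. hess (y (fst x)) (fst (snd x)) (snd (snd x)) = 0"
    have "y T \<in> forms 2" using y(1) kchains_quadratic_iff[of y p] by (auto simp: linear_strand_def)
    then show "y T = 0 T" using y(2) form_2_eq_0[of "y T"] by simp
  qed
qed

section \<open>Quadrics and syzygies as tensors\<close>

text \<open>
  The Hessians of the apolar quadrics. In \<open>first_syzygy\<close> the matrix \<open>s m\<close> is the Hessian of the
  coefficient \<open>q\<^sub>m\<close> in a relation \<open>\<Sum>\<^sub>m x\<^sub>m q\<^sub>m = 0\<close>; the cyclic sums are the third derivatives of its
  left side. In \<open>second_syzygy\<close> the relations \<open>t k\<close> are the contractions of a cycle in \<open>K\<^sub>2 \<otimes> I\<close>.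
\<close>

definition apolar_matrix :: "4 mpoly \<Rightarrow> (4 \<Rightarrow> 4 \<Rightarrow> complex) \<Rightarrow> bool"
  where "apolar_matrix F g \<longleftrightarrow> (\<forall>i j. g i j = g j i) \<and>
    (\<forall>k l. (\<Sum>i\<in>UNIV. \<Sum>j\<in>UNIV. g i j * hess (pdiff i (pdiff j F)) k l) = 0)"

definition first_syzygy :: "4 mpoly \<Rightarrow> (4 \<Rightarrow> 4 \<Rightarrow> 4 \<Rightarrow> complex) \<Rightarrow> bool"
  where "first_syzygy F s \<longleftrightarrow> (\<forall>m. apolar_matrix F (s m)) \<and>
    (\<forall>m i j. s m i j + s i m j + s j m i = 0)"

definition second_syzygy :: "4 mpoly \<Rightarrow> (4 \<Rightarrow> 4 \<Rightarrow> 4 \<Rightarrow> 4 \<Rightarrow> complex) \<Rightarrow> bool"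
  where "second_syzygy F t \<longleftrightarrow> (\<forall>k m i j. t k m i j = - t m k i j) \<and> (\<forall>k. first_syzygy F (t k))"

lemma apolar_matrix_hess:
  "F \<in> forms 4 \<Longrightarrow> q \<in> forms 2 \<Longrightarrow> apolar_matrix F (hess q) \<longleftrightarrow> q \<in> apolar F"
  by (auto simp: apolar_matrix_def apolar_quadric_iff hess_sym)

lemma hess_quad_apolar: "apolar_matrix F g \<Longrightarrow> hess (quad g) = g"
  by (intro ext) (simp add: hess_quad apolar_matrix_def)

lemma quad_apolar: "F \<in> forms 4 \<Longrightarrow> apolar_matrix F g \<Longrightarrow> quad g \<in> apolar F"
  using apolar_matrix_hess[of F "quad g"] by (simp add: quad_forms hess_quad_apolar)

lemma koszul_kchains_1:
  assumes "y \<in> kchains 1 (1 + 2)"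
  shows "koszul y = 0 \<longleftrightarrow> (\<Sum>m\<in>UNIV. X m * y {m}) = 0"
proof -
  have *: "koszul y {} = (\<Sum>m\<in>UNIV. X m * y {m})" by (simp add: koszul_def contract_def sgn_at_def)
  have "koszul y T = 0" if "T \<noteq> {}" for T
    using koszul_kchains[of y 0 3] assms that by (simp add: kchains_def)
  then have "koszul y = 0" if "koszul y {} = 0"
    using that by (intro ext) (metis zero_fun_apply)
  then have "koszul y = 0 \<longleftrightarrow> koszul y {} = 0" by auto
  then show ?thesis unfolding * .
qed

lemma contract_antisym: "contract k y {m} = - contract m y {k}"
  using contract_contract[of k m y "{}"] by (simp add: contract_def sgn_at_def)

lemma koszul_kchains_2:
  assumes "y \<in> kchains 2 (2 + 2)"
  shows "koszul y = 0 \<longleftrightarrow> (\<forall>k. (\<Sum>m\<in>UNIV. X m * contract k y {m}) = 0)"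
proof -
  have *: "koszul y {k} = - (\<Sum>m\<in>UNIV. X m * contract k y {m})" for k
    unfolding koszul_def sum_negf[symmetric] by (subst contract_antisym) simp
  have 0: "koszul y T = 0" if "card T \<noteq> 1" for T
    using koszul_kchains[of y 1 4] assms that by (simp add: kchains_def numeral_2_eq_2 One_nat_def)
  show ?thesis
  proof
    assume "koszul y = 0"
    then have "- (\<Sum>m\<in>UNIV. X m * contract k y {m}) = 0" for k unfolding *[symmetric] by simp
    then show "\<forall>k. (\<Sum>m\<in>UNIV. X m * contract k y {m}) = 0" unfolding neg_equal_0_iff_equal by blast
  next
    assume a: "\<forall>k. (\<Sum>m\<in>UNIV. X m * contract k y {m}) = 0"
    show "koszul y = 0"
    proof
      fix T show "koszul y T = 0 T"
      proof (cases "card T = 1")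
        case True
        then obtain k where "T = {k}" by (auto simp: card_1_singleton_iff One_nat_def)
        then show ?thesis using * a by simp
      qed (simp add: 0)
    qed
  qed
qed

lemma first_syzygy_iff:
  assumes F: "F \<in> forms 4" and q: "\<And>m. q m \<in> forms 2"
  shows "first_syzygy F (\<lambda>m. hess (q m)) \<longleftrightarrow> (\<forall>m. q m \<in> apolar F) \<and> (\<Sum>m\<in>UNIV. X m * q m) = 0"
  by (auto simp: first_syzygy_def apolar_matrix_hess[OF F q] linear_relation_iff_hess[OF q])

definition chain0 :: "4 mpoly \<Rightarrow> chain"
  where "chain0 q = (\<lambda>T. if T = {} then q else 0)"

definition chain1 :: "(4 \<Rightarrow> 4 mpoly) \<Rightarrow> chain"
  where "chain1 q = (\<lambda>T. if card T = 1 then q (the_elem T) else 0)"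

text \<open>
  The family \<open>q\<close> is antisymmetric; \<open>Min\<close> and \<open>Max\<close> put the two factors of \<open>e\<^sub>T\<close> in increasing order.
\<close>

definition chain2 :: "(4 \<Rightarrow> 4 \<Rightarrow> 4 mpoly) \<Rightarrow> chain"
  where "chain2 q = (\<lambda>T. if card T = 2 then q (Min T) (Max T) else 0)"

lemma chain1_apply [simp]: "chain1 q {m} = q m"
  by (simp add: chain1_def)

lemma contract_chain2:
  assumes "\<And>k m. q k m = - q m k"
  shows "contract k (chain2 q) {m} = q k m"
proof -
  have "q k k + q k k = 0" using assms[of k k] by (metis ab_left_minus)
  then have "scal 2 (q k k) = 0" using mpoly.scale_left_distrib[of 1 1 "q k k"] by simp
  then have kk: "q k k = 0" by simp
  consider "k = m" | "k < m" | "m < k" by fastforce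
  then show ?thesis
  proof cases
    case 1
    then show ?thesis using kk by (simp add: contract_def)
  next
    case 2
    have "{i \<in> {m}. i < k} = {}" using 2 by auto
    then have "sgn_at k {m} = 1" unfolding sgn_at_def by (simp only: card.empty power_0)
    then show ?thesis using 2 by (simp add: contract_def chain2_def)
  next
    case 3
    have "{i \<in> {m}. i < k} = {m}" using 3 by auto
    then have "sgn_at k {m} = - 1" unfolding sgn_at_def by simp
    then show ?thesis using 3 assms[of k m] by (simp add: contract_def chain2_def)
  qed
qed

lemma linear_strandI:
  assumes "\<And>T. y T \<in> forms 2" "\<And>T. card T \<noteq> p \<Longrightarrow> y T = 0" "\<And>T. y T \<in> I" "koszul y = 0"
  shows "y \<in> linear_strand p I"
  using assms unfolding linear_strand_def mem_Collect_eq kchains_quadratic_iff by blast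

lemma linear_strandD:
  assumes "y \<in> linear_strand p I"
  shows "y T \<in> forms 2" "card T \<noteq> p \<Longrightarrow> y T = 0" "y T \<in> I" "koszul y = 0" "y \<in> kchains p (p + 2)"
  using assms unfolding linear_strand_def mem_Collect_eq kchains_quadratic_iff by blast+

lemma chain0_strand:
  assumes "q \<in> forms 2" "q \<in> I" "0 \<in> I"
  shows "chain0 q \<in> linear_strand 0 I"
proof (rule linear_strandI)
  show "koszul (chain0 q) = 0"
  proof -
    have "contract k (chain0 q) T = 0" for k T by (auto simp: contract_def chain0_def)
    then show ?thesis by (auto simp: koszul_def fun_eq_iff)
  qed
qed (use assms in \<open>auto simp: chain0_def forms_0\<close>)

lemma chain1_strand:
  assumes q: "\<And>m. q m \<in> forms 2" "\<And>m. q m \<in> I" "0 \<in> I" and rel: "(\<Sum>m\<in>UNIV. X m * q m) = 0"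
  shows "chain1 q \<in> linear_strand 1 I"
proof (rule linear_strandI)
  have "chain1 q \<in> kchains 1 (1 + 2)"
    unfolding kchains_quadratic_iff chain1_def using q(1) forms_0 by auto
  then show "koszul (chain1 q) = 0" by (subst koszul_kchains_1) (simp_all add: rel)
qed (use q in \<open>auto simp: chain1_def forms_0\<close>)

lemma chain2_strand:
  assumes q: "\<And>k m. q k m \<in> forms 2" "\<And>k m. q k m \<in> I" "0 \<in> I"
    and anti: "\<And>k m. q k m = - q m k" and rel: "\<And>k. (\<Sum>m\<in>UNIV. X m * q k m) = 0"
  shows "chain2 q \<in> linear_strand 2 I"
proof (rule linear_strandI)
  have "chain2 q \<in> kchains 2 (2 + 2)"
    unfolding kchains_quadratic_iff chain2_def using q(1) forms_0 by auto
  then show "koszul (chain2 q) = 0"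
    by (subst koszul_kchains_2) (simp_all only: contract_chain2[of q, OF anti] rel simp_thms)
qed (use q in \<open>auto simp: chain2_def forms_0\<close>)

lemma strand_0_eqI:
  assumes "y \<in> linear_strand 0 I" "y {} = 0"
  shows "y = 0"
proof
  fix T show "y T = 0 T"
    using assms linear_strandD(2)[OF assms(1), of T] by (cases "T = {}") simp_all
qed

lemma strand_1_eqI:
  assumes "y \<in> linear_strand 1 I" "\<And>m. y {m} = 0"
  shows "y = 0"
proof
  fix T show "y T = 0 T"
  proof (cases "card T = 1")
    case True
    then obtain m where "T = {m}" by (auto simp: card_1_singleton_iff One_nat_def)
    then show ?thesis using assms(2) by simp
  next
    case False
    then show ?thesis using linear_strandD(2)[OF assms(1)] by simp
  qed
qed

lemma strand_2_eqI:
  assumes "y \<in> linear_strand 2 I" "\<And>k m. contract k y {m} = 0"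
  shows "y = 0"
proof
  fix T show "y T = 0 T"
  proof (cases "card T = 2")
    case True
    then obtain k m where T: "T = {k, m}" "k \<noteq> m" by (auto simp: card_2_iff)
    have "sgn_at k {m} * (sgn_at k {m} * y T) = y T"
      by (simp add: sgn_at_def flip: mult.assoc power_add)
    moreover have "sgn_at k {m} * y T = 0" using assms(2)[of k m] T by (simp add: contract_def)
    ultimately show ?thesis by simp
  next
    case False
    then show ?thesis using linear_strandD(2)[OF assms(1)] by simp
  qed
qed

lemma betti_forms_iff:
  "F \<in> betti_forms b12 b23 b34 \<longleftrightarrow> F \<in> forms 4 \<and> nondegenerate F \<and>
    chain.dim (linear_strand 0 (apolar F)) = b12 \<and>
    chain.dim (linear_strand 1 (apolar F)) = b23 \<and>
    chain.dim (linear_strand 2 (apolar F)) = b34"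
proof -
  have "tor_dim 1 2 (apolar F) = chain.dim (linear_strand 0 (apolar F))"
    "tor_dim 2 3 (apolar F) = chain.dim (linear_strand 1 (apolar F))"
    "tor_dim 3 4 (apolar F) = chain.dim (linear_strand 2 (apolar F))" if "nondegenerate F"
    using that tor_dim_linear_strand[OF apolar_subspace, of F 0]
      tor_dim_linear_strand[OF apolar_subspace, of F 1] tor_dim_linear_strand[OF apolar_subspace, of F 2]
    by (simp_all add: nondegenerate_def eval_nat_numeral One_nat_def)
  then show ?thesis by (auto simp: betti_forms_def)
qed

lemma zero_apolar: "0 \<in> apolar F"
  by (simp add: apolar_def diff_action_0)

text \<open>
  For this and the next two degrees of the strand, a pivot set \<open>J\<close> of tensor entries determines the
  dimension.
\<close>

lemma dim_strand_0:
  assumes F: "F \<in> forms 4" and J: "finite J"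
    and sep: "\<And>g. apolar_matrix F g \<Longrightarrow> \<forall>(i, j)\<in>J. g i j = 0 \<Longrightarrow> g = 0"
    and e: "\<forall>x\<in>J. apolar_matrix F (e x)"
    and dual: "\<forall>x\<in>J. \<forall>(i, j)\<in>J. e x i j = (if x = (i, j) then 1 else 0)"
  shows "chain.dim (linear_strand 0 (apolar F)) = card J"
proof (rule chain.dim_eq_card_dual_functionals[where f = "\<lambda>(i, j) y. hess (y {}) i j"
      and b = "\<lambda>x. chain0 (quad (e x))", OF linear_strand_subspace[OF apolar_subspace] J])
  show "\<forall>x\<in>J. Vector_Spaces.linear chain_scal (*) (case x of (i, j) \<Rightarrow> \<lambda>y. hess (y {}) i j)"
    by (auto simp: hess_functional)
  show "\<forall>y\<in>linear_strand 0 (apolar F).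
      (\<forall>x\<in>J. (case x of (i, j) \<Rightarrow> \<lambda>y. hess (y {}) i j) y = 0) \<longrightarrow> y = 0"
  proof (intro ballI impI)
    fix y assume y: "y \<in> linear_strand 0 (apolar F)"
      and 0: "\<forall>x\<in>J. (case x of (i, j) \<Rightarrow> \<lambda>y. hess (y {}) i j) y = 0"
    have "hess (y {}) = 0"
      using 0 y by (intro sep) (auto simp: apolar_matrix_hess[OF F] linear_strandD)
    then have "y {} = 0" using form_2_eq_0[OF linear_strandD(1)[OF y]] by simp
    then show "y = 0" by (rule strand_0_eqI[OF y])
  qed
  show "\<forall>x\<in>J. chain0 (quad (e x)) \<in> linear_strand 0 (apolar F)"
    using e by (auto intro!: chain0_strand quad_forms quad_apolar[OF F] zero_apolar)
  show "\<forall>x\<in>J. \<forall>z\<in>J. (case z of (i, j) \<Rightarrow> \<lambda>y. hess (y {}) i j) (chain0 (quad (e x))) = (if x = z then 1 else 0)"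
    using e dual by (auto simp: chain0_def hess_quad_apolar[of F] split: prod.splits)
qed

lemma dim_strand_1:
  assumes F: "F \<in> forms 4" and J: "finite J"
    and sep: "\<And>s. first_syzygy F s \<Longrightarrow> \<forall>(m, i, j)\<in>J. s m i j = 0 \<Longrightarrow> s = 0"
    and e: "\<forall>x\<in>J. first_syzygy F (e x)"
    and dual: "\<forall>x\<in>J. \<forall>(m, i, j)\<in>J. e x m i j = (if x = (m, i, j) then 1 else 0)"
  shows "chain.dim (linear_strand 1 (apolar F)) = card J"
proof (rule chain.dim_eq_card_dual_functionals[where f = "\<lambda>(m, i, j) y. hess (y {m}) i j"
      and b = "\<lambda>x. chain1 (\<lambda>m. quad (e x m))", OF linear_strand_subspace[OF apolar_subspace] J])
  have hq: "hess (quad (e x m)) = e x m" if "x \<in> J" for x m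
    using e that by (auto simp: first_syzygy_def hess_quad_apolar[of F])
  show "\<forall>x\<in>J. Vector_Spaces.linear chain_scal (*) (case x of (m, i, j) \<Rightarrow> \<lambda>y. hess (y {m}) i j)"
    by (auto simp: hess_functional)
  show "\<forall>y\<in>linear_strand 1 (apolar F).
      (\<forall>x\<in>J. (case x of (m, i, j) \<Rightarrow> \<lambda>y. hess (y {m}) i j) y = 0) \<longrightarrow> y = 0"
  proof (intro ballI impI)
    fix y assume y: "y \<in> linear_strand 1 (apolar F)"
      and 0: "\<forall>x\<in>J. (case x of (m, i, j) \<Rightarrow> \<lambda>y. hess (y {m}) i j) y = 0"
    have "first_syzygy F (\<lambda>m. hess (y {m}))"
      using linear_strandD[OF y] koszul_kchains_1[of y] by (subst first_syzygy_iff[OF F]) auto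
    then have "(\<lambda>m. hess (y {m})) = 0" by (rule sep) (use 0 in auto)
    then have "hess (y {m}) i j = 0" for m i j by (simp add: fun_eq_iff)
    then have "y {m} = 0" for m using form_2_eq_0[OF linear_strandD(1)[OF y]] by blast
    then show "y = 0" by (rule strand_1_eqI[OF y])
  qed
  show "\<forall>x\<in>J. chain1 (\<lambda>m. quad (e x m)) \<in> linear_strand 1 (apolar F)"
  proof
    fix x assume x: "x \<in> J"
    have "first_syzygy F (\<lambda>m. hess (quad (e x m)))" using e x by (simp add: hq)
    then show "chain1 (\<lambda>m. quad (e x m)) \<in> linear_strand 1 (apolar F)"
      using first_syzygy_iff[OF F, of "\<lambda>m. quad (e x m)"]
      by (intro chain1_strand zero_apolar) (auto simp: quad_forms)
  qed
  show "\<forall>x\<in>J. \<forall>z\<in>J. (case z of (m, i, j) \<Rightarrow> \<lambda>y. hess (y {m}) i j) (chain1 (\<lambda>m. quad (e x m))) = (if x = z then 1 else 0)"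
    using dual by (auto simp: hq split: prod.splits)
qed

lemma contract_singleton:
  "contract k y {m} = (if k = m then 0 else if m < k then - y {k, m} else y {k, m})"
proof -
  have "{i \<in> {m}. i < k} = (if m < k then {m} else {})" by auto
  then have "sgn_at k {m} = (if m < k then - 1 else 1)" unfolding sgn_at_def by simp
  then show ?thesis by (simp add: contract_def)
qed

lemma hess_contract_functional: "Vector_Spaces.linear chain_scal (*) (\<lambda>y. hess (contract k y {m}) i j)"
  by (simp add: contract_singleton Vector_Spaces.linear_iff chain.vector_space_axioms
      complex_vector_space hess_simps chain_scal_apply)

lemma contract_strand_2:
  assumes "y \<in> linear_strand 2 (apolar F)"
  shows "contract k y {m} \<in> forms 2" "contract k y {m} \<in> apolar F"
  using linear_strandD(1,3)[OF assms] mpoly.subspace_neg[OF apolar_subspace]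
  by (simp_all add: contract_singleton forms_0 forms_uminus zero_apolar)

lemma second_syzygy_strand:
  assumes F: "F \<in> forms 4" and y: "y \<in> linear_strand 2 (apolar F)"
  shows "second_syzygy F (\<lambda>k m. hess (contract k y {m}))"
proof -
  have r: "(\<Sum>m\<in>UNIV. X m * contract k y {m}) = 0" for k
    using koszul_kchains_2[of y] linear_strandD(4,5)[OF y] by blast
  have "first_syzygy F (\<lambda>m. hess (contract k y {m}))" for k
    using first_syzygy_iff[OF F, of "\<lambda>m. contract k y {m}"] contract_strand_2[OF y] r by blast
  moreover have "hess (contract k y {m}) i j = - hess (contract m y {k}) i j" for k m i j
    using contract_antisym[of k y m] by (simp add: hess_simps)
  ultimately show ?thesis unfolding second_syzygy_def by blast
qed

lemma second_syzygy_quad: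
  assumes F: "F \<in> forms 4" and t: "second_syzygy F t"
  shows "hess (quad (t k m)) = t k m"
    and "contract k (chain2 (\<lambda>k m. quad (t k m))) {m} = quad (t k m)"
    and "chain2 (\<lambda>k m. quad (t k m)) \<in> linear_strand 2 (apolar F)"
proof -
  have t1: "first_syzygy F (t k)" and t2: "t k m i j = - t m k i j" for k m i j
    using t unfolding second_syzygy_def by blast+
  show hq: "hess (quad (t k m)) = t k m" for k m
    using t1[of k] hess_quad_apolar[of F "t k m"] unfolding first_syzygy_def by blast
  have anti: "quad (t k m) = - quad (t m k)" for k m
  proof (rule form_2_eqI)
    show "hess (quad (t k m)) i j = hess (- quad (t m k)) i j" for i j
      unfolding hess_simps hq by (rule t2)
  qed (simp_all add: quad_forms forms_uminus)
  show "contract k (chain2 (\<lambda>k m. quad (t k m))) {m} = quad (t k m)"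
    by (rule contract_chain2) (rule anti)
  have "first_syzygy F (\<lambda>m. hess (quad (t k m)))" for k
    unfolding hq by (rule t1)
  then have "\<forall>m. quad (t k m) \<in> apolar F" "(\<Sum>m\<in>UNIV. X m * quad (t k m)) = 0" for k
    using first_syzygy_iff[OF F, of "\<lambda>m. quad (t k m)"] by (auto simp: quad_forms)
  then show "chain2 (\<lambda>k m. quad (t k m)) \<in> linear_strand 2 (apolar F)"
    by (intro chain2_strand zero_apolar quad_forms anti) auto
qed

lemma dim_strand_2:
  assumes F: "F \<in> forms 4" and J: "finite J"
    and sep: "\<And>t. second_syzygy F t \<Longrightarrow> \<forall>(k, m, i, j)\<in>J. t k m i j = 0 \<Longrightarrow> t = 0"
    and e: "\<forall>x\<in>J. second_syzygy F (e x)"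
    and dual: "\<forall>x\<in>J. \<forall>(k, m, i, j)\<in>J. e x k m i j = (if x = (k, m, i, j) then 1 else 0)"
  shows "chain.dim (linear_strand 2 (apolar F)) = card J"
proof (rule chain.dim_eq_card_dual_functionals[where f = "\<lambda>(k, m, i, j) y. hess (contract k y {m}) i j"
      and b = "\<lambda>x. chain2 (\<lambda>k m. quad (e x k m))", OF linear_strand_subspace[OF apolar_subspace] J])
  show "\<forall>x\<in>J. Vector_Spaces.linear chain_scal (*) (case x of (k, m, i, j) \<Rightarrow> \<lambda>y. hess (contract k y {m}) i j)"
    by (auto simp: hess_contract_functional)
  show "\<forall>y\<in>linear_strand 2 (apolar F).
      (\<forall>x\<in>J. (case x of (k, m, i, j) \<Rightarrow> \<lambda>y. hess (contract k y {m}) i j) y = 0) \<longrightarrow> y = 0"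
  proof (intro ballI impI)
    fix y assume y: "y \<in> linear_strand 2 (apolar F)"
      and 0: "\<forall>x\<in>J. (case x of (k, m, i, j) \<Rightarrow> \<lambda>y. hess (contract k y {m}) i j) y = 0"
    have "(\<lambda>k m. hess (contract k y {m})) = 0"
      by (rule sep[OF second_syzygy_strand[OF F y]]) (use 0 in auto)
    then have "hess (contract k y {m}) i j = 0" for k m i j by (simp add: fun_eq_iff)
    then have "contract k y {m} = 0" for k m using form_2_eq_0[OF contract_strand_2(1)[OF y]] by blast
    then show "y = 0" by (rule strand_2_eqI[OF y])
  qed
  show "\<forall>x\<in>J. chain2 (\<lambda>k m. quad (e x k m)) \<in> linear_strand 2 (apolar F)"
    using e second_syzygy_quad(3)[OF F] by blast
  show "\<forall>x\<in>J. \<forall>z\<in>J. (case z of (k, m, i, j) \<Rightarrow> \<lambda>y. hess (contract k y {m}) i j)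
      (chain2 (\<lambda>k m. quad (e x k m))) = (if x = z then 1 else 0)"
    using dual e second_syzygy_quad(1,2)[OF F] by (auto split: prod.splits)
qed

section \<open>Quartics that are sums of products of squares\<close>

text \<open>
  The factor \<open>1/8\<close> makes the fourth derivatives of \<open>even_quartic w\<close> equal to entries of \<open>w\<close>, up to
  a factor \<open>3\<close> on the diagonal.
\<close>

definition even_quartic :: "(4 \<Rightarrow> 4 \<Rightarrow> complex) \<Rightarrow> 4 mpoly"
  where "even_quartic w = (\<Sum>a\<in>UNIV. \<Sum>b\<in>UNIV. scal (w a b / 8) (X a * (X a * (X b * X b))))"

lemma even_quartic_forms: "even_quartic w \<in> forms 4"
proof -
  have "X a * (X a * (X b * X b)) \<in> forms 4" for a b :: 4
    using forms_mult[OF XX_forms[of a a] XX_forms[of b b]] by (simp add: mult.assoc)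
  then show ?thesis unfolding even_quartic_def by (intro forms_sum forms_scal)
qed

definition kron :: "4 \<Rightarrow> 4 \<Rightarrow> complex"
  where "kron i j = (if i = j then 1 else 0)"

lemma kron_mult: "kron i j * x = (if i = j then x else 0)"
  by (simp add: kron_def)

lemma sum_kron1: "(\<Sum>a\<in>UNIV. kron i a * f a) = f i"
  by (simp add: kron_mult)

lemma sum_kron: "(\<Sum>a\<in>UNIV. \<Sum>b\<in>UNIV. kron i a * (kron j b * f a b)) = f i j"
  by (simp add: sum_kron1 flip: sum_distrib_left)

lemma hess_even_monomial:
  "hess (pdiff i (pdiff j (X a * (X a * (X b * X b))))) k l =
    4 * kron j a * kron i a * kron k b * kron l b + 4 * kron j b * kron i b * kron k a * kron l a
    + 4 * (kron j a * kron i b + kron j b * kron i a) * (kron k a * kron l b + kron k b * kron l a)"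
proof -
  have 1: "pdiff i (X k * f) = X k * pdiff i f + scal (kron i k) f" for i k and f :: "4 mpoly"
    by (simp add: pdiff_X_mult kron_def)
  have 2: "pdiff i (X k) = scal (kron i k) (1 :: 4 mpoly)" for i k
    by (simp add: pdiff_X kron_def)
  have 3: "hess (X a * X b) i j = kron i a * kron j b + kron j a * kron i b" for a b i j
    unfolding hess_linear_mult[OF X_forms X_forms] grad_X kron_def by (rule refl)
  have 4: "pdiff i (X x * (X y * X z)) =
      scal (kron i z) (X x * X y) + scal (kron i y) (X x * X z) + scal (kron i x) (X y * X z)" for i x y z
    by (simp only: 1 2 scal_mult_right distrib_left mult_1_right)
  have 5: "pdiff i (X w * (X x * (X y * X z))) = scal (kron i z) (X w * (X x * X y))
      + scal (kron i y) (X w * (X x * X z)) + scal (kron i x) (X w * (X y * X z))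
      + scal (kron i w) (X x * (X y * X z))" for i w x y z
    by (simp only: 1[of i w] 4 scal_mult_right distrib_left)
  show ?thesis
    by (simp only: 5 pdiff_add pdiff_scal 4 hess_simps 3) (simp add: algebra_simps)
qed

lemma hess_even_quartic:
  assumes w: "\<And>a b. w a b = w b a"
  shows "hess (pdiff i (pdiff j (even_quartic w))) k l =
    kron i j * kron k l * w i k + (kron k i * kron l j + kron l i * kron k j) * w i j"
proof -
  have "hess (pdiff i (pdiff j (even_quartic w))) k l =
     (\<Sum>a\<in>UNIV. \<Sum>b\<in>UNIV. kron i a * (kron k b * (kron j a * kron l b * w a b / 2)))
   + (\<Sum>a\<in>UNIV. \<Sum>b\<in>UNIV. kron k a * (kron i b * (kron j b * kron l a * w a b / 2)))
   + (\<Sum>a\<in>UNIV. \<Sum>b\<in>UNIV. kron j a * (kron i b * ((kron k a * kron l b + kron k b * kron l a) * w a b / 2)))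
   + (\<Sum>a\<in>UNIV. \<Sum>b\<in>UNIV. kron i a * (kron j b * ((kron k a * kron l b + kron k b * kron l a) * w a b / 2)))"
    unfolding even_quartic_def pdiff_sum pdiff_scal hess_simps hess_even_monomial sum.distrib[symmetric]
    by (intro sum.cong refl) (simp add: algebra_simps add_divide_distrib)
  also have "\<dots> = kron i j * kron k l * w i k + (kron k i * kron l j + kron l i * kron k j) * w i j"
    unfolding sum_kron using w by (auto simp: field_simps kron_def)
  finally show ?thesis .
qed

text \<open>
  A product of two different variables is apolar to all monomials but its own, and the squares
  interact only among themselves.
\<close>

lemma apolar_matrix_even_quartic:
  assumes w: "\<And>a b. w a b = w b a"
  shows "apolar_matrix (even_quartic w) g \<longleftrightarrow> (\<forall>i j. g i j = g j i) \<and>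
    (\<forall>k l. k \<noteq> l \<longrightarrow> w k l * g k l = 0) \<and> (\<forall>k. (\<Sum>i\<in>UNIV. w k i * g i i) + 2 * w k k * g k k = 0)"
proof (cases "\<forall>i j. g i j = g j i")
  case True
  have "(\<Sum>i\<in>UNIV. \<Sum>j\<in>UNIV. g i j * hess (pdiff i (pdiff j (even_quartic w))) k l) =
     kron k l * (\<Sum>i\<in>UNIV. w k i * g i i) + 2 * w k l * g k l" for k l
  proof -
    have "(\<Sum>i\<in>UNIV. \<Sum>j\<in>UNIV. g i j * hess (pdiff i (pdiff j (even_quartic w))) k l) =
      (\<Sum>i\<in>UNIV. \<Sum>j\<in>UNIV. kron i j * (kron k l * (w k i * g i j)))
      + (\<Sum>i\<in>UNIV. \<Sum>j\<in>UNIV. kron k i * (kron l j * (w i j * g i j)))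
      + (\<Sum>i\<in>UNIV. \<Sum>j\<in>UNIV. kron l i * (kron k j * (w i j * g i j)))"
      unfolding hess_even_quartic[OF w] sum.distrib[symmetric]
      by (intro sum.cong refl) (simp add: algebra_simps w[of _ k])
    also have "\<dots> = kron k l * (\<Sum>i\<in>UNIV. w k i * g i i) + 2 * w k l * g k l"
      unfolding sum_kron sum_kron1 using True w by (simp flip: sum_distrib_left)
    finally show ?thesis .
  qed
  with True show ?thesis
    unfolding apolar_matrix_def by (auto simp: kron_def mult.assoc)
qed (auto simp: apolar_matrix_def)

lemma even_quartic_nondegenerate:
  assumes w: "\<And>a b. w a b = w b a" and nz: "\<And>i. \<exists>l. w i l \<noteq> 0"
  shows "nondegenerate (even_quartic w)"
proof (rule nondegenerateI[OF even_quartic_forms])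
  fix c assume 0: "\<And>j k l. (\<Sum>i\<in>UNIV. c i * hess (pdiff l (pdiff i (even_quartic w))) j k) = 0"
  show "\<forall>i. c i = 0"
  proof
    fix i
    obtain l where l: "w i l \<noteq> 0" using nz by blast
    have "(\<Sum>a\<in>UNIV. c a * hess (pdiff l (pdiff a (even_quartic w))) l i) = 
      (\<Sum>a\<in>UNIV. kron i a * (c a * w l a * (if i = l then 3 else 1)))"
      unfolding hess_even_quartic[OF w] by (intro sum.cong refl) (auto simp: kron_def w)
    also have "\<dots> = c i * w l i * (if i = l then 3 else 1)" by (rule sum_kron1)
    finally have "c i * w l i * (if i = l then 3 else 1) = 0" using 0[of l l i] by simp
    moreover have "w l i \<noteq> 0" using l w[of i l] by simp
    ultimately show "c i = 0" by (simp split: if_splits)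
  qed
qed

section \<open>The four test quartics\<close>

text \<open>
  An edge \<open>{a, b}\<close> contributes a multiple of \<open>y\<^sub>a\<^sup>2 y\<^sub>b\<^sup>2\<close>, a loop a multiple of \<open>y\<^sub>a\<^sup>4\<close>.
\<close>

definition graph_quartic :: "(4 \<times> 4) set \<Rightarrow> 4 mpoly"
  where "graph_quartic E = even_quartic (\<lambda>a b. if (a, b) \<in> E \<or> (b, a) \<in> E then 1 else 0)"

lemma graph_quartic_forms: "graph_quartic E \<in> forms 4"
  by (simp add: graph_quartic_def even_quartic_forms)

lemma graph_quartic_nondegenerate:
  assumes "\<forall>i. \<exists>l. (i, l) \<in> E \<or> (l, i) \<in> E"
  shows "nondegenerate (graph_quartic E)"
  unfolding graph_quartic_def by (rule even_quartic_nondegenerate) (use assms in auto)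

lemma apolar_matrix_graph_quartic:
  fixes w :: "4 \<Rightarrow> 4 \<Rightarrow> complex" and E :: "(4 \<times> 4) set"
  defines "w \<equiv> \<lambda>a b. if (a, b) \<in> E \<or> (b, a) \<in> E then 1 else 0"
  shows "apolar_matrix (graph_quartic E) g \<longleftrightarrow> (\<forall>i j. g i j = g j i) \<and>
    (\<forall>k l. k \<noteq> l \<longrightarrow> w k l * g k l = 0) \<and> (\<forall>k. (\<Sum>i\<in>UNIV. w k i * g i i) + 2 * w k k * g k k = 0)"
  unfolding graph_quartic_def w_def by (rule apolar_matrix_even_quartic) auto

text \<open>
  The names tell the zero sets of the apolar quadrics: the ideals are
  \<open>(x\<^sub>0, x\<^sub>1) \<inter> (x\<^sub>2, x\<^sub>3)\<close>, \<open>x\<^sub>0 (x\<^sub>1, x\<^sub>2, x\<^sub>3)\<close>, \<open>x\<^sub>0 (x\<^sub>1, x\<^sub>2)\<close>, and in the last case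
  \<open>(x\<^sub>1\<^sup>2 - x\<^sub>2\<^sup>2, x\<^sub>1\<^sup>2 - x\<^sub>3\<^sup>2, x\<^sub>1 x\<^sub>2, x\<^sub>1 x\<^sub>3, x\<^sub>2 x\<^sub>3)\<close>, a scheme of length five supported at one point,
  which stands in for five general points.
\<close>

abbreviation two_lines_quartic :: "4 mpoly"
  where "two_lines_quartic \<equiv> graph_quartic {(0, 1), (2, 3)}"

abbreviation plane_point_quartic :: "4 mpoly"
  where "plane_point_quartic \<equiv> graph_quartic {(0, 0), (1, 2), (1, 3), (2, 3)}"

abbreviation plane_line_quartic :: "4 mpoly"
  where "plane_line_quartic \<equiv> graph_quartic {(0, 3), (1, 2), (1, 3), (2, 3)}"

abbreviation five_points_quartic :: "4 mpoly"
  where "five_points_quartic \<equiv> graph_quartic {(0, 1), (0, 2), (0, 3)}"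

lemma apolar_two_lines:
  "apolar_matrix two_lines_quartic g \<longleftrightarrow> (\<forall>i j. g i j = g j i) \<and> (\<forall>i. g i i = 0) \<and> g 0 1 = 0 \<and> g 2 3 = 0"
  unfolding apolar_matrix_graph_quartic by (auto simp: forall_4 sum_4)

lemma apolar_plane_point:
  "apolar_matrix plane_point_quartic g \<longleftrightarrow> (\<forall>i j. g i j = g j i) \<and> (\<forall>i. g i i = 0) \<and>
    g 1 2 = 0 \<and> g 1 3 = 0 \<and> g 2 3 = 0"
proof -
  have *: "a = 0 \<and> b = 0 \<and> c = 0" if "b + c = 0" "a + c = 0" "a + b = 0" for a b c :: complex
  proof -
    have "2 * a = (a + c) + (a + b) - (b + c)" by (simp add: algebra_simps)
    then have "a = 0" using that by simp
    then show ?thesis using that by simp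
  qed
  have "(\<forall>k. (\<Sum>i\<in>UNIV. W k i * g i i) + 2 * W k k * g k k = 0) \<longleftrightarrow> (\<forall>i. g i i = 0)"
    if W: "W = (\<lambda>a b. if (a, b) \<in> {(0, 0), (1, 2), (1, 3), (2, 3)} \<or>
      (b, a) \<in> {(0, 0), (1, 2), (1, 3), (2, 3)} then 1 else 0)"
    for W :: "4 \<Rightarrow> 4 \<Rightarrow> complex"
  proof
    assume "\<forall>k. (\<Sum>i\<in>UNIV. W k i * g i i) + 2 * W k k * g k k = 0"
    then have "(\<Sum>i\<in>UNIV. W k i * g i i) + 2 * W k k * g k k = 0" for k by blast
    from this[of 0] this[of 1] this[of 2] this[of 3]
    have "3 * g 0 0 = 0" "g 2 2 + g 3 3 = 0" "g 1 1 + g 3 3 = 0" "g 1 1 + g 2 2 = 0"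
      by (simp_all add: W sum_4)
    then show "\<forall>i. g i i = 0" unfolding forall_4 using *[of "g 2 2" "g 3 3" "g 1 1"] by simp
  next
    assume "\<forall>i. g i i = 0"
    then show "\<forall>k. (\<Sum>i\<in>UNIV. W k i * g i i) + 2 * W k k * g k k = 0" by simp
  qed
  note W = this[OF refl]
  show ?thesis
    unfolding apolar_matrix_graph_quartic W by (auto simp: forall_4)
qed

lemma apolar_plane_line:
  "apolar_matrix plane_line_quartic g \<longleftrightarrow> (\<forall>i j. g i j = g j i) \<and> (\<forall>i. g i i = 0) \<and>
    g 0 3 = 0 \<and> g 1 2 = 0 \<and> g 1 3 = 0 \<and> g 2 3 = 0"
  unfolding apolar_matrix_graph_quartic by (auto simp: forall_4 sum_4)

lemma apolar_five_points:
  "apolar_matrix five_points_quartic g \<longleftrightarrow> (\<forall>i j. g i j = g j i) \<and>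
    g 0 0 = 0 \<and> g 0 1 = 0 \<and> g 0 2 = 0 \<and> g 0 3 = 0 \<and> g 1 1 + g 2 2 + g 3 3 = 0"
  unfolding apolar_matrix_graph_quartic by (auto simp: forall_4 sum_4)

lemma graph_nondegenerate:
  "nondegenerate two_lines_quartic" "nondegenerate plane_point_quartic"
  "nondegenerate plane_line_quartic" "nondegenerate five_points_quartic"
  by (rule graph_quartic_nondegenerate, unfold forall_4, auto)+

text \<open>
  The Hessian of \<open>x\<^sub>b x\<^sub>c\<close>.
\<close>

definition monomial_hessian :: "4 \<Rightarrow> 4 \<Rightarrow> 4 \<Rightarrow> 4 \<Rightarrow> complex"
  where "monomial_hessian b c i j = kron i b * kron j c + kron i c * kron j b"

text \<open>
  The relation \<open>x\<^sub>a (x\<^sub>b x\<^sub>c) - x\<^sub>b (x\<^sub>a x\<^sub>c) = 0\<close>.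
\<close>

definition koszul_syzygy :: "4 \<Rightarrow> 4 \<Rightarrow> 4 \<Rightarrow> 4 \<Rightarrow> 4 \<Rightarrow> 4 \<Rightarrow> complex"
  where "koszul_syzygy a b c m i j = kron m a * monomial_hessian b c i j - kron m b * monomial_hessian a c i j"

text \<open>
  The element \<open>x\<^sub>c x\<^sub>d e\<^sub>a \<and> e\<^sub>b\<close>.
\<close>

definition wedge_quadric :: "4 \<Rightarrow> 4 \<Rightarrow> 4 \<Rightarrow> 4 \<Rightarrow> 4 \<Rightarrow> 4 \<Rightarrow> 4 \<Rightarrow> 4 \<Rightarrow> complex"
  where "wedge_quadric a b c d k m i j = (kron k a * kron m b - kron k b * kron m a) * monomial_hessian c d i j"

lemma first_syzygyD:
  assumes "first_syzygy F s"
  shows "apolar_matrix F (s m)" "s m i j = s m j i" "s m i j + s i m j + s j m i = 0"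
  using assms unfolding first_syzygy_def apolar_matrix_def by blast+

text \<open>
  If no apolar quadric contains a square, the relation in the monomial \<open>x\<^sub>m\<^sup>2 x\<^sub>j\<close> leaves only its term
  with \<open>x\<^sub>m x\<^sub>j\<close>.
\<close>

lemma first_syzygy_diag:
  assumes "first_syzygy F s" "\<And>g i. apolar_matrix F g \<Longrightarrow> g i i = 0"
  shows "s m i i = 0" "s m m j = 0" "s m j m = 0"
proof -
  show 0: "s m i i = 0" for m i by (rule assms(2)[OF first_syzygyD(1)[OF assms(1)]])
  have "2 * s m m j = 0" using first_syzygyD(3)[OF assms(1), of m m j] 0 by simp
  then show "s m m j = 0" by simp
  then show "s m j m = 0" using first_syzygyD(2)[OF assms(1)] by metis
qed

lemma apolar_diag:
  "apolar_matrix two_lines_quartic g \<Longrightarrow> g i i = 0"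
  "apolar_matrix plane_point_quartic g \<Longrightarrow> g i i = 0"
  "apolar_matrix plane_line_quartic g \<Longrightarrow> g i i = 0"
  unfolding apolar_two_lines apolar_plane_point apolar_plane_line by blast+

lemma tensor2_eq_0:
  fixes g :: "4 \<Rightarrow> 4 \<Rightarrow> complex"
  assumes sym: "\<And>i j. g i j = g j i" and "\<And>i. g i i = 0"
    and "g 0 1 = 0" "g 0 2 = 0" "g 0 3 = 0" "g 1 2 = 0" "g 1 3 = 0" "g 2 3 = 0"
  shows "g = 0"
proof -
  have s: "g 1 0 = g 0 1" "g 2 0 = g 0 2" "g 3 0 = g 0 3" "g 2 1 = g 1 2" "g 3 1 = g 1 3" "g 3 2 = g 2 3"
    by (rule sym)+
  have "\<forall>i j. g i j = 0"
    unfolding forall_4 by (simp add: s assms(2-))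
  then show ?thesis by (simp add: fun_eq_iff)
qed

lemma tensor3_eq_0:
  fixes s :: "4 \<Rightarrow> 4 \<Rightarrow> 4 \<Rightarrow> complex"
  assumes sym: "\<And>m i j. s m i j = s m j i"
    and diag: "\<And>m i. s m i i = 0" "\<And>m j. s m m j = 0"
    and "s 0 1 2 = 0" "s 0 1 3 = 0" "s 0 2 3 = 0" "s 1 0 2 = 0" "s 1 0 3 = 0" "s 1 2 3 = 0"
      "s 2 0 1 = 0" "s 2 0 3 = 0" "s 2 1 3 = 0" "s 3 0 1 = 0" "s 3 0 2 = 0" "s 3 1 2 = 0"
  shows "s = 0"
proof -
  have s: "s m 1 0 = s m 0 1" "s m 2 0 = s m 0 2" "s m 3 0 = s m 0 3" "s m 2 1 = s m 1 2"
    "s m 3 1 = s m 1 3" "s m 3 2 = s m 2 3" for m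
    by (rule sym)+
  have d: "s m j m = 0" for m j using diag(2) sym by metis
  have "\<forall>m i j. s m i j = 0"
    unfolding forall_4 by (simp add: s diag d assms(4-))
  then show ?thesis by (simp add: fun_eq_iff)
qed

text \<open>
  When no apolar quadric contains a square, an entry can only be non-zero if its four indices are
  distinct, and antisymmetry leaves six of these.
\<close>

lemma tensor4_eq_0:
  fixes t :: "4 \<Rightarrow> 4 \<Rightarrow> 4 \<Rightarrow> 4 \<Rightarrow> complex"
  assumes t: "second_syzygy F t" and F: "\<And>g i. apolar_matrix F g \<Longrightarrow> g i i = 0"
    and z: "t 0 1 2 3 = 0" "t 0 2 1 3 = 0" "t 0 3 1 2 = 0" "t 1 2 0 3 = 0" "t 1 3 0 2 = 0" "t 2 3 0 1 = 0"
  shows "t = 0"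
proof -
  have f: "first_syzygy F (t k)" and anti: "t k m i j = - t m k i j" for k m i j
    using t unfolding second_syzygy_def by blast+
  have dg: "t k m i i = 0" "t k m m j = 0" "t k m j m = 0" for k m i j
    by (rule first_syzygy_diag[OF f], rule F, assumption)+
  have kk: "t k k i j = 0" for k i j using anti[of k k i j] by simp
  have kmk: "t k m k j = 0" "t k m j k = 0" for k m j
    using anti[of k m k j] anti[of k m j k] dg by simp_all
  have "t k = 0" for k
  proof (rule tensor3_eq_0)
    show "t k m i j = t k m j i" for m i j by (rule first_syzygyD(2)[OF f])
    show "t k m i i = 0" "t k m m j = 0" for m i j by (rule dg)+
    have a: "t 1 0 2 3 = 0" "t 2 0 1 3 = 0" "t 3 0 1 2 = 0" "t 2 1 0 3 = 0" "t 3 1 0 2 = 0" "t 3 2 0 1 = 0"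
      using z anti[of 1 0 2 3] anti[of 2 0 1 3] anti[of 3 0 1 2] anti[of 2 1 0 3] anti[of 3 1 0 2] anti[of 3 2 0 1]
      by simp_all
    show "t k 0 1 2 = 0" "t k 0 1 3 = 0" "t k 0 2 3 = 0" "t k 1 0 2 = 0" "t k 1 0 3 = 0" "t k 1 2 3 = 0"
      "t k 2 0 1 = 0" "t k 2 0 3 = 0" "t k 2 1 3 = 0" "t k 3 0 1 = 0" "t k 3 0 2 = 0" "t k 3 1 2 = 0"
      using exhaust_4[of k] by (auto simp: z a kk kmk)
  qed
  then show ?thesis by (simp add: fun_eq_iff)
qed

lemma koszul_syzygy_relation:
  "koszul_syzygy a b c m i j = koszul_syzygy a b c m j i"
  "koszul_syzygy a b c m i j + koszul_syzygy a b c i m j + koszul_syzygy a b c j m i = 0"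
  by (simp_all add: koszul_syzygy_def monomial_hessian_def algebra_simps)

lemma two_lines_pivots:
  assumes "apolar_matrix two_lines_quartic g" "\<forall>(i, j)\<in>{(0,2), (0,3), (1,2), (1,3)}. g i j = 0"
  shows "g = 0"
  by (rule tensor2_eq_0) (use assms in \<open>unfold apolar_two_lines, auto\<close>)

lemma two_lines_strand_0: "chain.dim (linear_strand 0 (apolar two_lines_quartic)) = 4"
proof -
  let ?J = "{(0,2), (0,3), (1,2), (1,3)} :: (4 \<times> 4) set"
  have "chain.dim (linear_strand 0 (apolar two_lines_quartic)) = card ?J"
  proof (rule dim_strand_0[OF graph_quartic_forms, where e = "\<lambda>(b, c). monomial_hessian b c"])
    fix g assume g: "apolar_matrix two_lines_quartic g" "\<forall>(i, j)\<in>?J. g i j = 0"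
    then show "g = 0" by (rule two_lines_pivots)
  next
    show "\<forall>x\<in>?J. apolar_matrix two_lines_quartic (case x of (b, c) \<Rightarrow> monomial_hessian b c)"
      unfolding apolar_two_lines by (simp add: monomial_hessian_def kron_def forall_4)
    show "\<forall>x\<in>?J. \<forall>(i, j)\<in>?J. (case x of (b, c) \<Rightarrow> monomial_hessian b c) i j = (if x = (i, j) then 1 else 0)"
      by (simp add: monomial_hessian_def kron_def)
  qed simp
  then show ?thesis by simp
qed

lemma koszul_first_syzygy:
  assumes "\<And>m. apolar_matrix F (koszul_syzygy a b c m)"
  shows "first_syzygy F (koszul_syzygy a b c)"
  using assms koszul_syzygy_relation(2) unfolding first_syzygy_def by blast

lemma two_lines_strand_1: "chain.dim (linear_strand 1 (apolar two_lines_quartic)) = 4"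
proof -
  let ?J = "{(0,1,2), (0,1,3), (2,3,0), (2,3,1)} :: (4 \<times> 4 \<times> 4) set"
  have "chain.dim (linear_strand 1 (apolar two_lines_quartic)) = card ?J"
  proof (rule dim_strand_1[OF graph_quartic_forms, where e = "\<lambda>(a, b, c). koszul_syzygy a b c"])
    fix s assume s: "first_syzygy two_lines_quartic s" "\<forall>(m, i, j)\<in>?J. s m i j = 0"
    have dg: "s m i i = 0" "s m m j = 0" for m i j
      by (rule first_syzygy_diag[OF s(1)], erule apolar_diag)+
    note sym = first_syzygyD(2)[OF s(1)] and cyc = first_syzygyD(3)[OF s(1)]
    have z: "s m 0 1 = 0" "s m 2 3 = 0" for m
      using first_syzygyD(1)[OF s(1), of m] unfolding apolar_two_lines by blast+
    have p: "s 0 1 2 = 0" "s 0 1 3 = 0" "s 2 0 3 = 0" "s 2 1 3 = 0"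
      using s(2) sym[of 2 3 0] sym[of 2 3 1] by auto
    have q: "s 1 0 2 = 0" "s 1 0 3 = 0" "s 3 0 2 = 0" "s 3 1 2 = 0"
      using cyc[of 1 0 2] cyc[of 1 0 3] cyc[of 3 0 2] cyc[of 3 1 2] p z sym[of 2 1 0] sym[of 3 1 0] sym[of 0 3 2]
        sym[of 2 3 0] sym[of 0 3 1] sym[of 1 3 2] sym[of 2 3 1] sym[of 0 2 1] sym[of 3 1 2]
      by simp_all
    show "s = 0"
      by (rule tensor3_eq_0) (rule sym dg p q z)+
  next
    show "\<forall>x\<in>?J. first_syzygy two_lines_quartic (case x of (a, b, c) \<Rightarrow> koszul_syzygy a b c)"
      unfolding ball_simps case_prod_conv
      by (intro conjI koszul_first_syzygy TrueI)
       (simp_all add: apolar_two_lines koszul_syzygy_relation(1) koszul_syzygy_def monomial_hessian_def kron_def forall_4)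
    show "\<forall>x\<in>?J. \<forall>(m, i, j)\<in>?J. (case x of (a, b, c) \<Rightarrow> koszul_syzygy a b c) m i j = (if x = (m, i, j) then 1 else 0)"
      by (simp add: koszul_syzygy_def monomial_hessian_def kron_def)
  qed simp
  then show ?thesis by simp
qed

lemma second_syzygy_wedge_quadrics:
  assumes "\<And>k m i j. t k m i j = - t m k i j" "\<And>k m. apolar_matrix F (t k m)"
    and "\<forall>k m i j. t k m i j + t k i m j + t k j m i = 0"
  shows "second_syzygy F t"
  using assms unfolding second_syzygy_def first_syzygy_def by blast

text \<open>
  The quadric at \<open>e\<^sub>k \<and> e\<^sub>m\<close> is, up to sign, the minor of the matrix with rows \<open>(x\<^sub>0, x\<^sub>1, x\<^sub>2, x\<^sub>3)\<close> and
  \<open>(x\<^sub>0, x\<^sub>1, 0, 0)\<close> in the two columns other than \<open>k\<close> and \<open>m\<close>.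
\<close>

definition two_lines_second_syzygy :: "4 \<Rightarrow> 4 \<Rightarrow> 4 \<Rightarrow> 4 \<Rightarrow> complex"
  where "two_lines_second_syzygy k m i j =
    wedge_quadric 0 2 1 3 k m i j - wedge_quadric 0 3 1 2 k m i j
    - wedge_quadric 1 2 0 3 k m i j + wedge_quadric 1 3 0 2 k m i j"

lemma two_lines_second_syzygy: "second_syzygy two_lines_quartic two_lines_second_syzygy"
proof (rule second_syzygy_wedge_quadrics)
  show "two_lines_second_syzygy k m i j = - two_lines_second_syzygy m k i j" for k m i j
    unfolding two_lines_second_syzygy_def wedge_quadric_def by (simp add: algebra_simps)
  show "apolar_matrix two_lines_quartic (two_lines_second_syzygy k m)" for k m
    unfolding apolar_two_lines two_lines_second_syzygy_def wedge_quadric_def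
    by (simp add: monomial_hessian_def algebra_simps) (simp add: kron_def forall_4)
  show "\<forall>k m i j. two_lines_second_syzygy k m i j + two_lines_second_syzygy k i m j + two_lines_second_syzygy k j m i = 0"
    unfolding two_lines_second_syzygy_def wedge_quadric_def monomial_hessian_def
    by (intro allI) (simp add: algebra_simps)
qed

lemma second_syzygyD:
  assumes "second_syzygy F t"
  shows "t k m i j = - t m k i j" "apolar_matrix F (t k m)" "t k m i j = t k m j i"
    "t k m i j + t k i m j + t k j m i = 0"
  using assms first_syzygyD[of F "t k"] unfolding second_syzygy_def by blast+

lemma two_lines_strand_2: "chain.dim (linear_strand 2 (apolar two_lines_quartic)) = 1"
proof -
  let ?J = "{(0,2,1,3)} :: (4 \<times> 4 \<times> 4 \<times> 4) set"
  have "chain.dim (linear_strand 2 (apolar two_lines_quartic)) = card ?J"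
  proof (rule dim_strand_2[OF graph_quartic_forms, where e = "\<lambda>_. two_lines_second_syzygy"])
    fix t assume t: "second_syzygy two_lines_quartic t" "\<forall>(k, m, i, j)\<in>?J. t k m i j = 0"
    note D = second_syzygyD[OF t(1)]
    have z: "t k m 0 1 = 0" "t k m 2 3 = 0" for k m
      using D(2)[of k m] unfolding apolar_two_lines by blast+
    have 1: "t 0 2 1 3 = 0" using t(2) by simp
    have 2: "t 0 3 1 2 = 0" using D(4)[of 0 1 2 3] 1 z by simp
    have 3: "t 1 2 0 3 = 0" using D(4)[of 2 0 1 3] D(1)[of 2 0 1 3] D(1)[of 2 1 0 3] 1 z D(3)[of 2 3 1 0] by simp
    have 4: "t 1 3 0 2 = 0" using D(4)[of 1 0 2 3] 3 z by simp
    show "t = 0" by (rule tensor4_eq_0[OF t(1)]) (erule apolar_diag | rule 1 2 3 4 z)+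
  qed (simp_all add: two_lines_second_syzygy two_lines_second_syzygy_def wedge_quadric_def monomial_hessian_def kron_def)
  then show ?thesis by simp
qed

lemma betti_two_lines: "two_lines_quartic \<in> betti_forms 4 4 1"
  using two_lines_strand_0 two_lines_strand_1 two_lines_strand_2 graph_nondegenerate(1) graph_quartic_forms
  unfolding betti_forms_iff by blast

text \<open>
  All terms of elements of an ideal generated by quadrics have degree at least two.
\<close>

lemma quadric_ideal_linear_forms: "quadric_ideal F \<inter> forms 1 \<subseteq> {0}"
proof -
  interpret S: Modules.module "(*) :: 4 mpoly \<Rightarrow> 4 mpoly \<Rightarrow> 4 mpoly" by (rule module_mult)
  let ?D = "{p :: 4 mpoly. \<forall>m\<in>keys p. 2 \<le> mdeg m}"
  have "S.subspace ?D"
  proof (rule S.subspaceI)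
    show "0 \<in> ?D" by simp
  next
    fix p q assume pq: "p \<in> ?D" "q \<in> ?D"
    have "m \<in> keys p \<or> m \<in> keys q" if "m \<in> keys (p + q)" for m
      using that Poly_Mapping.keys_add[of p q] by blast
    with pq show "p + q \<in> ?D" by blast
  next
    fix c p assume p: "p \<in> ?D"
    have "2 \<le> mdeg m" if m: "m \<in> keys (c * p)" for m
    proof -
      obtain m1 m2 where "m = m1 + m2" "m2 \<in> keys p" using keys_mult[of c p] m by auto
      with p show ?thesis by (simp add: mdeg_add trans_le_add2)
    qed
    then show "c * p \<in> ?D" by blast
  qed
  moreover have "apolar F \<inter> forms 2 \<subseteq> ?D" by (auto simp: forms_def)
  ultimately have "quadric_ideal F \<subseteq> ?D" unfolding quadric_ideal_def by (rule S.span_minimal[rotated])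
  moreover have "p = 0" if "p \<in> ?D" "p \<in> forms 1" for p
  proof -
    have "keys p = {}"
    proof (rule equals0I)
      fix m assume "m \<in> keys p"
      then have "2 \<le> mdeg m" "mdeg m = 1" using that by (auto simp: forms_def)
      then show False by simp
    qed
    then show ?thesis by simp
  qed
  ultimately show ?thesis by blast
qed

text \<open>
  A chain \<open>z\<close> with \<open>koszul z\<close> equal to the second syzygy exists by exactness; it is not a boundary
  because boundaries have Koszul differential zero. The rank is \<open>4\<close>: each of the four contractions has
  an entry, a monomial in a position, that the other three lack.
\<close>

lemma two_lines_in_441b: "point two_lines_quartic \<in> \<F>_441b"
proof -
  let ?F = "two_lines_quartic" and ?Q = "quadric_ideal two_lines_quartic"
  interpret S: Modules.module "(*) :: 4 mpoly \<Rightarrow> 4 mpoly \<Rightarrow> 4 mpoly" by (rule module_mult)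
  interpret K: Vector_Spaces.linear chain_scal chain_scal koszul by (rule koszul_linear)
  define y where "y = chain2 (\<lambda>k m. quad (two_lines_second_syzygy k m))"
  note t_quad = second_syzygy_quad[OF graph_quartic_forms two_lines_second_syzygy]
  have y: "y \<in> linear_strand 2 (apolar ?F)" unfolding y_def by (rule t_quad(3))
  have h: "hess (contract k y {m}) i j = two_lines_second_syzygy k m i j" for k m i j
    unfolding y_def t_quad(2) t_quad(1) by (rule refl)
  have "y \<in> koszul ` kchains (Suc 2) 4"
    by (rule koszul_exact) (use linear_strandD(4,5)[OF y] in simp_all)
  then obtain z where z: "z \<in> kchains 3 4" "y = koszul z" by auto
  have "y T \<in> ?Q" for T
    unfolding quadric_ideal_def using linear_strandD(1,3)[OF y] by (intro S.span_base) blast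
  then have zc: "z \<in> cycles 3 4 ?Q" using z by (simp add: cycles_def)
  have "z \<notin> boundaries 3 4 ?Q"
  proof
    assume "z \<in> boundaries 3 4 ?Q"
    then obtain w v where wv: "z = koszul w + v" "v \<in> kchains 3 4" "\<And>T. v T \<in> ?Q"
      by (auto simp: boundaries_def)
    have "v T \<in> forms 1" for T using kchains_linear_iff[of v 3] wv(2) by simp
    then have "v T = 0" for T using wv(3) quadric_ideal_linear_forms by blast
    then have "z = koszul w" using wv(1) by (auto simp: fun_eq_iff)
    then have "y = 0" using z(2) koszul_koszul by simp
    then have "two_lines_second_syzygy 0 2 1 3 = 0"
      unfolding h[symmetric] by (simp add: contract_def hess_simps)
    then show False by (simp add: two_lines_second_syzygy_def wedge_quadric_def monomial_hessian_def kron_def)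
  qed
  moreover have "syzygy_rank z = 4"
  proof -
    \<comment> \<open>The entry that distinguishes the \<open>k\<close>-th contraction, as position and monomial.\<close>
    define e :: "4 \<Rightarrow> 4 \<times> 4 \<times> 4" where "e k = (if k = 0 then (2, 1, 3) else if k = 1 then (2, 0, 3) else if k = 2 then (0, 1, 3) else (0, 1, 2))"
      for k :: 4
    define f where "f k c = (case e k of (m, i, j) \<Rightarrow> (if k = 1 \<or> k = 2 then - 1 else 1) * hess (c {m}) i j)"
      for k :: 4 and c :: chain
    have lin: "\<forall>k\<in>UNIV. Vector_Spaces.linear chain_scal (*) (f k)"
      by (auto simp: f_def Vector_Spaces.linear_iff chain.vector_space_axioms complex_vector_space
          hess_simps chain_scal_apply algebra_simps split: prod.splits)
    have dual: "\<forall>i\<in>UNIV. \<forall>j\<in>UNIV. f j (contract i y) = (if i = j then 1 else 0)"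
      unfolding Ball_def forall_4
      by (simp add: f_def e_def h two_lines_second_syzygy_def wedge_quadric_def monomial_hessian_def kron_def)
    note ind = chain.independent_of_dual_functionals[OF finite_class.finite_UNIV lin dual]
    have "chain.dim (chain.span (range (\<lambda>k. contract k y))) = card (range (\<lambda>k. contract k y))"
      by (rule chain.dim_span_eq_card_independent[OF ind(2)])
    also have "\<dots> = 4" using card_image[OF ind(1)] by simp
    finally show ?thesis unfolding syzygy_rank_def z(2)[symmetric] .
  qed
  ultimately show ?thesis
    using zc betti_two_lines unfolding \<F>_441_rank_def linear_second_syzygies_def by blast
qed

lemma plane_point_pivots:
  assumes "apolar_matrix plane_point_quartic g" "\<forall>(i, j)\<in>{(0,1), (0,2), (0,3)}. g i j = 0"
  shows "g = 0"
  by (rule tensor2_eq_0) (use assms in \<open>unfold apolar_plane_point, auto\<close>)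

lemma plane_point_strand_0: "chain.dim (linear_strand 0 (apolar plane_point_quartic)) = 3"
proof -
  let ?J = "{(0,1), (0,2), (0,3)} :: (4 \<times> 4) set"
  have "chain.dim (linear_strand 0 (apolar plane_point_quartic)) = card ?J"
  proof (rule dim_strand_0[OF graph_quartic_forms, where e = "\<lambda>(b, c). monomial_hessian b c"])
    fix g assume g: "apolar_matrix plane_point_quartic g" "\<forall>(i, j)\<in>?J. g i j = 0"
    then show "g = 0" by (rule plane_point_pivots)
  next
    show "\<forall>x\<in>?J. apolar_matrix plane_point_quartic (case x of (b, c) \<Rightarrow> monomial_hessian b c)"
      unfolding apolar_plane_point by (simp add: monomial_hessian_def kron_def forall_4)
    show "\<forall>x\<in>?J. \<forall>(i, j)\<in>?J. (case x of (b, c) \<Rightarrow> monomial_hessian b c) i j = (if x = (i, j) then 1 else 0)"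
      by (simp add: monomial_hessian_def kron_def)
  qed simp
  then show ?thesis by simp
qed

lemma plane_line_pivots:
  assumes "apolar_matrix plane_line_quartic g" "\<forall>(i, j)\<in>{(0,1), (0,2)}. g i j = 0"
  shows "g = 0"
  by (rule tensor2_eq_0) (use assms in \<open>unfold apolar_plane_line, auto\<close>)

lemma plane_line_strand_0: "chain.dim (linear_strand 0 (apolar plane_line_quartic)) = 2"
proof -
  let ?J = "{(0,1), (0,2)} :: (4 \<times> 4) set"
  have "chain.dim (linear_strand 0 (apolar plane_line_quartic)) = card ?J"
  proof (rule dim_strand_0[OF graph_quartic_forms, where e = "\<lambda>(b, c). monomial_hessian b c"])
    fix g assume g: "apolar_matrix plane_line_quartic g" "\<forall>(i, j)\<in>?J. g i j = 0"
    then show "g = 0" by (rule plane_line_pivots)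
  next
    show "\<forall>x\<in>?J. apolar_matrix plane_line_quartic (case x of (b, c) \<Rightarrow> monomial_hessian b c)"
      unfolding apolar_plane_line by (simp add: monomial_hessian_def kron_def forall_4)
    show "\<forall>x\<in>?J. \<forall>(i, j)\<in>?J. (case x of (b, c) \<Rightarrow> monomial_hessian b c) i j = (if x = (i, j) then 1 else 0)"
      by (simp add: monomial_hessian_def kron_def)
  qed simp
  then show ?thesis by simp
qed

lemma plane_point_strand_1: "chain.dim (linear_strand 1 (apolar plane_point_quartic)) = 3"
proof -
  let ?J = "{(1,2,0), (1,3,0), (2,3,0)} :: (4 \<times> 4 \<times> 4) set"
  have "chain.dim (linear_strand 1 (apolar plane_point_quartic)) = card ?J"
  proof (rule dim_strand_1[OF graph_quartic_forms, where e = "\<lambda>(a, b, c). koszul_syzygy a b c"])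
    fix s assume s: "first_syzygy plane_point_quartic s" "\<forall>(m, i, j)\<in>?J. s m i j = 0"
    have dg: "s m i i = 0" "s m m j = 0" for m i j
      by (rule first_syzygy_diag[OF s(1)], erule apolar_diag)+
    note sym = first_syzygyD(2)[OF s(1)] and cyc = first_syzygyD(3)[OF s(1)]
    have z: "s m 1 2 = 0" "s m 1 3 = 0" "s m 2 3 = 0" for m
      using first_syzygyD(1)[OF s(1), of m] unfolding apolar_plane_point by blast+
    have p: "s 1 0 2 = 0" "s 1 0 3 = 0" "s 2 0 3 = 0"
      using s(2) sym[of 1 2 0] sym[of 1 3 0] sym[of 2 3 0] by auto
    have q: "s 2 0 1 = 0" "s 3 0 1 = 0" "s 3 0 2 = 0"
      using cyc[of 0 1 2] cyc[of 0 1 3] cyc[of 0 2 3] p z by simp_all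
    show "s = 0"
      by (rule tensor3_eq_0) (rule sym dg p q z)+
  next
    show "\<forall>x\<in>?J. first_syzygy plane_point_quartic (case x of (a, b, c) \<Rightarrow> koszul_syzygy a b c)"
      unfolding ball_simps case_prod_conv
      by (intro conjI koszul_first_syzygy TrueI)
       (simp_all add: apolar_plane_point koszul_syzygy_relation(1) koszul_syzygy_def monomial_hessian_def kron_def forall_4)
    show "\<forall>x\<in>?J. \<forall>(m, i, j)\<in>?J. (case x of (a, b, c) \<Rightarrow> koszul_syzygy a b c) m i j = (if x = (m, i, j) then 1 else 0)"
      by (simp add: koszul_syzygy_def monomial_hessian_def kron_def)
  qed simp
  then show ?thesis by simp
qed

lemma plane_line_strand_1: "chain.dim (linear_strand 1 (apolar plane_line_quartic)) = 1"
proof -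
  let ?J = "{(1,2,0)} :: (4 \<times> 4 \<times> 4) set"
  have "chain.dim (linear_strand 1 (apolar plane_line_quartic)) = card ?J"
  proof (rule dim_strand_1[OF graph_quartic_forms, where e = "\<lambda>(a, b, c). koszul_syzygy a b c"])
    fix s assume s: "first_syzygy plane_line_quartic s" "\<forall>(m, i, j)\<in>?J. s m i j = 0"
    have dg: "s m i i = 0" "s m m j = 0" for m i j
      by (rule first_syzygy_diag[OF s(1)], erule apolar_diag)+
    note sym = first_syzygyD(2)[OF s(1)] and cyc = first_syzygyD(3)[OF s(1)]
    have z: "s m 0 3 = 0" "s m 1 2 = 0" "s m 1 3 = 0" "s m 2 3 = 0" for m
      using first_syzygyD(1)[OF s(1), of m] unfolding apolar_plane_line by blast+
    have p: "s 1 0 2 = 0"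
      using s(2) sym[of 1 2 0] by auto
    have q: "s 2 0 1 = 0" "s 3 0 1 = 0" "s 3 0 2 = 0"
      using cyc[of 0 1 2] cyc[of 0 1 3] cyc[of 0 2 3] p z by simp_all
    show "s = 0"
      by (rule tensor3_eq_0) (rule sym dg p q z)+
  next
    show "\<forall>x\<in>?J. first_syzygy plane_line_quartic (case x of (a, b, c) \<Rightarrow> koszul_syzygy a b c)"
      unfolding ball_simps case_prod_conv
      by (intro conjI koszul_first_syzygy TrueI)
       (simp_all add: apolar_plane_line koszul_syzygy_relation(1) koszul_syzygy_def monomial_hessian_def kron_def forall_4)
    show "\<forall>x\<in>?J. \<forall>(m, i, j)\<in>?J. (case x of (a, b, c) \<Rightarrow> koszul_syzygy a b c) m i j = (if x = (m, i, j) then 1 else 0)"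
      by (simp add: koszul_syzygy_def monomial_hessian_def kron_def)
  qed simp
  then show ?thesis by simp
qed

text \<open>
  The same construction with second row \<open>(x\<^sub>0, 0, 0, 0)\<close>.
\<close>

definition plane_point_second_syzygy :: "4 \<Rightarrow> 4 \<Rightarrow> 4 \<Rightarrow> 4 \<Rightarrow> complex"
  where "plane_point_second_syzygy k m i j =
    wedge_quadric 1 2 0 3 k m i j - wedge_quadric 1 3 0 2 k m i j + wedge_quadric 2 3 0 1 k m i j"

lemma plane_point_second_syzygy: "second_syzygy plane_point_quartic plane_point_second_syzygy"
proof (rule second_syzygy_wedge_quadrics)
  show "plane_point_second_syzygy k m i j = - plane_point_second_syzygy m k i j" for k m i j
    unfolding plane_point_second_syzygy_def wedge_quadric_def by (simp add: algebra_simps)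
  show "apolar_matrix plane_point_quartic (plane_point_second_syzygy k m)" for k m
    unfolding apolar_plane_point plane_point_second_syzygy_def wedge_quadric_def
    by (simp add: monomial_hessian_def algebra_simps) (simp add: kron_def forall_4)
  show "\<forall>k m i j. plane_point_second_syzygy k m i j + plane_point_second_syzygy k i m j + plane_point_second_syzygy k j m i = 0"
    unfolding plane_point_second_syzygy_def wedge_quadric_def monomial_hessian_def
    by (intro allI) (simp add: algebra_simps)
qed

lemma plane_point_strand_2: "chain.dim (linear_strand 2 (apolar plane_point_quartic)) = 1"
proof -
  let ?J = "{(1,2,0,3)} :: (4 \<times> 4 \<times> 4 \<times> 4) set"
  have "chain.dim (linear_strand 2 (apolar plane_point_quartic)) = card ?J"
  proof (rule dim_strand_2[OF graph_quartic_forms, where e = "\<lambda>_. plane_point_second_syzygy"])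
    fix t assume t: "second_syzygy plane_point_quartic t" "\<forall>(k, m, i, j)\<in>?J. t k m i j = 0"
    note D = second_syzygyD[OF t(1)]
    have z: "t k m 1 2 = 0" "t k m 1 3 = 0" "t k m 2 3 = 0" for k m
      using D(2)[of k m] unfolding apolar_plane_point by blast+
    have 1: "t 1 2 0 3 = 0" using t(2) by simp
    have 2: "t 1 3 0 2 = 0" using D(4)[of 1 0 2 3] 1 z by simp
    have 3: "t 2 3 0 1 = 0" using D(4)[of 2 0 1 3] D(1)[of 2 1 0 3] 1 z D(3)[of 2 3 1 0] by simp
    show "t = 0" by (rule tensor4_eq_0[OF t(1)]) (erule apolar_diag | rule 1 2 3 z)+
  qed (simp_all add: plane_point_second_syzygy plane_point_second_syzygy_def wedge_quadric_def monomial_hessian_def kron_def)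
  then show ?thesis by simp
qed

lemma plane_line_strand_2: "chain.dim (linear_strand 2 (apolar plane_line_quartic)) = 0"
proof -
  let ?J = "{} :: (4 \<times> 4 \<times> 4 \<times> 4) set"
  have "chain.dim (linear_strand 2 (apolar plane_line_quartic)) = card ?J"
  proof (rule dim_strand_2[OF graph_quartic_forms, where e = "\<lambda>_. 0"])
    fix t assume t: "second_syzygy plane_line_quartic t"
    note D = second_syzygyD[OF t(1)]
    have z: "t k m 0 3 = 0" "t k m 1 2 = 0" "t k m 1 3 = 0" "t k m 2 3 = 0" for k m
      using D(2)[of k m] unfolding apolar_plane_line by blast+
    have 1: "t 1 3 0 2 = 0" using D(4)[of 1 0 2 3] z by simp
    have 2: "t 2 3 0 1 = 0" using D(4)[of 2 0 1 3] z D(3)[of 2 3 1 0] by simp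
    show "t = 0" by (rule tensor4_eq_0[OF t(1)]) (erule apolar_diag | rule 1 2 z)+
  qed simp_all
  then show ?thesis by simp
qed

lemma betti_plane_point: "plane_point_quartic \<in> betti_forms 3 3 1"
  using plane_point_strand_0 plane_point_strand_1 plane_point_strand_2 graph_nondegenerate(2) graph_quartic_forms
  unfolding betti_forms_iff by blast

lemma betti_plane_line: "plane_line_quartic \<in> betti_forms 2 1 0"
  using plane_line_strand_0 plane_line_strand_1 plane_line_strand_2 graph_nondegenerate(3) graph_quartic_forms
  unfolding betti_forms_iff by blast

lemma five_points_strand_0: "chain.dim (linear_strand 0 (apolar five_points_quartic)) = 5"
proof -
  let ?J = "{(1,2), (1,3), (2,3), (1,1), (2,2)} :: (4 \<times> 4) set"
  let ?e = "\<lambda>(b, c) i j. if b = c then (monomial_hessian b b i j - monomial_hessian 3 3 i j) / 2 else monomial_hessian b c i j"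
  have "chain.dim (linear_strand 0 (apolar five_points_quartic)) = card ?J"
  proof (rule dim_strand_0[OF graph_quartic_forms, where e = ?e])
    fix g assume g: "apolar_matrix five_points_quartic g" "\<forall>(i, j)\<in>?J. g i j = 0"
    have sym: "g i j = g j i" for i j using g(1) unfolding apolar_five_points by blast
    have z: "g 0 0 = 0" "g 0 1 = 0" "g 0 2 = 0" "g 0 3 = 0" and tr: "g 1 1 + g 2 2 + g 3 3 = 0"
      using g(1) unfolding apolar_five_points by blast+
    have p: "g 1 2 = 0" "g 1 3 = 0" "g 2 3 = 0" "g 1 1 = 0" "g 2 2 = 0" using g(2) by auto
    have "g 3 3 = 0" using tr p by simp
    then have d: "g i i = 0" for i using exhaust_4[of i] z p by auto
    show "g = 0" by (rule tensor2_eq_0) (rule sym d z p)+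
  next
    show "\<forall>x\<in>?J. apolar_matrix five_points_quartic (?e x)"
      unfolding apolar_five_points by (simp add: monomial_hessian_def kron_def forall_4)
    show "\<forall>x\<in>?J. \<forall>(i, j)\<in>?J. ?e x i j = (if x = (i, j) then 1 else 0)"
      by (simp add: monomial_hessian_def kron_def)
  qed simp
  then show ?thesis by simp
qed

text \<open>
  The index \<open>0\<close> does not occur, so syzygies are tensors in three indices that are trace-free in the
  last two.
\<close>

lemma five_points_first_syzygy:
  assumes s: "first_syzygy five_points_quartic s"
  shows "s m 0 j = 0" "s 0 i j = 0" "s i i i = 0" "s m 1 1 + s m 2 2 + s m 3 3 = 0"
    "(\<And>m i. s m i i = 0) \<Longrightarrow> s m m j = 0"
proof -
  note D = first_syzygyD[OF s]
  have "s m 0 0 = 0" "s m 0 1 = 0" "s m 0 2 = 0" "s m 0 3 = 0" for m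
    using D(1)[of m] unfolding apolar_five_points by blast+
  then show z: "s m 0 j = 0" for m j using exhaust_4[of j] by auto
  show "s 0 i j = 0" using D(3)[of 0 i j] z D(2)[of i 0 j] D(2)[of j 0 i] by simp
  show "s i i i = 0" using D(3)[of i i i] by simp
  show "s m 1 1 + s m 2 2 + s m 3 3 = 0"
    using D(1)[of m] unfolding apolar_five_points by blast
  assume "\<And>m i. s m i i = 0"
  then have "2 * s m m j = 0" using D(3)[of m m j] by simp
  then show "s m m j = 0" by simp
qed

lemma koszul_difference_first_syzygy:
  assumes "\<And>m. apolar_matrix F (\<lambda>i j. (koszul_syzygy a b b m i j - koszul_syzygy a c c m i j) / 2)"
  shows "first_syzygy F (\<lambda>m i j. (koszul_syzygy a b b m i j - koszul_syzygy a c c m i j) / 2)"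
proof -
  have "(koszul_syzygy a b b m i j - koszul_syzygy a c c m i j) / 2
      + (koszul_syzygy a b b i m j - koszul_syzygy a c c i m j) / 2
      + (koszul_syzygy a b b j m i - koszul_syzygy a c c j m i) / 2
    = ((koszul_syzygy a b b m i j + koszul_syzygy a b b i m j + koszul_syzygy a b b j m i)
      - (koszul_syzygy a c c m i j + koszul_syzygy a c c i m j + koszul_syzygy a c c j m i)) / 2" for m i j
    by (simp add: field_simps)
  then show ?thesis using assms unfolding first_syzygy_def koszul_syzygy_relation(2) by simp
qed

lemma five_points_strand_1: "chain.dim (linear_strand 1 (apolar five_points_quartic)) = 5"
proof -
  let ?J = "{(1,2,2), (2,1,1), (3,1,1), (1,3,2), (2,3,1)} :: (4 \<times> 4 \<times> 4) set"
  let ?e = "\<lambda>(a, b, c) m i j. if b = c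
    then (koszul_syzygy a b b m i j - koszul_syzygy a (if a = 3 then 2 else 3) (if a = 3 then 2 else 3) m i j) / 2
    else koszul_syzygy a b c m i j"
  have e: "first_syzygy five_points_quartic (\<lambda>m i j. (koszul_syzygy 1 2 2 m i j - koszul_syzygy 1 3 3 m i j) / 2)"
    "first_syzygy five_points_quartic (\<lambda>m i j. (koszul_syzygy 2 1 1 m i j - koszul_syzygy 2 3 3 m i j) / 2)"
    "first_syzygy five_points_quartic (\<lambda>m i j. (koszul_syzygy 3 1 1 m i j - koszul_syzygy 3 2 2 m i j) / 2)"
    "first_syzygy five_points_quartic (koszul_syzygy 1 3 2)"
    "first_syzygy five_points_quartic (koszul_syzygy 2 3 1)"
    by (rule koszul_difference_first_syzygy koszul_first_syzygy, unfold apolar_five_points,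
        simp add: koszul_syzygy_def monomial_hessian_def kron_def forall_4)+
  have "chain.dim (linear_strand 1 (apolar five_points_quartic)) = card ?J"
  proof (rule dim_strand_1[OF graph_quartic_forms, where e = ?e])
    fix s assume s: "first_syzygy five_points_quartic s" "\<forall>(m, i, j)\<in>?J. s m i j = 0"
    note sym = first_syzygyD(2)[OF s(1)] and cyc = first_syzygyD(3)[OF s(1)]
    note S = five_points_first_syzygy[OF s(1)]
    have p: "s 1 2 2 = 0" "s 2 1 1 = 0" "s 3 1 1 = 0" "s 1 2 3 = 0" "s 2 1 3 = 0"
      using s(2) sym[of 1 3 2] sym[of 2 3 1] by auto
    have q: "s 1 3 3 = 0" "s 2 3 3 = 0" "s 3 2 2 = 0"
      using S(4)[of 1] S(4)[of 2] S(4)[of 3] S(3) p by simp_all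
    have d: "s m i i = 0" for m i
      using exhaust_4[of m] exhaust_4[of i] by (elim disjE) (simp_all only: S(1-3) p q)
    have r: "s 3 1 2 = 0" using cyc[of 1 2 3] p by simp
    show "s = 0"
    proof (rule tensor3_eq_0)
      show "s m i j = s m j i" for m i j by (rule sym)
      show "s m i i = 0" "s m m j = 0" for m i j by (rule d, rule S(5), rule d)
    qed (rule p r S(1,2))+
  next
    show "\<forall>x\<in>?J. first_syzygy five_points_quartic (?e x)"
      using e by simp
    show "\<forall>x\<in>?J. \<forall>(m, i, j)\<in>?J. ?e x m i j = (if x = (m, i, j) then 1 else 0)"
      by (simp add: koszul_syzygy_def monomial_hessian_def kron_def)
  qed simp
  then show ?thesis by simp
qed

lemma five_points_second_syzygy:
  assumes t: "second_syzygy five_points_quartic t"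
  shows "t = 0"
proof -
  note D = second_syzygyD[OF t]
  have f: "first_syzygy five_points_quartic (t k)" for k using t unfolding second_syzygy_def by blast
  note S = five_points_first_syzygy[OF f]
  have kk: "t k k i j = 0" for k i j using D(1)[of k k i j] by simp
  have t0: "t 0 m i j = 0" for m i j using D(1)[of 0 m i j] S(2)[of m i j] by simp
  have mkk: "t k m k k = 0" for k m using D(4)[of k m k k] kk by simp
  have d: "t k m i i = 0" for k m i
  proof (cases "k = 0 \<or> m = 0 \<or> i = 0 \<or> k = m \<or> i = k \<or> i = m")
    case True
    then show ?thesis using t0 S(1,2,3) kk mkk by auto
  next
    case False
    then show ?thesis
      using S(4)[of k m] S(3)[of k m] mkk[of k m] exhaust_4[of k] exhaust_4[of m] exhaust_4[of i]
      by (elim disjE) simp_all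
  qed
  have mm: "t k m m j = 0" for k m j by (rule S(5)) (rule d)
  have km: "t k m k j = 0" "t k m j k = 0" for k m j
    using D(1)[of k m k j] mm[of m k j] D(3)[of k m j k] by simp_all
  have "t k = 0" for k
  proof (rule tensor3_eq_0)
    show "t k m i j = t k m j i" for m i j by (rule D(3))
    show "t k m i i = 0" "t k m m j = 0" for m i j by (rule d mm)+
    show "t k 0 1 2 = 0" "t k 0 1 3 = 0" "t k 0 2 3 = 0" "t k 1 0 2 = 0" "t k 1 0 3 = 0" "t k 1 2 3 = 0"
      "t k 2 0 1 = 0" "t k 2 0 3 = 0" "t k 2 1 3 = 0" "t k 3 0 1 = 0" "t k 3 0 2 = 0" "t k 3 1 2 = 0"
      using exhaust_4[of k] by (auto simp: S(1,2) t0 kk km)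
  qed
  then show ?thesis by (simp add: fun_eq_iff)
qed

lemma five_points_strand_2: "chain.dim (linear_strand 2 (apolar five_points_quartic)) = 0"
proof -
  have "chain.dim (linear_strand 2 (apolar five_points_quartic)) = card ({} :: (4 \<times> 4 \<times> 4 \<times> 4) set)"
    by (rule dim_strand_2[OF graph_quartic_forms, where e = "\<lambda>_. 0"])
      (simp_all add: five_points_second_syzygy)
  then show ?thesis by simp
qed

lemma betti_five_points: "five_points_quartic \<in> betti_forms 5 5 0"
  using five_points_strand_0 five_points_strand_1 five_points_strand_2 graph_nondegenerate(4) graph_quartic_forms
  unfolding betti_forms_iff by blast

section \<open>Nets of quadrics with two linear syzygies\<close>

lemma forms_mult_11: "p \<in> forms 1 \<Longrightarrow> q \<in> forms 1 \<Longrightarrow> p * q \<in> forms 2"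
  using forms_mult[of p 1 q 1] by simp

lemma grad_nonzero: "a \<in> forms 1 \<Longrightarrow> a \<noteq> 0 \<Longrightarrow> \<exists>j. grad a j \<noteq> 0"
  using form_1_eq_0 by blast

lemma divide_linear:
  assumes "grad a j \<noteq> 0" "k \<in> forms 1" "a \<in> forms 1"
  obtains c k' where "k = scal c a + k'" "k' \<in> forms 1" "pdiff j k' = 0"
proof -
  define c where "c = grad k j / grad a j"
  have f: "k - scal c a \<in> forms 1" using assms by (intro forms_intros)
  have "pdiff j (k - scal c a) = 0"
    using form_0_const[OF pdiff_form_1[OF f, of j]] assms(1)
    by (simp add: pdiff_minus pdiff_scal lookup_minus c_def grad_def)
  with f that[of c "k - scal c a"] show ?thesis by simp
qed

lemma grad_pdiff: "grad (pdiff j q) i = hess q i j"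
  by (simp add: grad_def hess_def)

text \<open>
  Division with remainder by a linear form \<open>a\<close> that involves the variable \<open>x\<^sub>j\<close>; a vanishing derivative
  \<open>pdiff j q'\<close> says that the remainder does not involve \<open>x\<^sub>j\<close>.
\<close>

lemma divide_quadric:
  assumes a: "grad a j \<noteq> 0" "a \<in> forms 1" and q: "q \<in> forms 2"
  obtains g q' where "q = a * g + q'" "g \<in> forms 1" "q' \<in> forms 2" "pdiff j q' = 0"
proof -
  \<comment> \<open>Comparing \<open>x\<^sub>j\<^sup>2\<close> in \<open>q\<close> and \<open>a * g\<close> determines the entry \<open>gj\<close> of \<open>g\<close>, and then \<open>x\<^sub>i x\<^sub>j\<close> the others.\<close>
  define gj where "gj = hess q j j / (2 * grad a j)"
  define g where "g = scal (1 / grad a j) (pdiff j q - scal gj a)"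
  have g: "g \<in> forms 1" unfolding g_def using a q by (intro forms_intros pdiff_form_2)
  have ggj: "grad g j = gj"
    using a(1) by (simp add: g_def grad_simps grad_pdiff gj_def field_simps)
  have f: "q - a * g \<in> forms 2" using a q g by (intro forms_diff forms_mult_11)
  have "pdiff j (q - a * g) = 0"
  proof (rule form_1_eq_0[OF pdiff_form_2[OF f]])
    fix i
    have "grad (pdiff j (q - a * g)) i = hess q i j - (grad a i * grad g j + grad a j * grad g i)"
      by (simp add: grad_pdiff hess_simps hess_linear_mult a g)
    also have "grad g i = (hess q i j - gj * grad a i) / grad a j"
      by (simp add: g_def grad_simps grad_pdiff)
    finally show "grad (pdiff j (q - a * g)) i = 0" using a(1) ggj by simp
  qed
  with f g that[of g "q - a * g"] show ?thesis by simp
qed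

text \<open>
  Differentiation by \<open>x\<^sub>j\<close> turns the equation for \<open>g\<close> and \<open>n\<close> into the same equation for \<open>pdiff j g\<close>
  and \<open>n + 1\<close>, so the degree of \<open>g\<close> can be lowered until the second term vanishes.
\<close>

lemma multiple_free_of_variable:
  assumes a: "a \<in> forms 1" "grad a j \<noteq> 0" and g: "g \<in> forms d"
    and 0: "scal (of_nat (Suc n) * grad a j) g + a * pdiff j g = 0"
  shows "g = 0"
  using g 0
proof (induction d arbitrary: g n)
  case 0
  then show ?case using pdiff_forms(2)[OF 0(1)] a(2) by (simp del: of_nat_Suc)
next
  case (Suc d)
  have f: "pdiff j g \<in> forms d" using pdiff_forms(1)[OF Suc.prems(1)] by simp
  have "pdiff j (scal (of_nat (Suc n) * grad a j) g + a * pdiff j g) = 0"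
    unfolding Suc.prems(2) by simp
  then have "scal (of_nat (Suc n) * grad a j) (pdiff j g) + (a * pdiff j (pdiff j g) + scal (grad a j) (pdiff j g)) = 0"
    by (simp only: pdiff_add pdiff_scal pdiff_linear_mult[OF a(1)])
  moreover have "scal (of_nat (Suc (Suc n)) * grad a j) (pdiff j g)
      = scal (of_nat (Suc n) * grad a j) (pdiff j g) + scal (grad a j) (pdiff j g)"
    unfolding mpoly.scale_left_distrib[symmetric] by (simp add: distrib_right)
  ultimately have "scal (of_nat (Suc (Suc n)) * grad a j) (pdiff j g) + a * pdiff j (pdiff j g) = 0"
    by (simp only: ac_simps)
  then have 0: "pdiff j g = 0" by (rule Suc.IH[OF f])
  show ?case using Suc.prems(2) a(2) unfolding 0 by (simp del: of_nat_Suc)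
qed

lemma multiple_eq_0:
  assumes a: "a \<in> forms 1" "grad a j \<noteq> 0" and g: "g \<in> forms d" and 0: "pdiff j (a * g) = 0"
  shows "g = 0"
  using 0 by (intro multiple_free_of_variable[OF a g, of 0]) (simp add: pdiff_linear_mult a add.commute)

text \<open>
  Linear forms are prime. Modulo \<open>a\<close> both factors can be replaced by remainders without \<open>x\<^sub>j\<close>; their
  product is a multiple of \<open>a\<close> without \<open>x\<^sub>j\<close>, hence zero.
\<close>

lemma linear_form_prime_quadric:
  fixes a :: "4 mpoly"
  assumes a: "a \<in> forms 1" "a \<noteq> 0" and k: "k \<in> forms 1" and q: "q \<in> forms 2"
    and h: "h \<in> forms 2" and eq: "k * q = a * h"
  shows "(\<exists>c. k = scal c a) \<or> (\<exists>g\<in>forms 1. q = a * g)"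
proof -
  obtain j where j: "grad a j \<noteq> 0" using grad_nonzero a by blast
  obtain c k' where k': "k = scal c a + k'" "k' \<in> forms 1" "pdiff j k' = 0"
    using divide_linear[OF j k a(1)] by metis
  obtain g q' where q': "q = a * g + q'" "g \<in> forms 1" "q' \<in> forms 2" "pdiff j q' = 0"
    using divide_quadric[OF j a(1) q] by metis
  define r where "r = h - scal c q - k' * g"
  have r: "r \<in> forms 2" unfolding r_def by (intro forms_diff forms_scal h q forms_mult_11 k' q')
  have kq: "k' * q' = a * r"
  proof -
    have "k' * q' = k * q - scal c a * q - k' * (a * g)" unfolding k'(1) q'(1) by (simp add: algebra_simps)
    then show ?thesis unfolding eq r_def by (simp add: algebra_simps scal_mult_left scal_mult_right)
  qed
  have "pdiff j (k' * q') = 0"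
    using k' q' by (simp add: pdiff_linear_mult grad_def)
  then have "r = 0" using multiple_eq_0[OF a(1) j r] kq by simp
  then have "k' = 0 \<or> q' = 0" using kq by simp
  then show ?thesis using k' q' by auto
qed

lemma linear_form_prime_linear:
  fixes a :: "4 mpoly"
  assumes a: "a \<in> forms 1" "a \<noteq> 0" and k: "k \<in> forms 1" and q: "q \<in> forms 1"
    and h: "h \<in> forms 1" and eq: "k * q = a * h"
  shows "(\<exists>c. k = scal c a) \<or> (\<exists>c. q = scal c a)"
proof -
  obtain j where j: "grad a j \<noteq> 0" using grad_nonzero a by blast
  obtain c k' where k': "k = scal c a + k'" "k' \<in> forms 1" "pdiff j k' = 0"
    using divide_linear[OF j k a(1)] by metis
  obtain d q' where q': "q = scal d a + q'" "q' \<in> forms 1" "pdiff j q' = 0"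
    using divide_linear[OF j q a(1)] by metis
  define r where "r = h - scal c q - scal d k'"
  have r: "r \<in> forms 1" unfolding r_def by (intro forms_diff forms_scal h q k' q')
  have kq: "k' * q' = a * r"
  proof -
    have "k' * q' = k * q - scal c a * q - k' * scal d a" unfolding k'(1) q'(1) by (simp add: algebra_simps)
    then show ?thesis unfolding eq r_def by (simp add: algebra_simps scal_mult_left scal_mult_right)
  qed
  have "pdiff j (k' * q') = 0"
    using k' q' by (simp add: pdiff_linear_mult grad_def)
  then have "r = 0" using multiple_eq_0[OF a(1) j r] kq by simp
  then have "k' = 0 \<or> q' = 0" using kq by simp
  then show ?thesis using k' q' by auto
qed

lemma koszul_two_linear_forms:
  fixes l1 :: "4 mpoly"
  assumes l: "l1 \<in> forms 1" "l2 \<in> forms 1" and n: "n1 \<in> forms 2" "n2 \<in> forms 2"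
    and l1: "l1 \<noteq> 0" and l2: "\<And>c. l2 \<noteq> scal c l1" and rel: "l1 * n1 + l2 * n2 = 0"
  obtains a where "a \<in> forms 1" "n1 = l2 * a" "n2 = - (l1 * a)"
proof -
  have "l2 * n2 = l1 * (- n1)" using rel by (simp add: add_eq_0_iff)
  then obtain g where g: "g \<in> forms 1" "n2 = l1 * g"
    using linear_form_prime_quadric[OF l(1) l1 l(2) n(2) forms_uminus[OF n(1)]] l2 by auto
  have "l1 * (n1 + l2 * g) = 0" using rel g by (simp add: algebra_simps)
  then have "n1 = l2 * (- g)" using l1 by (simp add: add_eq_0_iff)
  with g that[of "- g"] show ?thesis by (simp add: forms_uminus)
qed

text \<open>
  Independent linear forms are a regular sequence, so their relations are Koszul relations: here
  \<open>n = l \<times> b\<close>. Modulo \<open>l1\<close> this is a relation between two forms.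
\<close>

lemma koszul_three_linear_forms:
  fixes l1 :: "4 mpoly"
  assumes l: "l1 \<in> forms 1" "l2 \<in> forms 1" "l3 \<in> forms 1"
    and n: "n1 \<in> forms 2" "n2 \<in> forms 2" "n3 \<in> forms 2"
    and ind: "\<And>a b c. scal a l1 + scal b l2 + scal c l3 = 0 \<Longrightarrow> a = 0 \<and> b = 0 \<and> c = 0"
    and rel: "l1 * n1 + l2 * n2 + l3 * n3 = 0"
  obtains b1 b2 b3 where "b1 \<in> forms 1" "b2 \<in> forms 1" "b3 \<in> forms 1"
    "n1 = l2 * b3 - l3 * b2" "n2 = l3 * b1 - l1 * b3" "n3 = l1 * b2 - l2 * b1"
proof -
  have l1: "l1 \<noteq> 0" using ind[of 1 0 0] by auto
  obtain j where j: "grad l1 j \<noteq> 0" using grad_nonzero l l1 by blast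
  obtain c2 l2' where l2': "l2 = scal c2 l1 + l2'" "l2' \<in> forms 1" "pdiff j l2' = 0"
    using divide_linear[OF j l(2) l(1)] by metis
  obtain c3 l3' where l3': "l3 = scal c3 l1 + l3'" "l3' \<in> forms 1" "pdiff j l3' = 0"
    using divide_linear[OF j l(3) l(1)] by metis
  obtain g2 n2' where n2': "n2 = l1 * g2 + n2'" "g2 \<in> forms 1" "n2' \<in> forms 2" "pdiff j n2' = 0"
    using divide_quadric[OF j l(1) n(2)] by metis
  obtain g3 n3' where n3': "n3 = l1 * g3 + n3'" "g3 \<in> forms 1" "n3' \<in> forms 2" "pdiff j n3' = 0"
    using divide_quadric[OF j l(1) n(3)] by metis
  define r where "r = - (n1 + scal c2 n2 + l2' * g2 + scal c3 n3 + l3' * g3)"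
  have r: "r \<in> forms 2"
    unfolding r_def by (intro forms_uminus forms_add forms_scal n forms_mult_11 l2' l3' n2' n3')
  have eq: "l2' * n2' + l3' * n3' = l1 * r"
  proof -
    have "l2' * n2' + l3' * n3' = l2 * n2 + l3 * n3 - scal c2 l1 * n2 - l2' * (l1 * g2)
        - scal c3 l1 * n3 - l3' * (l1 * g3)"
      unfolding l2'(1) l3'(1) n2'(1) n3'(1) by (simp add: algebra_simps)
    moreover have "l2 * n2 + l3 * n3 = - (l1 * n1)" using rel by (simp add: add_eq_0_iff2 add.assoc)
    ultimately show ?thesis unfolding r_def by (simp add: algebra_simps scal_mult_left scal_mult_right)
  qed
  have "pdiff j (l2' * n2' + l3' * n3') = 0"
    using l2' l3' n2' n3' by (simp add: pdiff_add pdiff_linear_mult grad_def)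
  then have "r = 0" using multiple_eq_0[OF l(1) j r] eq by simp
  then have rel': "l2' * n2' + l3' * n3' = 0" using eq by simp
  have "l2' \<noteq> 0" using ind[of "- c2" 1 0] l2'(1) by (auto simp: mpoly.scale_minus_left)
  moreover have "l3' \<noteq> scal c l2'" for c
  proof
    assume "l3' = scal c l2'"
    then have "scal (c * c2 - c3) l1 + scal (- c) l2 + scal 1 l3 = 0"
      unfolding l2'(1) l3'(1)
      by (simp add: mpoly.scale_left_diff_distrib mpoly.scale_right_distrib mpoly.scale_minus_left)
    then show False using ind by fastforce
  qed
  ultimately obtain a where a: "a \<in> forms 1" "n2' = l3' * a" "n3' = - (l2' * a)"
    using koszul_two_linear_forms[OF l2'(2) l3'(2) n2'(3) n3'(3) _ _ rel'] by metis
  define d where "d = g2 - scal c3 a"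
  define e where "e = g3 + scal c2 a"
  have de: "d \<in> forms 1" "e \<in> forms 1" unfolding d_def e_def by (intro forms_diff forms_add forms_scal n2' n3' a)+
  have 2: "n2 = l3 * a - l1 * (- d)"
    unfolding n2'(1) a d_def l3'(1) by (simp add: algebra_simps scal_mult_left scal_mult_right)
  have 3: "n3 = l1 * e - l2 * a"
    unfolding n3'(1) a e_def l2'(1) by (simp add: algebra_simps scal_mult_left scal_mult_right)
  have "l1 * (n1 - (l2 * (- d) - l3 * e)) = l1 * n1 + l2 * n2 + l3 * n3"
    unfolding 2 3 by (simp add: algebra_simps)
  then have "n1 = l2 * (- d) - l3 * e" using rel l1 by simp
  with 2 3 a de that[of a e "- d"] show ?thesis by (simp add: forms_uminus)
qed

definition independent3 :: "4 mpoly \<Rightarrow> 4 mpoly \<Rightarrow> 4 mpoly \<Rightarrow> bool"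
  where "independent3 p q r \<longleftrightarrow> (\<forall>a b c. scal a p + scal b q + scal c r = 0 \<longrightarrow> a = 0 \<and> b = 0 \<and> c = 0)"

text \<open>
  The net spanned by \<open>n1, n2, n3\<close> consists of the maximal minors of the \<open>3 \<times> 2\<close> matrix with columns
  \<open>k\<close> and \<open>b\<close>.
\<close>

definition contains_cross_net :: "4 mpoly set \<Rightarrow> bool"
  where "contains_cross_net N \<longleftrightarrow> (\<exists>n1\<in>N. \<exists>n2\<in>N. \<exists>n3\<in>N. independent3 n1 n2 n3 \<and>
    (\<exists>k1\<in>forms 1. \<exists>k2\<in>forms 1. \<exists>k3\<in>forms 1. \<exists>b1\<in>forms 1. \<exists>b2\<in>forms 1. \<exists>b3\<in>forms 1.
      n1 = k2 * b3 - k3 * b2 \<and> n2 = k3 * b1 - k1 * b3 \<and> n3 = k1 * b2 - k2 * b1))"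

lemma contains_cross_netI:
  assumes "n1 \<in> N" "n2 \<in> N" "n3 \<in> N" "independent3 n1 n2 n3"
    "k1 \<in> forms 1" "k2 \<in> forms 1" "k3 \<in> forms 1" "b1 \<in> forms 1" "b2 \<in> forms 1" "b3 \<in> forms 1"
    "n1 = k2 * b3 - k3 * b2" "n2 = k3 * b1 - k1 * b3" "n3 = k1 * b2 - k2 * b1"
  shows "contains_cross_net N"
  using assms unfolding contains_cross_net_def by blast

text \<open>
  After a change of basis of the net, the first syzygy involves only two quadrics \<open>m1, m2\<close>, so these
  are \<open>k2 * a\<close> and \<open>- (k1 * a)\<close>. In the second syzygy the form \<open>a\<close> divides the product of \<open>n3\<close> with its
  coefficient. Either \<open>a\<close> divides \<open>n3\<close>, and then it is a common factor of the net, or the coefficient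
  is a multiple of \<open>a\<close>, and then the second syzygy expresses \<open>n3\<close> as a minor.
\<close>

lemma hilbert_burch_dependent:
  fixes n1 :: "4 mpoly"
  assumes N: "mpoly.subspace N" "n1 \<in> N" "n2 \<in> N" "n3 \<in> N"
    and n: "n1 \<in> forms 2" "n2 \<in> forms 2" "n3 \<in> forms 2" and ind: "independent3 n1 n2 n3"
    and k: "k1 \<in> forms 1" "k2 \<in> forms 1" "k3 \<in> forms 1" and rel: "k1 * n1 + k2 * n2 + k3 * n3 = 0"
    and k': "k1' \<in> forms 1" "k2' \<in> forms 1" "k3' \<in> forms 1" and rel': "k1' * n1 + k2' * n2 + k3' * n3 = 0"
    and kk': "\<And>x y. scal x k1 + scal y k1' = 0 \<Longrightarrow> scal x k2 + scal y k2' = 0 \<Longrightarrow>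
      scal x k3 + scal y k3' = 0 \<Longrightarrow> x = 0 \<and> y = 0"
    and no: "\<And>a c1 c2 c3. a \<in> forms 1 \<Longrightarrow> c1 \<in> forms 1 \<Longrightarrow> c2 \<in> forms 1 \<Longrightarrow> c3 \<in> forms 1 \<Longrightarrow>
      n1 = a * c1 \<Longrightarrow> n2 = a * c2 \<Longrightarrow> n3 = a * c3 \<Longrightarrow> False"
    and k3: "k3 = scal s k1 + scal t k2"
  shows "contains_cross_net N"
proof -
  note scal_mult = scal_mult_left scal_mult_right
  define m1 where "m1 = n1 + scal s n3"
  define m2 where "m2 = n2 + scal t n3"
  have m: "m1 \<in> forms 2" "m2 \<in> forms 2" unfolding m1_def m2_def by (intro forms_add forms_scal n)+
  have mN: "m1 \<in> N" "m2 \<in> N"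
    unfolding m1_def m2_def by (intro mpoly.subspace_add[OF N(1)] mpoly.subspace_scale[OF N(1)] N(2-4))+
  have "k1 * m1 + k2 * m2 = k1 * n1 + k2 * n2 + k3 * n3"
    unfolding m1_def m2_def k3 by (simp add: algebra_simps scal_mult)
  then have relm: "k1 * m1 + k2 * m2 = 0" using rel by simp
  have indm: "x = 0 \<and> y = 0 \<and> z = 0" if "scal x m1 + scal y m2 + scal z n3 = 0" for x y z
  proof -
    have "scal x n1 + scal y n2 + scal (x * s + y * t + z) n3 = scal x m1 + scal y m2 + scal z n3"
      unfolding m1_def m2_def
      by (simp add: mpoly.scale_left_distrib mpoly.scale_right_distrib algebra_simps)
    then have "x = 0 \<and> y = 0 \<and> x * s + y * t + z = 0" using ind that unfolding independent3_def by metis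
    then show ?thesis by auto
  qed
  have k1: "k1 \<noteq> 0"
  proof
    assume 0: "k1 = 0"
    then have "k2 * m2 = 0" using relm by simp
    moreover have "m2 \<noteq> 0" using indm[of 0 1 0] by auto
    ultimately have "k2 = 0" by simp
    then show False using kk'[of 1 0] 0 k3 by simp
  qed
  have k2: "k2 \<noteq> scal c k1" for c
  proof
    assume c: "k2 = scal c k1"
    have "k1 * (m1 + scal c m2) = k1 * m1 + k2 * m2" unfolding c by (simp add: distrib_left scal_mult)
    then have "m1 + scal c m2 = 0" using relm k1 by simp
    then show False using indm[of 1 c 0] by simp
  qed
  obtain a where a: "a \<in> forms 1" "m1 = k2 * a" "m2 = - (k1 * a)"
    by (rule koszul_two_linear_forms[OF k(1,2) m k1 k2 relm])
  have a0: "a \<noteq> 0" using indm[of 1 0 0] a(2) by auto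
  define a3 where "a3 = k3' - scal s k1' - scal t k2'"
  have a3: "a3 \<in> forms 1" unfolding a3_def by (intro forms_diff forms_scal k')
  define h where "h = k1 * k2' - k2 * k1'"
  have h: "h \<in> forms 2" unfolding h_def by (intro forms_diff forms_mult_11 k k')
  have "k1' * m1 + k2' * m2 + a3 * n3 = k1' * n1 + k2' * n2 + k3' * n3"
    unfolding m1_def m2_def a3_def by (simp add: algebra_simps scal_mult)
  then have "k1' * (k2 * a) + k2' * (- (k1 * a)) + a3 * n3 = 0" using rel' a(2,3) by simp
  then have an: "a3 * n3 = a * h" unfolding h_def by (simp add: algebra_simps)
  consider c where "a3 = scal c a" | g where "g \<in> forms 1" "n3 = a * g"
    using linear_form_prime_quadric[OF a(1) a0 a3 n(3) h an] by blast
  then show ?thesis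
  proof cases
    case (1 c)
    have "a * (scal c n3 - h) = a3 * n3 - a * h" unfolding 1 by (simp add: right_diff_distrib scal_mult)
    then have ch: "scal c n3 = h" using an a0 by simp
    show ?thesis
    proof (cases "c = 0")
      case True
      have "k2 * k1' = k1 * k2'" using ch True unfolding h_def by simp
      then obtain d where d: "k1' = scal d k1"
        using linear_form_prime_linear[OF k(1) k1 k(2) k'(1,2)] k2 by blast
      have "k1 * (k2' - scal d k2) = 0"
        using \<open>k2 * k1' = k1 * k2'\<close> unfolding d by (simp add: right_diff_distrib scal_mult mult.commute)
      then have d2: "k2' = scal d k2" using k1 by simp
      have "a3 = 0" using 1 True by simp
      then have d3: "k3' = scal d k3"
        unfolding a3_def k3 d d2 by (simp add: mpoly.scale_right_distrib algebra_simps)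
      show ?thesis
        using kk'[of "- d" 1] by (simp add: d d2 d3 mpoly.scale_minus_left)
    next
      case False
      show ?thesis
      proof (rule contains_cross_netI[OF mN N(4) _ k(1,2) forms_0, of "scal (1 / c) k1'" "scal (1 / c) k2'" a])
        show "independent3 m1 m2 n3" using indm unfolding independent3_def by blast
        have "n3 = scal (1 / c) h" unfolding ch[symmetric] using False by simp
        then show "n3 = k1 * scal (1 / c) k2' - k2 * scal (1 / c) k1'"
          by (simp add: h_def scal_mult mpoly.scale_right_diff_distrib)
      qed (simp_all add: a forms_scal k')
    qed
  next
    case (2 g)
    have e1: "n1 = a * (k2 - scal s g)"
    proof -
      have "n1 = m1 - scal s n3" by (simp add: m1_def)
      then show ?thesis unfolding a 2 by (simp add: algebra_simps scal_mult)
    qed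
    have e2: "n2 = a * (- k1 - scal t g)"
    proof -
      have "n2 = m2 - scal t n3" by (simp add: m2_def)
      then show ?thesis unfolding a 2 by (simp add: algebra_simps scal_mult)
    qed
    have f: "k2 - scal s g \<in> forms 1" "- k1 - scal t g \<in> forms 1"
      using k 2(1) by (simp_all add: forms_diff forms_scal forms_uminus)
    show ?thesis using no[OF a(1) f 2(1) e1 e2 2(2)] by blast
  qed
qed

lemma independent3_rotate: "independent3 p q r \<Longrightarrow> independent3 q r p"
  unfolding independent3_def
proof (intro allI impI)
  fix a b c
  assume 0: "\<forall>a b c. scal a p + scal b q + scal c r = 0 \<longrightarrow> a = 0 \<and> b = 0 \<and> c = 0"
    and "scal a q + scal b r + scal c p = 0"
  then have "scal c p + scal a q + scal b r = 0" by (simp only: ac_simps)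
  then show "a = 0 \<and> b = 0 \<and> c = 0" using 0 by blast
qed

text \<open>
  If the coefficients of the first syzygy are independent, exactness of the Koszul complex gives the
  second column directly. Otherwise one coefficient depends on the other two.
\<close>

lemma hilbert_burch:
  fixes n1 :: "4 mpoly"
  assumes N: "mpoly.subspace N" "n1 \<in> N" "n2 \<in> N" "n3 \<in> N"
    and n: "n1 \<in> forms 2" "n2 \<in> forms 2" "n3 \<in> forms 2" and ind: "independent3 n1 n2 n3"
    and k: "k1 \<in> forms 1" "k2 \<in> forms 1" "k3 \<in> forms 1" and rel: "k1 * n1 + k2 * n2 + k3 * n3 = 0"
    and k': "k1' \<in> forms 1" "k2' \<in> forms 1" "k3' \<in> forms 1" and rel': "k1' * n1 + k2' * n2 + k3' * n3 = 0"
    and kk': "\<And>x y. scal x k1 + scal y k1' = 0 \<Longrightarrow> scal x k2 + scal y k2' = 0 \<Longrightarrow>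
      scal x k3 + scal y k3' = 0 \<Longrightarrow> x = 0 \<and> y = 0"
    and no: "\<And>a c1 c2 c3. a \<in> forms 1 \<Longrightarrow> c1 \<in> forms 1 \<Longrightarrow> c2 \<in> forms 1 \<Longrightarrow> c3 \<in> forms 1 \<Longrightarrow>
      n1 = a * c1 \<Longrightarrow> n2 = a * c2 \<Longrightarrow> n3 = a * c3 \<Longrightarrow> False"
  shows "contains_cross_net N"
proof (cases "independent3 k1 k2 k3")
  case True
  then show ?thesis
    using koszul_three_linear_forms[OF k n _ rel] contains_cross_netI[OF N(2-4) ind k]
    unfolding independent3_def by metis
next
  case False
  have solve: "r = scal (- x / z) p + scal (- y / z) q"
    if "scal x p + scal y q + scal z r = 0" "z \<noteq> 0" for x y z and p q r :: "4 mpoly"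
  proof -
    have "scal z r = - (scal x p + scal y q)" using that(1) by (simp add: add_eq_0_iff2 add.commute)
    then have "scal (1 / z) (scal z r) = scal (1 / z) (- (scal x p + scal y q))" by simp
    then show ?thesis using that(2)
      by (simp add: mpoly.scale_right_distrib mpoly.scale_minus_left mpoly.scale_right_diff_distrib)
  qed
  obtain x y z where xyz: "scal x k1 + scal y k2 + scal z k3 = 0" "x \<noteq> 0 \<or> y \<noteq> 0 \<or> z \<noteq> 0"
    using False unfolding independent3_def by blast
  have r1: "k2 * n2 + k3 * n3 + k1 * n1 = 0" "k2' * n2 + k3' * n3 + k1' * n1 = 0"
    and r2: "k3 * n3 + k1 * n1 + k2 * n2 = 0" "k3' * n3 + k1' * n1 + k2' * n2 = 0"
    using rel rel' by (simp_all add: ac_simps)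
  from xyz(2) consider "z \<noteq> 0" | "x \<noteq> 0" | "y \<noteq> 0" by blast
  then show ?thesis
  proof cases
    case 1
    show ?thesis
      by (rule hilbert_burch_dependent[OF N n ind k rel k' rel' kk' no solve[OF xyz(1) 1]])
  next
    case 2
    have "scal y k2 + scal z k3 + scal x k1 = 0" using xyz(1) by (simp add: ac_simps)
    note s = solve[OF this 2]
    show ?thesis
      by (rule hilbert_burch_dependent[OF N(1,3,4,2) n(2,3,1) independent3_rotate[OF ind]
            k(2,3,1) r1(1) k'(2,3,1) r1(2) _ _ s]) (use kk' no in blast)+
  next
    case 3
    have "scal z k3 + scal x k1 + scal y k2 = 0" using xyz(1) by (simp add: ac_simps)
    note s = solve[OF this 3]
    show ?thesis
      by (rule hilbert_burch_dependent[OF N(1,4,2,3) n(3,1,2)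
            independent3_rotate[OF independent3_rotate[OF ind]]
            k(3,1,2) r2(1) k'(3,1,2) r2(2) _ _ s]) (use kk' no in blast)+
  qed
qed

section \<open>Separation by ranks\<close>

lemma betti_forms_nonzero: "betti_forms b12 b23 b34 \<subseteq> forms 4 - {0}"
  using nondegenerate_nonzero by (auto simp: betti_forms_def)

lemma diff_action_coefficient_linear:
  "Vector_Spaces.linear scal (*) (\<lambda>F. lookup (diff_action q F) m)"
  "Vector_Spaces.linear scal (*) (\<lambda>q. lookup (diff_action q F) m)"
  by (simp_all add: Vector_Spaces.linear_iff mpoly.vector_space_axioms complex_vector_space
      diff_action_add_right diff_action_scal_right diff_action_add diff_action_scal lookup_add)

text \<open>
  Take the catalecticant map on the quadrics whose entries in \<open>J\<close> vanish. No such quadric is apolar to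
  \<open>F0\<close>, but some non-zero one is apolar to \<open>F\<close> in \<open>W\<close>, as \<open>J\<close> imposes too few conditions.
\<close>

lemma quadrics_separate:
  assumes F0: "F0 \<in> forms 4" and J: "finite J"
    and sep: "\<And>g. apolar_matrix F0 g \<Longrightarrow> \<forall>(i, j)\<in>J. g i j = 0 \<Longrightarrow> g = 0"
    and W: "W \<subseteq> forms 4 - {0}" and dim: "\<And>F. F \<in> W \<Longrightarrow> card J < chain.dim (linear_strand 0 (apolar F))"
  shows "point F0 \<notin> zariski_closure (point ` W)"
proof -
  define U :: "4 mpoly set" where "U = {q \<in> forms 2. \<forall>x\<in>J. hess q (fst x) (snd x) = 0}"
  have hl: "Vector_Spaces.linear scal (*) (\<lambda>q. hess q i j)" for i j :: 4
    by (simp add: Vector_Spaces.linear_iff mpoly.vector_space_axioms complex_vector_space hess_simps)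
  have U: "mpoly.subspace U"
    by (rule mpoly.subspaceI) (auto simp: U_def forms_0 forms_add forms_scal hess_simps)
  obtain B where B: "finite B" "mpoly.span B = U"
  proof (rule mpoly.span_of_separating_functionals[OF U finite_class.finite_UNIV,
        of "\<lambda>x q. hess q (fst x) (snd x)"])
    show "\<forall>x\<in>UNIV. Vector_Spaces.linear scal (*) (\<lambda>q. hess q (fst x) (snd x))"
      using hl by blast
    show "\<forall>q\<in>U. (\<forall>x\<in>UNIV. hess q (fst x) (snd x) = 0) \<longrightarrow> q = 0"
      using form_2_eq_0 by (auto simp: U_def)
  qed
  show ?thesis
  proof (rule not_in_zariski_closure[OF mpoly.vector_space_axioms B diff_action_coefficient_linear])
    show "q = 0" if q: "q \<in> U" "\<And>m. lookup (diff_action q F0) m = 0" for q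
    proof -
      have q2: "q \<in> forms 2" using q(1) by (simp add: U_def)
      have "diff_action q F0 = 0" by (rule poly_mapping_eqI) (simp add: q(2))
      then have "apolar_matrix F0 (hess q)" using apolar_matrix_hess[OF F0 q2] by (simp add: apolar_def)
      then have "hess q = 0" using q(1) by (intro sep) (auto simp: U_def)
      then show ?thesis using form_2_eq_0[OF q2] by simp
    qed
  next
    show "W \<subseteq> forms 4 - {0}" by (rule W)
  next
    fix F assume F: "F \<in> W"
    let ?f = "\<lambda>(i, j) y. hess (y {}) i j"
    have "\<not> (\<forall>y\<in>linear_strand 0 (apolar F). (\<forall>x\<in>J. ?f x y = 0) \<longrightarrow> y = 0)"
    proof
      assume "\<forall>y\<in>linear_strand 0 (apolar F). (\<forall>x\<in>J. ?f x y = 0) \<longrightarrow> y = 0"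
      moreover have "\<forall>x\<in>J. Vector_Spaces.linear chain_scal (*) (?f x)" by (auto simp: hess_functional)
      ultimately have "chain.dim (linear_strand 0 (apolar F)) \<le> card J"
        by (intro chain.dim_le_card_functionals[OF linear_strand_subspace[OF apolar_subspace] J])
      then show False using dim[OF F] by simp
    qed
    then obtain y where y: "y \<in> linear_strand 0 (apolar F)" "\<forall>x\<in>J. ?f x y = 0" "y \<noteq> 0" by blast
    have "y {} \<in> U" using y(2) linear_strandD(1)[OF y(1)] by (auto simp: U_def)
    moreover have "y {} \<noteq> 0" using strand_0_eqI[OF y(1)] y(3) by blast
    moreover have "diff_action (y {}) F = 0" using linear_strandD(3)[OF y(1)] by (simp add: apolar_def)
    ultimately show "\<exists>q\<in>U. q \<noteq> 0 \<and> (\<forall>m. lookup (diff_action q F) m = 0)" by auto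
  qed
qed

text \<open>
  The second syzygies for \<open>I = S\<close> form a fixed space, and those of \<open>F\<^sup>\<bottom>\<close> are the ones whose values are
  annihilated by \<open>F\<close>, a condition linear in \<open>F\<close>.
\<close>

lemma second_syzygies_separate:
  assumes F0: "F0 \<in> forms 4" and sep: "\<And>t. second_syzygy F0 t \<Longrightarrow> t = 0"
    and W: "W \<subseteq> forms 4 - {0}" and dim: "\<And>F. F \<in> W \<Longrightarrow> 0 < chain.dim (linear_strand 2 (apolar F))"
  shows "point F0 \<notin> zariski_closure (point ` W)"
proof -
  obtain B where B: "finite B" "chain.span B = linear_strand 2 UNIV"
    using linear_strand_span[OF mpoly.subspace_UNIV] by blast
  define L where "L F y = (\<lambda>x. lookup (diff_action (y (fst x)) F) (snd x))" for F and y :: chain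
  have L0: "y \<in> linear_strand 2 (apolar F) \<longleftrightarrow> (\<forall>x. L F y x = 0)" if "y \<in> linear_strand 2 UNIV" for y F
  proof -
    have "(\<forall>x. L F y x = 0) \<longleftrightarrow> (\<forall>T. diff_action (y T) F = 0)"
      by (auto simp: L_def poly_mapping_eq_iff fun_eq_iff)
    then show ?thesis using that by (auto simp: linear_strand_def apolar_def)
  qed
  show ?thesis
  proof (rule not_in_zariski_closure[OF chain.vector_space_axioms B, where L = L])
    show "Vector_Spaces.linear scal (*) (\<lambda>F. L F y x)" for y x
      unfolding L_def by (rule diff_action_coefficient_linear)
    show "Vector_Spaces.linear chain_scal (*) (\<lambda>y. L F y x)" for F x
      by (simp add: L_def Vector_Spaces.linear_iff chain.vector_space_axioms complex_vector_space
          diff_action_add diff_action_scal lookup_add chain_scal_apply)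
    show "y = 0" if y: "y \<in> linear_strand 2 UNIV" "\<And>x. L F0 y x = 0" for y
    proof -
      have y': "y \<in> linear_strand 2 (apolar F0)" using L0[OF y(1)] y(2) by blast
      have "(\<lambda>k m. hess (contract k y {m})) = 0" by (rule sep[OF second_syzygy_strand[OF F0 y']])
      then have "hess (contract k y {m}) i j = 0" for k m i j by (simp add: fun_eq_iff)
      then have "contract k y {m} = 0" for k m using form_2_eq_0[OF contract_strand_2(1)[OF y']] by blast
      then show "y = 0" by (rule strand_2_eqI[OF y'])
    qed
  next
    show "W \<subseteq> forms 4 - {0}" by (rule W)
  next
    fix F assume F: "F \<in> W"
    have "\<not> linear_strand 2 (apolar F) \<subseteq> chain.span {}"
      using chain.dim_le_card[of "linear_strand 2 (apolar F)" "{}"] dim[OF F] by auto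
    then obtain y where y: "y \<in> linear_strand 2 (apolar F)" "y \<noteq> 0" by auto
    moreover have "y \<in> linear_strand 2 UNIV" using y(1) by (auto simp: linear_strand_def)
    ultimately show "\<exists>y\<in>linear_strand 2 UNIV. y \<noteq> 0 \<and> (\<forall>x. L F y x = 0)" using L0 by blast
  qed
qed

section \<open>Determinantal nets\<close>

lemma linear_syzygy_coordinates:
  assumes n: "\<And>q. q \<in> N \<Longrightarrow> \<exists>a b c. q = scal a n1 + scal b n2 + scal c n3"
    and y: "\<And>m. y {m} \<in> N" "(\<Sum>m\<in>UNIV. X m * y {m}) = 0"
  obtains k1 k2 k3 where "k1 \<in> forms 1" "k2 \<in> forms 1" "k3 \<in> forms 1" "k1 * n1 + k2 * n2 + k3 * n3 = 0"
    "\<And>m. y {m} = scal (grad k1 m) n1 + scal (grad k2 m) n2 + scal (grad k3 m) n3"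
proof -
  obtain a b c where abc: "\<And>m. y {m} = scal (a m) n1 + scal (b m) n2 + scal (c m) n3"
    using n[OF y(1)] by metis
  define L where "L u = (\<Sum>m\<in>UNIV. scal (u m) (X m))" for u :: "4 \<Rightarrow> complex"
  have L: "L u \<in> forms 1" for u unfolding L_def by (intro forms_sum forms_scal X_forms)
  have grad_L: "grad (L u) m = u m" for u m by (simp add: L_def grad_simps grad_X if_distrib cong: if_cong)
  have "L a * n1 + L b * n2 + L c * n3 = (\<Sum>m\<in>UNIV. X m * y {m})"
    unfolding L_def sum_distrib_right sum.distrib[symmetric] abc
    by (intro sum.cong refl) (simp add: distrib_left scal_mult_left scal_mult_right)
  then show ?thesis using that[OF L L L, of a b c] y(2) abc grad_L by simp
qed

text \<open>
  A common linear factor \<open>a\<close> of the net would leave three linear forms, whose Koszul relations are three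
  independent syzygies of the net; but there are only two.
\<close>

lemma contains_cross_net_of_betti_320:
  assumes "F \<in> betti_forms 3 2 0"
  shows "contains_cross_net (apolar F \<inter> forms 2)"
proof -
  let ?I = "apolar F" and ?N = "apolar F \<inter> forms 2"
  have F: "F \<in> forms 4" and dim: "chain.dim (linear_strand 0 ?I) = 3" "chain.dim (linear_strand 1 ?I) = 2"
    using assms unfolding betti_forms_iff by auto
  have N: "mpoly.subspace ?N" by (intro mpoly.subspace_inter apolar_subspace subspace_forms)
  note S = linear_strand_subspace[OF apolar_subspace, of _ F]
  obtain y1 y2 y3 where y: "y1 \<in> linear_strand 0 ?I" "y2 \<in> linear_strand 0 ?I" "y3 \<in> linear_strand 0 ?I"
    and indy: "\<And>a b c. chain_scal a y1 + chain_scal b y2 + chain_scal c y3 = 0 \<Longrightarrow> a = 0 \<and> b = 0 \<and> c = 0"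
    and spy: "\<And>x. x \<in> linear_strand 0 ?I \<Longrightarrow> \<exists>a b c. x = chain_scal a y1 + chain_scal b y2 + chain_scal c y3"
    by (rule chain.basis_of_dim_3[OF S dim(1)], rule that; blast)
  define n1 where "n1 = y1 {}"
  define n2 where "n2 = y2 {}"
  define n3 where "n3 = y3 {}"
  note n_def = n1_def n2_def n3_def
  have nN: "n1 \<in> ?N" "n2 \<in> ?N" "n3 \<in> ?N"
    unfolding n_def using linear_strandD(1,3)[OF y(1)] linear_strandD(1,3)[OF y(2)] linear_strandD(1,3)[OF y(3)]
    by blast+
  then have nf: "n1 \<in> forms 2" "n2 \<in> forms 2" "n3 \<in> forms 2" by blast+
  have ind: "independent3 n1 n2 n3"
    unfolding independent3_def
  proof (intro allI impI)
    fix a b c assume 0: "scal a n1 + scal b n2 + scal c n3 = 0"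
    let ?y = "chain_scal a y1 + chain_scal b y2 + chain_scal c y3"
    have "?y \<in> linear_strand 0 ?I" using y by (intro chain.subspace_add[OF S] chain.subspace_scale[OF S])
    moreover have "?y {} = 0" using 0 by (simp add: chain_scal_apply n_def)
    ultimately have "?y = 0" by (rule strand_0_eqI)
    then show "a = 0 \<and> b = 0 \<and> c = 0" by (rule indy)
  qed
  have span: "\<exists>a b c. q = scal a n1 + scal b n2 + scal c n3" if "q \<in> ?N" for q
  proof -
    have "chain0 q \<in> linear_strand 0 ?I" using that by (intro chain0_strand zero_apolar) auto
    then obtain a b c where "chain0 q = chain_scal a y1 + chain_scal b y2 + chain_scal c y3" using spy by blast
    from fun_cong[OF this, of "{}"] show ?thesis by (auto simp: chain0_def chain_scal_apply n_def)
  qed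
  obtain z z' where z: "z \<in> linear_strand 1 ?I" "z' \<in> linear_strand 1 ?I"
    and indz: "\<And>a b. chain_scal a z + chain_scal b z' = 0 \<Longrightarrow> a = 0 \<and> b = 0"
    and spz: "\<And>x. x \<in> linear_strand 1 ?I \<Longrightarrow> \<exists>a b. x = chain_scal a z + chain_scal b z'"
    by (rule chain.basis_of_dim_2[OF S dim(2)], rule that; blast)
  have zN: "x {m} \<in> ?N" "(\<Sum>m\<in>UNIV. X m * x {m}) = 0" if "x \<in> linear_strand 1 ?I" for x m
    using linear_strandD[OF that] koszul_kchains_1[of x] by blast+
  obtain k1 k2 k3 where k: "k1 \<in> forms 1" "k2 \<in> forms 1" "k3 \<in> forms 1"
    and rel: "k1 * n1 + k2 * n2 + k3 * n3 = 0"
    and zk: "\<And>m. z {m} = scal (grad k1 m) n1 + scal (grad k2 m) n2 + scal (grad k3 m) n3"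
    by (rule linear_syzygy_coordinates[OF span zN[OF z(1)]], assumption, rule that; blast)
  obtain k1' k2' k3' where k': "k1' \<in> forms 1" "k2' \<in> forms 1" "k3' \<in> forms 1"
    and rel': "k1' * n1 + k2' * n2 + k3' * n3 = 0"
    and zk': "\<And>m. z' {m} = scal (grad k1' m) n1 + scal (grad k2' m) n2 + scal (grad k3' m) n3"
    by (rule linear_syzygy_coordinates[OF span zN[OF z(2)]], assumption, rule that; blast)
  show ?thesis
  proof (rule hilbert_burch[OF N nN nf ind k rel k' rel'])
    fix a b
    assume 0: "scal a k1 + scal b k1' = 0" "scal a k2 + scal b k2' = 0" "scal a k3 + scal b k3' = 0"
    have g: "a * grad p m + b * grad q m = 0" if "scal a p + scal b q = 0" for p q m
    proof -
      have "grad (scal a p + scal b q) m = 0" unfolding that by (rule grad_simps)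
      then show ?thesis by (simp add: grad_simps)
    qed
    let ?x = "chain_scal a z + chain_scal b z'"
    have "?x \<in> linear_strand 1 ?I" using z by (intro chain.subspace_add[OF S] chain.subspace_scale[OF S])
    moreover have "?x {m} = 0" for m
    proof -
      have "?x {m} = scal (a * grad k1 m + b * grad k1' m) n1 + scal (a * grad k2 m + b * grad k2' m) n2
          + scal (a * grad k3 m + b * grad k3' m) n3"
        by (simp add: chain_scal_apply zk zk' mpoly.scale_left_distrib mpoly.scale_right_distrib)
      then show ?thesis using g[OF 0(1)] g[OF 0(2)] g[OF 0(3)] by simp
    qed
    ultimately have "?x = 0" by (rule strand_1_eqI)
    then show "a = 0 \<and> b = 0" by (rule indz)
  next
    fix a c1 c2 c3
    assume c: "a \<in> forms 1" "c1 \<in> forms 1" "c2 \<in> forms 1" "c3 \<in> forms 1"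
      and ac: "n1 = a * c1" "n2 = a * c2" "n3 = a * c3"
    define v where "v p q p' q' = chain1 (\<lambda>m. scal (grad p m) q' - scal (grad q m) p')" for p q p' q'
    have vs: "v p q p' q' \<in> chain.span {z, z'}"
      if p: "p \<in> forms 1" "q \<in> forms 1" "p' \<in> ?N" "q' \<in> ?N" "p' = a * p" "q' = a * q" for p q p' q'
    proof -
      have "scal (grad p m) q' - scal (grad q m) p' \<in> ?N" for m
        using p(3,4) by (intro mpoly.subspace_diff[OF N] mpoly.subspace_scale[OF N])
      moreover have "(\<Sum>m\<in>UNIV. X m * (scal (grad p m) q' - scal (grad q m) p')) = 0"
      proof -
        have "(\<Sum>m\<in>UNIV. X m * (scal (grad p m) q' - scal (grad q m) p'))
          = (\<Sum>m\<in>UNIV. scal (grad p m) (X m)) * q' - (\<Sum>m\<in>UNIV. scal (grad q m) (X m)) * p'"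
          by (simp add: sum_distrib_right sum_subtractf right_diff_distrib scal_mult_left scal_mult_right)
        also have "\<dots> = p * q' - q * p'"
          using linear_form_expand[OF p(1)] linear_form_expand[OF p(2)] by simp
        also have "\<dots> = 0" unfolding p(5,6) by (simp add: algebra_simps)
        finally show ?thesis .
      qed
      ultimately have "v p q p' q' \<in> linear_strand 1 ?I"
        unfolding v_def by (intro chain1_strand zero_apolar) auto
      then obtain x y where "v p q p' q' = chain_scal x z + chain_scal y z'" using spz by blast
      moreover have "chain_scal x z + chain_scal y z' \<in> chain.span {z, z'}"
        by (rule chain.span_add[OF chain.span_scale[OF chain.span_base] chain.span_scale[OF chain.span_base]]) simp_all
      ultimately show ?thesis by simp
    qed
    obtain x y w where xyw: "chain_scal x (v c1 c2 n1 n2) + chain_scal y (v c1 c3 n1 n3) + chain_scal w (v c2 c3 n2 n3) = 0"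
      "x \<noteq> 0 \<or> y \<noteq> 0 \<or> w \<noteq> 0"
      by (rule chain.three_vectors_in_plane[OF vs[OF c(2,3) nN(1,2) ac(1,2)] vs[OF c(2,4) nN(1,3) ac(1,3)]
            vs[OF c(3,4) nN(2,3) ac(2,3)]])
    have "scal (- x * grad c2 m - y * grad c3 m) n1 + scal (x * grad c1 m - w * grad c3 m) n2
       + scal (y * grad c1 m + w * grad c2 m) n3 = 0" for m
    proof -
      have "scal (- x * grad c2 m - y * grad c3 m) n1 + scal (x * grad c1 m - w * grad c3 m) n2
          + scal (y * grad c1 m + w * grad c2 m) n3
        = (chain_scal x (v c1 c2 n1 n2) + chain_scal y (v c1 c3 n1 n3) + chain_scal w (v c2 c3 n2 n3)) {m}"
        by (simp add: chain_scal_apply v_def mpoly.scale_left_distrib mpoly.scale_right_distrib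
            mpoly.scale_left_diff_distrib mpoly.scale_right_diff_distrib mpoly.scale_minus_left)
      then show ?thesis unfolding xyw(1) by simp
    qed
    then have g: "x * grad c1 m - w * grad c3 m = 0" "y * grad c1 m + w * grad c2 m = 0" for m
      using ind unfolding independent3_def by blast+
    have 1: "scal x c1 - scal w c3 = 0"
    proof (rule form_1_eq_0)
      show "scal x c1 - scal w c3 \<in> forms 1" by (intro forms_diff forms_scal c)
      show "grad (scal x c1 - scal w c3) i = 0" for i unfolding grad_simps by (rule g(1))
    qed
    have "scal x n1 + scal 0 n2 + scal (- w) n3 = a * (scal x c1 - scal w c3)"
      unfolding ac(1,3) by (simp add: right_diff_distrib scal_mult_right mpoly.scale_minus_left)
    then have "scal x n1 + scal 0 n2 + scal (- w) n3 = 0" unfolding 1 by simp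
    then have "x = 0 \<and> (0 :: complex) = 0 \<and> - w = 0" using ind unfolding independent3_def by blast
    then have xw: "x = 0" "w = 0" by auto
    have 2: "scal y c1 + scal w c2 = 0"
    proof (rule form_1_eq_0)
      show "scal y c1 + scal w c2 \<in> forms 1" by (intro forms_add forms_scal c)
      show "grad (scal y c1 + scal w c2) i = 0" for i unfolding grad_simps by (rule g(2))
    qed
    have "scal y n1 + scal w n2 + scal 0 n3 = a * (scal y c1 + scal w c2)"
      unfolding ac(1,2) by (simp add: distrib_left scal_mult_right)
    then have "scal y n1 + scal w n2 + scal 0 n3 = 0" unfolding 2 by simp
    then have "y = 0" using ind unfolding independent3_def by blast
    then show False using xyw(2) xw by blast
  qed
qed

type_synonym index6 = "(4 \<times> 4 \<times> 4) \<times> (4 \<times> 4 \<times> 4)"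

text \<open>
  If \<open>k\<close> and \<open>b\<close> are linear syzygies of quadrics \<open>n\<close>, then \<open>K = \<Sum>\<^sub>p n\<^sub>p \<otimes> k\<^sub>p\<close> and \<open>B = \<Sum>\<^sub>p n\<^sub>p \<otimes> b\<^sub>p\<close> are
  tensors with three indices, the first two for a quadric and the third for a linear form. The
  tensors below are modelled on \<open>K \<otimes> B - B \<otimes> K\<close>: the first three conditions say that quadrics are
  symmetric, that the tensor is alternating and that its columns are syzygies. Symmetrising the
  two linear indices \<open>i, j\<close> turns them into a quadric as well, the minors \<open>k\<^sub>p b\<^sub>q - k\<^sub>q b\<^sub>p\<close>. If
  these are the entries of \<open>n\<close>, the result is the alternating tensor \<open>n\<^sub>1 \<and> n\<^sub>2 \<and> n\<^sub>3\<close>; the last condition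
  demands antisymmetry under exchange of the second and third quadric. It expresses the
  proportionality of \<open>n\<close> to the minors without mentioning \<open>n\<close>.
\<close>

definition pairing_tensors :: "(index6 \<Rightarrow> complex) set"
  where "pairing_tensors = {w.
    (\<forall>a a' i x. w ((a, a', i), x) = w ((a', a, i), x)) \<and>
    (\<forall>x y. w (x, y) = - w (y, x)) \<and>
    (\<forall>a a' i x. w ((a, a', i), x) + w ((a', i, a), x) + w ((i, a, a'), x) = 0) \<and>
    (\<forall>a a' i b b' j. w ((a, a', i), (b, b', j)) + w ((a, a', j), (b, b', i))
      + w ((a, a', b), (i, j, b')) + w ((a, a', b'), (i, j, b)) = 0)}"

definition pairing_contract :: "4 mpoly \<Rightarrow> (index6 \<Rightarrow> complex) \<Rightarrow> 4 \<times> (4 \<times> 4 \<times> 4) \<times> 4 \<times> 4 \<Rightarrow> complex"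
  where "pairing_contract F w = (\<lambda>(i, x, k, l).
    \<Sum>a\<in>UNIV. \<Sum>a'\<in>UNIV. w ((a, a', i), x) * hess (pdiff a (pdiff a' F)) k l)"

lemma pairing_contract_linear:
  "Vector_Spaces.linear scal (*) (\<lambda>F. pairing_contract F w z)"
  "Vector_Spaces.linear fun_scal (*) (\<lambda>w. pairing_contract F w z)"
  by (auto simp: pairing_contract_def Vector_Spaces.linear_iff mpoly.vector_space_axioms fun_scal_vector_space
      complex_vector_space pdiff_add pdiff_scal hess_simps distrib_left distrib_right sum.distrib
      sum_distrib_left fun_scal_def algebra_simps split: prod.splits)

lemma pairing_tensorsD:
  assumes "w \<in> pairing_tensors"
  shows "w ((a, a', i), x) = w ((a', a, i), x)" "w (x, y) = - w (y, x)"
    "w ((a, a', i), x) + w ((a', i, a), x) + w ((i, a, a'), x) = 0"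
    "w ((a, a', i), (b, b', j)) + w ((a, a', j), (b, b', i))
      + w ((a, a', b), (i, j, b')) + w ((a, a', b'), (i, j, b)) = 0"
  using assms unfolding pairing_tensors_def mem_Collect_eq by blast+

lemma pairing_tensorsI:
  assumes "\<And>a a' i x. w ((a, a', i), x) = w ((a', a, i), x)" "\<And>x y. w (x, y) = - w (y, x)"
    "\<And>a a' i x. w ((a, a', i), x) + w ((a', i, a), x) + w ((i, a, a'), x) = 0"
    "\<And>a a' i b b' j. w ((a, a', i), (b, b', j)) + w ((a, a', j), (b, b', i))
      + w ((a, a', b), (i, j, b')) + w ((a, a', b'), (i, j, b)) = 0"
  shows "w \<in> pairing_tensors"
  using assms unfolding pairing_tensors_def mem_Collect_eq by blast

lemma pairing_tensors_span:
  obtains B where "finite B" "Modules.module.span fun_scal B = pairing_tensors"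
proof -
  interpret V: vector_space "fun_scal :: complex \<Rightarrow> (index6 \<Rightarrow> complex) \<Rightarrow> index6 \<Rightarrow> complex"
    by (rule fun_scal_vector_space)
  have sub: "V.subspace pairing_tensors"
  proof (rule V.subspaceI)
    show "0 \<in> pairing_tensors" by (rule pairing_tensorsI) simp_all
  next
    fix u w assume u: "u \<in> pairing_tensors" and w: "w \<in> pairing_tensors"
    note D = pairing_tensorsD[OF u] pairing_tensorsD[OF w]
    show "u + w \<in> pairing_tensors"
    proof (rule pairing_tensorsI)
      show "(u + w) ((a, a', i), x) = (u + w) ((a', a, i), x)" for a a' i x
        by (simp only: plus_fun_apply D(1)[of a a' i x] D(5)[of a a' i x])
      show "(u + w) (x, y) = - (u + w) (y, x)" for x y
        by (simp only: plus_fun_apply D(2)[of x y] D(6)[of x y] minus_add_distrib)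
      show "(u + w) ((a, a', i), x) + (u + w) ((a', i, a), x) + (u + w) ((i, a, a'), x) = 0" for a a' i x
      proof -
        have "(u + w) ((a, a', i), x) + (u + w) ((a', i, a), x) + (u + w) ((i, a, a'), x) =
          (u ((a, a', i), x) + u ((a', i, a), x) + u ((i, a, a'), x)) + (w ((a, a', i), x) + w ((a', i, a), x) + w ((i, a, a'), x))"
          by (simp add: algebra_simps)
        then show ?thesis unfolding D(3)[of a a' i x] D(7)[of a a' i x] by simp
      qed
      show "(u + w) ((a, a', i), (b, b', j)) + (u + w) ((a, a', j), (b, b', i))
        + (u + w) ((a, a', b), (i, j, b')) + (u + w) ((a, a', b'), (i, j, b)) = 0" for a a' i b b' j
      proof -
        have "(u + w) ((a, a', i), (b, b', j)) + (u + w) ((a, a', j), (b, b', i))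
          + (u + w) ((a, a', b), (i, j, b')) + (u + w) ((a, a', b'), (i, j, b)) =
          (u ((a, a', i), (b, b', j)) + u ((a, a', j), (b, b', i)) + u ((a, a', b), (i, j, b')) + u ((a, a', b'), (i, j, b)))
          + (w ((a, a', i), (b, b', j)) + w ((a, a', j), (b, b', i)) + w ((a, a', b), (i, j, b')) + w ((a, a', b'), (i, j, b)))"
          by (simp add: algebra_simps)
        then show ?thesis unfolding D(4)[of a a' i b b' j] D(8)[of a a' i b b' j] by simp
      qed
    qed
  next
    fix c w assume w: "w \<in> pairing_tensors"
    note D = pairing_tensorsD[OF w]
    show "fun_scal c w \<in> pairing_tensors"
    proof (rule pairing_tensorsI)
      show "fun_scal c w ((a, a', i), x) = fun_scal c w ((a', a, i), x)" for a a' i x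
        using D(1)[of a a' i x] by (simp add: fun_scal_def)
      show "fun_scal c w (x, y) = - fun_scal c w (y, x)" for x y
        using D(2)[of x y] by (simp add: fun_scal_def)
      show "fun_scal c w ((a, a', i), x) + fun_scal c w ((a', i, a), x) + fun_scal c w ((i, a, a'), x) = 0" for a a' i x
        using D(3)[of a a' i x] unfolding fun_scal_def distrib_left[symmetric] by simp
      show "fun_scal c w ((a, a', i), (b, b', j)) + fun_scal c w ((a, a', j), (b, b', i))
        + fun_scal c w ((a, a', b), (i, j, b')) + fun_scal c w ((a, a', b'), (i, j, b)) = 0" for a a' i b b' j
        using D(4)[of a a' i b b' j] unfolding fun_scal_def distrib_left[symmetric] by simp
    qed
  qed
  show ?thesis
  proof (rule V.span_of_separating_functionals[OF sub finite_class.finite_UNIV, of "\<lambda>x w. w x"])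
    show "\<forall>x\<in>UNIV. Vector_Spaces.linear fun_scal (*) (\<lambda>w :: index6 \<Rightarrow> complex. w x)"
      by (simp add: Vector_Spaces.linear_iff fun_scal_vector_space complex_vector_space fun_scal_def)
    show "\<forall>w\<in>pairing_tensors. (\<forall>x\<in>UNIV. w x = 0) \<longrightarrow> w = 0" by (auto simp: fun_eq_iff)
  qed (use that in blast)
qed

text \<open>
  Apolarity forces exactly one of \<open>a, a'\<close> and one of \<open>b, b'\<close> to be \<open>0\<close>. Let \<open>p\<close> and \<open>q\<close> be the other two.
  The syzygy conditions make the remaining tensor \<open>v p i q j\<close> antisymmetric in \<open>p, i\<close> and in \<open>q, j\<close>,
  and zero if \<open>i\<close> or \<open>j\<close> is \<open>0\<close>. The last condition makes it antisymmetric in \<open>i, j\<close>, because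
  \<open>x\<^sub>i x\<^sub>j\<close> with \<open>i, j \<noteq> 0\<close> is not in the net. An alternating tensor in four indices with
  three values is zero.
\<close>

lemma pairing_plane_point:
  assumes w: "w \<in> pairing_tensors" and 0: "\<And>z. pairing_contract plane_point_quartic w z = 0"
  shows "w = 0"
proof -
  note D = pairing_tensorsD[OF w]
  have ap: "apolar_matrix plane_point_quartic (\<lambda>a a'. w ((a, a', i), x))" for i x
    unfolding apolar_matrix_def
  proof (intro conjI allI)
    show "w ((a, a', i), x) = w ((a', a, i), x)" for a a' by (rule D(1))
    show "(\<Sum>a\<in>UNIV. \<Sum>a'\<in>UNIV. w ((a, a', i), x) * hess (pdiff a (pdiff a' plane_point_quartic)) k l) = 0" for k l
      using 0[of "(i, x, k, l)"] by (simp add: pairing_contract_def)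
  qed
  have "w ((a, a', i), x) = 0" if "(a = 0) = (a' = 0)" for a a' i x
  proof -
    have "w ((b, b, i), x) = 0" for b using apolar_diag(2)[OF ap] .
    moreover have "w ((1, 2, i), x) = 0" "w ((1, 3, i), x) = 0" "w ((2, 3, i), x) = 0"
      using ap[of i x] unfolding apolar_plane_point by blast+
    ultimately show ?thesis
      using that exhaust_4[of a] exhaust_4[of a'] D(1)[of 2 1 i x] D(1)[of 3 1 i x] D(1)[of 3 2 i x]
      by (elim disjE) simp_all
  qed
  note z = this
  have z': "w (x, (b, b', j)) = 0" if "(b = 0) = (b' = 0)" for b b' j x
    using D(2)[of x "(b, b', j)"] z[OF that, of j x] by simp
  define v where "v p i q j = w ((0, p, i), (0, q, j))" for p i q j
  have v1: "v p i q j = - v i p q j" if "p \<noteq> 0" "i \<noteq> 0" for p i q j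
    using D(3)[of 0 p i "(0, q, j)"] z[of p i 0 "(0, q, j)"] D(1)[of i 0 p "(0, q, j)"] that
    by (simp add: v_def eq_neg_iff_add_eq_0)
  have v10: "v p 0 q j = 0" if "p \<noteq> 0" for p q j
    using D(3)[of 0 p 0 "(0, q, j)"] z[of 0 0 p "(0, q, j)"] D(1)[of p 0 0 "(0, q, j)"] that
    by (simp add: v_def)
  have vs: "v p i q j = - v q j p i" for p i q j unfolding v_def by (rule D(2))
  have v2: "v p i q j = - v p i j q" if "q \<noteq> 0" "j \<noteq> 0" for p i q j
    using v1[OF that, of p i] vs[of p i q j] vs[of p i j q] by simp
  have v20: "v p i q 0 = 0" if "q \<noteq> 0" for p i q
    using v10[OF that, of p i] vs[of p i q 0] by simp
  have v3: "v p i q j = - v p j q i" if "i \<noteq> 0" "j \<noteq> 0" for p i q j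
    using D(4)[of 0 p i 0 q j] z'[of i j "(0, p, 0)" q] z'[of i j "(0, p, q)" 0] that
    by (simp add: v_def eq_neg_iff_add_eq_0)
  have v0: "v p i q j = 0" if p: "p \<noteq> 0" "q \<noteq> 0" for p i q j
  proof (cases "i = 0 \<or> j = 0")
    case True
    then show ?thesis using v10 v20 p by auto
  next
    case False
    then have ij: "i \<noteq> 0" "j \<noteq> 0" by auto
    \<comment> \<open>By antisymmetry a repeated index can be moved to a position where it gives zero.\<close>
    have e13: "v a b a c = 0" if "a \<noteq> 0" "b \<noteq> 0" "c \<noteq> 0" for a b c
      using v1[OF that(1,2), of a c] v3[OF that(1,3), of b a] v2[OF that(1,1), of b c] v1[of b c a a] that by simp
    have e12: "v a a b c = 0" if "a \<noteq> 0" for a b c using v1[OF that that, of b c] by simp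
    have e34: "v b c a a = 0" if "a \<noteq> 0" for a b c using v2[OF that that, of b c] by simp
    have e24: "v b a c a = 0" if "a \<noteq> 0" for a b c using v3[OF that that, of b c] by simp
    have e14: "v a b c a = 0" if "a \<noteq> 0" "b \<noteq> 0" for a b c using v1[OF that, of c a] e24[OF that(1)] by simp
    have e23: "v b a a c = 0" if "a \<noteq> 0" "c \<noteq> 0" for a b c using v2[OF that, of b a] e24[OF that(1)] by simp
    have "p = i \<or> p = q \<or> p = j \<or> i = q \<or> i = j \<or> q = j"
      using exhaust_4[of p] exhaust_4[of i] exhaust_4[of q] exhaust_4[of j] p ij by (elim disjE) simp_all
    then show ?thesis using e12 e13 e14 e23 e24 e34 p ij by auto
  qed
  have w0: "w ((0, p, i), (0, q, j)) = 0" for p i q j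
    using v0[of p q i j] z[of 0 p i] z'[of 0 q _ j] by (cases "p = 0 \<or> q = 0") (auto simp: v_def)
  have "w ((a, a', i), (b, b', j)) = 0" for a a' i b b' j
  proof (cases "(a = 0) = (a' = 0) \<or> (b = 0) = (b' = 0)")
    case True
    then show ?thesis using z z' by blast
  next
    case False
    have s: "w (x, (b, b', j)) = w (x, (b', b, j))" for x b b'
      using D(1)[of b b' j x] D(2)[of x "(b, b', j)"] D(2)[of x "(b', b, j)"] by simp
    from False consider "a = 0" "b = 0" | "a = 0" "b' = 0" | "a' = 0" "b = 0" | "a' = 0" "b' = 0" by blast
    then show ?thesis
    proof cases
      case 1 then show ?thesis using w0 by simp
    next
      case 2 then show ?thesis using w0 s[of "(a, a', i)" b b'] by simp
    next
      case 3 then show ?thesis using w0 D(1)[of a a' i] by simp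
    next
      case 4 then show ?thesis using w0 D(1)[of a a' i] s[of "(a', a, i)" b b'] by simp
    qed
  qed
  then show ?thesis by (auto simp: fun_eq_iff)
qed

text \<open>
  The tensor is \<open>K \<otimes> B - B \<otimes> K\<close>; it is not zero because its symmetrisation \<open>n\<^sub>1 \<and> n\<^sub>2 \<and> n\<^sub>3\<close> is not.
\<close>

lemma pairing_tensor_of_cross:
  assumes F: "F \<in> forms 4" and N: "contains_cross_net (apolar F \<inter> forms 2)"
  shows "\<exists>w\<in>pairing_tensors. w \<noteq> 0 \<and> (\<forall>z. pairing_contract F w z = 0)"
proof -
  obtain n1 n2 n3 k1 k2 k3 b1 b2 b3 where n: "n1 \<in> apolar F \<inter> forms 2" "n2 \<in> apolar F \<inter> forms 2" "n3 \<in> apolar F \<inter> forms 2"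
    and ind: "independent3 n1 n2 n3" and k: "k1 \<in> forms 1" "k2 \<in> forms 1" "k3 \<in> forms 1"
    and b: "b1 \<in> forms 1" "b2 \<in> forms 1" "b3 \<in> forms 1"
    and nkb: "n1 = k2 * b3 - k3 * b2" "n2 = k3 * b1 - k1 * b3" "n3 = k1 * b2 - k2 * b1"
    using N unfolding contains_cross_net_def by blast
  define K where "K l1 l2 l3 = (\<lambda>(a, a', i). hess n1 a a' * grad l1 i + hess n2 a a' * grad l2 i + hess n3 a a' * grad l3 i)"
    for l1 l2 l3
  define w :: "index6 \<Rightarrow> complex" where "w = (\<lambda>(x, y). K k1 k2 k3 x * K b1 b2 b3 y - K b1 b2 b3 x * K k1 k2 k3 y)"
  have cyc: "K l1 l2 l3 (a, a', i) + K l1 l2 l3 (a', i, a) + K l1 l2 l3 (i, a, a') = 0"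
    if l: "l1 \<in> forms 1" "l2 \<in> forms 1" "l3 \<in> forms 1" and 0: "l1 * n1 + l2 * n2 + l3 * n3 = 0" for l1 l2 l3 a a' i
  proof -
    have "third (l1 * n1 + l2 * n2 + l3 * n3) a a' i = 0" unfolding 0 by (rule third_simps)
    then have "K l1 l2 l3 (a, a', i) + K l1 l2 l3 (a', i, a) + K l1 l2 l3 (a, i, a') = 0"
      by (simp add: third_simps third_linear_mult l K_def algebra_simps)
    moreover have "K l1 l2 l3 (a, i, a') = K l1 l2 l3 (i, a, a')" by (simp add: K_def hess_sym[of _ a i])
    ultimately show ?thesis by simp
  qed
  have relk: "k1 * n1 + k2 * n2 + k3 * n3 = 0" and relb: "b1 * n1 + b2 * n2 + b3 * n3 = 0"
    unfolding nkb by (simp_all add: algebra_simps)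
  note cyck = cyc[OF k relk] and cycb = cyc[OF b relb]
  have hn: "hess n1 i j = grad k2 i * grad b3 j + grad k2 j * grad b3 i - grad k3 i * grad b2 j - grad k3 j * grad b2 i"
    "hess n2 i j = grad k3 i * grad b1 j + grad k3 j * grad b1 i - grad k1 i * grad b3 j - grad k1 j * grad b3 i"
    "hess n3 i j = grad k1 i * grad b2 j + grad k1 j * grad b2 i - grad k2 i * grad b1 j - grad k2 j * grad b1 i" for i j
    unfolding nkb by (simp_all add: hess_simps hess_linear_mult k b algebra_simps)
  define A where "A a a' c c' i j =
      hess n1 a a' * (hess n2 c c' * hess n3 i j - hess n3 c c' * hess n2 i j)
    + hess n2 a a' * (hess n3 c c' * hess n1 i j - hess n1 c c' * hess n3 i j)
    + hess n3 a a' * (hess n1 c c' * hess n2 i j - hess n2 c c' * hess n1 i j)" for a a' c c' i j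
  have A: "w ((a, a', i), (c, c', j)) + w ((a, a', j), (c, c', i)) = A a a' c c' i j" for a a' c c' i j
    unfolding A_def hn[of i j] w_def K_def by (simp add: algebra_simps)
  have "w \<in> pairing_tensors"
  proof (rule pairing_tensorsI)
    show "w ((a, a', i), x) = w ((a', a, i), x)" for a a' i x
      by (simp add: w_def K_def hess_sym[of _ a a'])
    show "w (x, y) = - w (y, x)" for x y by (simp add: w_def)
    show "w ((a, a', i), x) + w ((a', i, a), x) + w ((i, a, a'), x) = 0" for a a' i x
    proof -
      have "w ((a, a', i), x) + w ((a', i, a), x) + w ((i, a, a'), x)
        = (K k1 k2 k3 (a, a', i) + K k1 k2 k3 (a', i, a) + K k1 k2 k3 (i, a, a')) * K b1 b2 b3 x
        - (K b1 b2 b3 (a, a', i) + K b1 b2 b3 (a', i, a) + K b1 b2 b3 (i, a, a')) * K k1 k2 k3 x"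
        by (simp add: w_def algebra_simps)
      then show ?thesis unfolding cyck cycb by simp
    qed
    show "w ((a, a', i), (c, c', j)) + w ((a, a', j), (c, c', i))
        + w ((a, a', c), (i, j, c')) + w ((a, a', c'), (i, j, c)) = 0" for a a' i c c' j
    proof -
      have "A a a' c c' i j + A a a' i j c c' = 0" by (simp add: A_def algebra_simps)
      then show ?thesis unfolding A[symmetric] by (simp add: add.assoc)
    qed
  qed
  moreover have "w \<noteq> 0"
  proof
    assume "w = 0"
    then have A0: "A a a' c c' i j = 0" for a a' c c' i j unfolding A[symmetric] by simp
    have nf: "n1 \<in> forms 2" "n2 \<in> forms 2" "n3 \<in> forms 2" using n by auto
    have 1: "hess n2 c c' * hess n3 i j - hess n3 c c' * hess n2 i j = 0" for c c' i j
    proof -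
      have "scal (hess n2 c c' * hess n3 i j - hess n3 c c' * hess n2 i j) n1
        + scal (hess n3 c c' * hess n1 i j - hess n1 c c' * hess n3 i j) n2
        + scal (hess n1 c c' * hess n2 i j - hess n2 c c' * hess n1 i j) n3 = 0" (is "?q = 0")
      proof (rule form_2_eq_0)
        show "?q \<in> forms 2" by (intro forms_add forms_scal nf)
        show "hess ?q a a' = 0" for a a'
          using A0[of a a' c c' i j] unfolding A_def hess_simps by (simp add: mult.commute)
      qed
      then show ?thesis using ind unfolding independent3_def by blast
    qed
    have "hess n3 i j = 0" for i j
    proof -
      have "scal 0 n1 + scal (hess n3 i j) n2 + scal (- hess n2 i j) n3 = 0" (is "?q = 0")
      proof (rule form_2_eq_0)
        show "?q \<in> forms 2" by (intro forms_add forms_scal nf)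
        show "hess ?q c c' = 0" for c c'
          using 1[of c c' i j] by (simp add: hess_simps mult.commute)
      qed
      then show ?thesis using ind unfolding independent3_def by blast
    qed
    then have "n3 = 0" using form_2_eq_0[OF nf(3)] by blast
    then have "scal 0 n1 + scal 0 n2 + scal 1 n3 = 0" by simp
    then show False using ind unfolding independent3_def by (metis zero_neq_one)
  qed
  moreover have "pairing_contract F w z = 0" for z
  proof -
    obtain i x k l where z: "z = (i, x, k, l)" by (cases z) auto
    have 0: "(\<Sum>a\<in>UNIV. \<Sum>a'\<in>UNIV. hess q a a' * hess (pdiff a (pdiff a' F)) k l) = 0"
      if "q \<in> apolar F \<inter> forms 2" for q
      using that apolar_quadric_iff[OF _ F, of q] by blast
    have K0: "(\<Sum>a\<in>UNIV. \<Sum>a'\<in>UNIV. K l1 l2 l3 (a, a', i) * hess (pdiff a (pdiff a' F)) k l) = 0" for l1 l2 l3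
    proof -
      have "(\<Sum>a\<in>UNIV. \<Sum>a'\<in>UNIV. K l1 l2 l3 (a, a', i) * hess (pdiff a (pdiff a' F)) k l)
        = grad l1 i * (\<Sum>a\<in>UNIV. \<Sum>a'\<in>UNIV. hess n1 a a' * hess (pdiff a (pdiff a' F)) k l)
        + grad l2 i * (\<Sum>a\<in>UNIV. \<Sum>a'\<in>UNIV. hess n2 a a' * hess (pdiff a (pdiff a' F)) k l)
        + grad l3 i * (\<Sum>a\<in>UNIV. \<Sum>a'\<in>UNIV. hess n3 a a' * hess (pdiff a (pdiff a' F)) k l)"
        unfolding K_def by (simp add: sum_distrib_left sum.distrib[symmetric] algebra_simps)
      then show ?thesis using 0[OF n(1)] 0[OF n(2)] 0[OF n(3)] by simp
    qed
    have "pairing_contract F w z =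
       (\<Sum>a\<in>UNIV. \<Sum>a'\<in>UNIV. K k1 k2 k3 (a, a', i) * hess (pdiff a (pdiff a' F)) k l) * K b1 b2 b3 x
     - (\<Sum>a\<in>UNIV. \<Sum>a'\<in>UNIV. K b1 b2 b3 (a, a', i) * hess (pdiff a (pdiff a' F)) k l) * K k1 k2 k3 x"
      unfolding z pairing_contract_def w_def prod.case sum_distrib_right sum_subtractf[symmetric]
      by (intro sum.cong refl) (simp add: algebra_simps)
    then show ?thesis unfolding K0 by simp
  qed
  ultimately show ?thesis by blast
qed

lemma plane_point_not_in_closure_320: "point plane_point_quartic \<notin> zariski_closure (\<F> 3 2 0)"
proof -
  obtain B where B: "finite B" "Modules.module.span fun_scal B = pairing_tensors"
    by (rule pairing_tensors_span)
  show ?thesis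
    unfolding \<F>_def
  proof (rule not_in_zariski_closure[OF fun_scal_vector_space B pairing_contract_linear])
    show "w = 0" if "w \<in> pairing_tensors" "\<And>z. pairing_contract plane_point_quartic w z = 0" for w
      using pairing_plane_point[OF that] .
    show "betti_forms 3 2 0 \<subseteq> forms 4 - {0}" by (rule betti_forms_nonzero)
    show "\<exists>w\<in>pairing_tensors. w \<noteq> 0 \<and> (\<forall>z. pairing_contract F w z = 0)" if "F \<in> betti_forms 3 2 0" for F
      using pairing_tensor_of_cross[OF _ contains_cross_net_of_betti_320[OF that]] that by (simp add: betti_forms_def)
  qed
qed

section \<open>The non-containments\<close>

theorem proposition6p11:
  shows "\<not> \<F>_441b \<subseteq> zariski_closure (\<F> 5 5 0) \<and>
    \<not> \<F> 5 5 0 \<subseteq> zariski_closure \<F>_441a \<and>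
    \<not> \<F> 3 3 1 \<subseteq> zariski_closure (\<F> 4 2 0) \<and>
    \<not> \<F> 2 1 0 \<subseteq> zariski_closure \<F>_300a \<and>
    \<not> \<F> 3 3 1 \<subseteq> zariski_closure (\<F> 3 2 0)"
proof (intro conjI)
  have dim: "chain.dim (linear_strand 0 (apolar F)) = b12" "chain.dim (linear_strand 2 (apolar F)) = b34"
    if "F \<in> betti_forms b12 b23 b34" for F b12 b23 b34
    using that unfolding betti_forms_iff by blast+
  have in_stratum: "F \<in> betti_forms b12 b23 b34 \<Longrightarrow> point F \<in> \<F> b12 b23 b34" for F b12 b23 b34
    unfolding \<F>_def by blast
  have "point two_lines_quartic \<notin> zariski_closure (\<F> 5 5 0)"
    unfolding \<F>_def
  proof (rule quadrics_separate[OF graph_quartic_forms, of "{(0,2), (0,3), (1,2), (1,3)}"])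
    show "g = 0" if "apolar_matrix two_lines_quartic g" "\<forall>(i, j)\<in>{(0,2), (0,3), (1,2), (1,3)}. g i j = 0" for g
      using two_lines_pivots[OF that] .
    show "card ({(0,2), (0,3), (1,2), (1,3)} :: (4 \<times> 4) set) < chain.dim (linear_strand 0 (apolar F))"
      if "F \<in> betti_forms 5 5 0" for F using dim[OF that] by simp
  qed (simp_all add: betti_forms_nonzero)
  then show "\<not> \<F>_441b \<subseteq> zariski_closure (\<F> 5 5 0)" using two_lines_in_441b by blast
  have "point five_points_quartic \<notin> zariski_closure \<F>_441a"
    unfolding \<F>_441_rank_def
  proof (rule second_syzygies_separate[OF graph_quartic_forms])
    show "t = 0" if "second_syzygy five_points_quartic t" for t by (rule five_points_second_syzygy[OF that])
  qed (use betti_forms_nonzero[of 4 4 1] dim(2) in fastforce)+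
  then show "\<not> \<F> 5 5 0 \<subseteq> zariski_closure \<F>_441a" using in_stratum[OF betti_five_points] by blast
  have "point plane_point_quartic \<notin> zariski_closure (\<F> 4 2 0)"
    unfolding \<F>_def
  proof (rule quadrics_separate[OF graph_quartic_forms, of "{(0,1), (0,2), (0,3)}"])
    show "g = 0" if "apolar_matrix plane_point_quartic g" "\<forall>(i, j)\<in>{(0,1), (0,2), (0,3)}. g i j = 0" for g
      using plane_point_pivots[OF that] .
    show "card ({(0,1), (0,2), (0,3)} :: (4 \<times> 4) set) < chain.dim (linear_strand 0 (apolar F))"
      if "F \<in> betti_forms 4 2 0" for F using dim[OF that] by simp
  qed (simp_all add: betti_forms_nonzero)
  then show "\<not> \<F> 3 3 1 \<subseteq> zariski_closure (\<F> 4 2 0)" using in_stratum[OF betti_plane_point] by blast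
  have "point plane_line_quartic \<notin> zariski_closure \<F>_300a"
    unfolding \<F>_300a_def
  proof (rule quadrics_separate[OF graph_quartic_forms, of "{(0,1), (0,2)}"])
    show "g = 0" if "apolar_matrix plane_line_quartic g" "\<forall>(i, j)\<in>{(0,1), (0,2)}. g i j = 0" for g
      using plane_line_pivots[OF that] .
    show "card ({(0,1), (0,2)} :: (4 \<times> 4) set) < chain.dim (linear_strand 0 (apolar F))"
      if "F \<in> {F \<in> betti_forms 3 0 0. complete_intersection_of_quadrics 3 (quadric_ideal F) \<and> min_apolar_length F 8}" for F
      using dim[of F 3 0 0] that by simp
  qed (use betti_forms_nonzero[of 3 0 0] in auto)
  then show "\<not> \<F> 2 1 0 \<subseteq> zariski_closure \<F>_300a" using in_stratum[OF betti_plane_line] by blast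
  show "\<not> \<F> 3 3 1 \<subseteq> zariski_closure (\<F> 3 2 0)"
    using plane_point_not_in_closure_320 in_stratum[OF betti_plane_point] by blast
qed

end
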